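(* For every (possibly infinite) digraph $D$ there is a reversion sequence $\mathcal{C}\in\mathbb{RS}(D)$ (so that each edge is reversed only finitely often) such that $\chi(D\circlearrowleft\mathcal{C})\le 2$.
   Context: Graphs may be infinite and may have multiple edges but no loops; an undirected graph is a set of edges and its vertex set is the set of end vertices of its edges. A digraph $D$ is an orientation of an undirected graph $\mathsf{Un}(D)$, and $V(D)$ is the vertex set of $\mathsf{Un}(D)$. For $E\subseteq \mathsf{Un}(D)$, $D(E)$ denotes the set of $D$-oriented elements of $E$. Cycles and paths are finite and directed; a cycle has at least two edges and no repeated vertices. Limit: if $\langle D_\xi:\xi<\alpha\rangle$ is a sequence of orientations of a graph $G$ such that for each $e\in G$ there is $\xi_e<\alpha$ with $D_\xi(e)=D_{\xi_e}(e)$ for all $\xi\ge\xi_e$, its limit is the orientation $D^*$ with $D^*(e)=D_{\xi_e}(e)$; otherwise it has no limit. Reversion sequences: the set $\mathbb{RS}(D)$ of transfinite sequences $\mathcal{C}=\langle C_\xi:\xi<\alpha\rangle$ and the reorientation $D\circlearrowleft\mathcal{C}$ of $D$ are defined by recursion on the ordinal $\alpha$. If $\alpha=0$, then $\mathcal{C}\in\mathbb{RS}(D)$ and $D\circlearrowleft\mathcal{C}=D$. If $\alpha=\beta+1$, then $\mathcal{C}\in\mathbb{RS}(D)$ iff $\mathcal{C}\upharpoonright\beta\in\mathbb{RS}(D)$ and $C_\beta$ is a directed cycle in $D\circlearrowleft(\mathcal{C}\upharpoonright\beta)$; then $D\circlearrowleft\mathcal{C}$ is obtained from $D\circlearrowleft(\mathcal{C}\upharpoonright\beta)$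 by reversing each edge of $C_\beta$. If $\alpha$ is a limit ordinal, then $\mathcal{C}\in\mathbb{RS}(D)$ iff $\mathcal{C}\upharpoonright\beta\in\mathbb{RS}(D)$ for all $\beta<\alpha$ and $\langle D\circlearrowleft(\mathcal{C}\upharpoonright\beta):\beta<\alpha\rangle$ has a limit, which is then $D\circlearrowleft\mathcal{C}$. (If $\mathcal{C}\in\mathbb{RS}(D)$ then each edge has an orientation lying in only finitely many of the $C_\xi$.) The dichromatic number $\chi(D)$ is the smallest cardinal $\kappa$ such that $V(D)$ can be coloured with $\kappa$ many colours without monochromatic directed cycles. *)

theory Defs
  imports "Graph_Theory.Arc_Walk"
begin

unbundle cardinal_syntax

text \<open>
  Digraphs are \<^typ>\<open>('v, 'e) pre_digraph\<close> records, so that parallel and antiparallel arcs are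
  allowed and nothing has to be finite. The arc set is the underlying undirected graph, and an
  orientation of it is given by the functions \<^const>\<open>tail\<close> and \<^const>\<open>head\<close>; in particular an
  element of the arc set is an undirected edge, and it keeps its name when it is reversed.

  Directed cycles are those of \<^const>\<open>pre_digraph.cycle\<close>: nonempty closed arc walks without
  repeated vertices, given as the list of their arcs. In a loopfree digraph they have at least two
  arcs.
\<close>

definition no_isolated_verts :: "('v, 'e) pre_digraph \<Rightarrow> bool" where
  "no_isolated_verts D \<longleftrightarrow> verts D = tail D ` arcs D \<union> head D ` arcs D"

definition reverse_arcs :: "('v, 'e) pre_digraph \<Rightarrow> 'e set \<Rightarrow> ('v, 'e) pre_digraph" where
  "reverse_arcs D A = D\<lparr>tail := (\<lambda>e. if e \<in> A then head D e else tail D e),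
                        head := (\<lambda>e. if e \<in> A then tail D e else head D e)\<rparr>"

text \<open>
  The limit of a sequence of orientations indexed by the elements of a well-order \<open>r\<close>. The values
  of \<^const>\<open>tail\<close> and \<^const>\<open>head\<close> outside the arc set carry no information and are the same for all
  the orientations considered here. The condition is imposed on them too so that the limit is
  unique as a record.
\<close>

definition is_limit_orientation ::
    "'i rel \<Rightarrow> ('i \<Rightarrow> ('v, 'e) pre_digraph) \<Rightarrow> ('v, 'e) pre_digraph \<Rightarrow> bool" where
  "is_limit_orientation r F L \<longleftrightarrow>
     (\<forall>\<xi>\<in>Field r. verts (F \<xi>) = verts L \<and> arcs (F \<xi>) = arcs L) \<and>
     (\<forall>e. \<exists>\<xi>\<^sub>0\<in>Field r. \<forall>\<xi>. (\<xi>\<^sub>0, \<xi>) \<in> r \<longrightarrow>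
        tail (F \<xi>) e = tail L e \<and> head (F \<xi>) e = head L e)"

text \<open>
  Reversion sequences. An ordinal \<open>\<alpha>\<close> is represented by a (reflexive) well-order \<open>r\<close> of type \<open>\<alpha>\<close>,
  an element \<open>\<beta>\<close> of \<open>\<alpha>\<close> by an element of \<^term>\<open>Field r\<close>, and the ordinal \<open>\<beta>\<close> itself by the
  restriction of \<open>r\<close> to the predecessors of that element. Only the values of \<open>C\<close> on \<^term>\<open>Field r\<close>
  matter. \<open>reverts D C r D'\<close> says that the sequence \<open>C\<close> of length \<open>r\<close> is a reversion sequence of \<open>D\<close>
  and that \<open>D'\<close> is the resulting reorientation of \<open>D\<close>.
\<close>

definition below :: "'i rel \<Rightarrow> 'i \<Rightarrow> 'i rel" where
  "below r \<beta> = Restr r (underS r \<beta>)"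

inductive reverts ::
    "('v, 'e) pre_digraph \<Rightarrow> ('i \<Rightarrow> 'e list) \<Rightarrow> 'i rel \<Rightarrow> ('v, 'e) pre_digraph \<Rightarrow> bool"
  for D :: "('v, 'e) pre_digraph" and C :: "'i \<Rightarrow> 'e list" where
  zero: "reverts D C {} D"
| succ: "reverts D C r (reverse_arcs D' (set (C \<beta>)))"
    if "Well_order r" "\<beta> \<in> Field r" "\<forall>\<xi>\<in>Field r. (\<xi>, \<beta>) \<in> r"
       "reverts D C (below r \<beta>) D'" "pre_digraph.cycle D' (C \<beta>)"
| limit: "reverts D C r L"
    if "Well_order r" "Field r \<noteq> {}" "\<forall>\<beta>\<in>Field r. \<exists>\<xi>\<in>Field r. (\<xi>, \<beta>) \<notin> r"
       "\<forall>\<beta>\<in>Field r. reverts D C (below r \<beta>) (F \<beta>)" "is_limit_orientation r F L"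

text \<open>The vertices of a cycle are the tails of its arcs.\<close>

definition dicolouring :: "('v, 'e) pre_digraph \<Rightarrow> ('v \<Rightarrow> 'c) \<Rightarrow> bool" where
  "dicolouring D c \<longleftrightarrow>
     (\<forall>p. pre_digraph.cycle D p \<longrightarrow> \<not> (\<exists>k. \<forall>v \<in> tail D ` set p. c v = k))"

definition dicolourable :: "('v, 'e) pre_digraph \<Rightarrow> 'c set \<Rightarrow> bool" where
  "dicolourable D K \<longleftrightarrow> (\<exists>c. c ` verts D \<subseteq> K \<and> dicolouring D c)"

text \<open>
  The least cardinal in the sense of \<^const>\<open>ordLeq\<close>, which is determined up to \<^const>\<open>ordIso\<close>. If \<open>D\<close>
  is loopfree, colouring every vertex by itself has no monochromatic cycle, so that cardinals on
  the type of the vertices suffice.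
\<close>

definition dichromatic_number :: "('v, 'e) pre_digraph \<Rightarrow> 'v rel" where
  "dichromatic_number D =
     (SOME \<kappa>. Card_order \<kappa> \<and> dicolourable D (Field \<kappa>) \<and>
        (\<forall>\<kappa>' :: 'v rel. Card_order \<kappa>' \<and> dicolourable D (Field \<kappa>') \<longrightarrow> \<kappa> \<le>o \<kappa>'))"

lemma dicolouring_if_inj:
  assumes "loopfree_digraph D" "inj_on c (verts D)"
  shows "dicolouring D c"
  unfolding dicolouring_def
proof (intro allI impI notI)
  fix p assume p: "pre_digraph.cycle D p" and "\<exists>k. \<forall>v\<in>tail D ` set p. c v = k"
  then obtain k where k: "\<forall>v\<in>tail D ` set p. c v = k" by blast
  interpret loopfree_digraph D by fact
  obtain u where w: "awalk u p u" "2 \<le> length p"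
    using p cycle_digraph_conv by blast
  then obtain e f q where pq: "p = e # f # q"
    by (cases p; cases "tl p") auto
  have ef: "e \<in> arcs D" "f \<in> arcs D" "head D e = tail D f"
    using w pq by (auto simp: awalk_def)
  then have "c (tail D e) = c (tail D f)" using k pq by simp
  then have "tail D e = tail D f"
    using assms(2) ef by (auto simp: inj_on_def)
  with ef no_loops show False by metis
qed

lemma dichromatic_number_spec:
  fixes D :: "('v, 'e) pre_digraph"
  assumes "loopfree_digraph D"
  shows "Card_order (dichromatic_number D)" "dicolourable D (Field (dichromatic_number D))"
    "\<And>\<kappa>' :: 'v rel. Card_order \<kappa>' \<Longrightarrow> dicolourable D (Field \<kappa>') \<Longrightarrow> dichromatic_number D \<le>o \<kappa>'"
proof -
  let ?R = "{\<kappa> :: 'v rel. Card_order \<kappa> \<and> dicolourable D (Field \<kappa>)}"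
  have "dicolouring D (id :: 'v \<Rightarrow> 'v)" using assms by (intro dicolouring_if_inj) auto
  then have "|UNIV :: 'v set| \<in> ?R" unfolding dicolourable_def
    by (auto simp: Field_card_of card_of_card_order_on)
  then have "\<exists>\<kappa>\<in>?R. \<forall>\<kappa>'\<in>?R. \<kappa> \<le>o \<kappa>'" by (intro exists_minim_Card_order) blast+
  then have "\<exists>\<kappa> :: 'v rel. Card_order \<kappa> \<and> dicolourable D (Field \<kappa>) \<and>
        (\<forall>\<kappa>' :: 'v rel. Card_order \<kappa>' \<and> dicolourable D (Field \<kappa>') \<longrightarrow> \<kappa> \<le>o \<kappa>')" by auto
  from someI_ex[OF this]
  show "Card_order (dichromatic_number D)" "dicolourable D (Field (dichromatic_number D))"
    "\<And>\<kappa>' :: 'v rel. Card_order \<kappa>' \<Longrightarrow> dicolourable D (Field \<kappa>') \<Longrightarrow> dichromatic_number D \<le>o \<kappa>'"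
    unfolding dichromatic_number_def by blast+
qed

lemma dicolouring_comp:
  assumes D: "wf_digraph D" and c: "dicolouring D c" and g: "inj_on g (c ` verts D)"
  shows "dicolouring D (g \<circ> c)"
  unfolding dicolouring_def
proof (intro allI impI notI)
  fix p assume p: "pre_digraph.cycle D p" and "\<exists>k. \<forall>v\<in>tail D ` set p. (g \<circ> c) v = k"
  then obtain k where k: "\<forall>v\<in>tail D ` set p. g (c v) = k" unfolding comp_def by blast
  interpret wf_digraph D by fact
  have sub: "set p \<subseteq> arcs D" and ne: "p \<noteq> []" using p by (auto simp: cycle_def awalk_def)
  have "c v = c (tail D (hd p))" if v: "v \<in> tail D ` set p" for v
  proof (rule inj_onD[OF g])
    have "hd p \<in> set p" using ne by simp
    then show "g (c v) = g (c (tail D (hd p)))" using bspec[OF k v] bspec[OF k, of "tail D (hd p)"] by simp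
    show "c v \<in> c ` verts D" "c (tail D (hd p)) \<in> c ` verts D"
      using v sub \<open>hd p \<in> set p\<close> by auto
  qed
  then have "\<exists>k. \<forall>v\<in>tail D ` set p. c v = k" by blast
  then show False using c[unfolded dicolouring_def, rule_format, OF p] by contradiction
qed

lemma dichromatic_number_le_iff:
  assumes "loopfree_digraph D"
  shows "dichromatic_number D \<le>o |K| \<longleftrightarrow> dicolourable D K"
proof
  interpret loopfree_digraph D by fact
  have wf: "wf_digraph D" by unfold_locales
  note s = dichromatic_number_spec[OF assms]
  { assume "dichromatic_number D \<le>o |K|"
    then have "|Field (dichromatic_number D)| \<le>o |K|"
      using ordIso_ordLeq_trans[OF card_of_Field_ordIso[OF s(1)]] by blast
    then obtain g where g: "inj_on g (Field (dichromatic_number D))"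
      "g ` Field (dichromatic_number D) \<subseteq> K"
      unfolding card_of_ordLeq[symmetric] by blast
    obtain c where c: "c ` verts D \<subseteq> Field (dichromatic_number D)" "dicolouring D c"
      using s(2) unfolding dicolourable_def by blast
    have "dicolouring D (g \<circ> c)" by (rule dicolouring_comp[OF wf c(2) inj_on_subset[OF g(1) c(1)]])
    then show "dicolourable D K" unfolding dicolourable_def using g(2) c(1)
      by (intro exI[of _ "g \<circ> c"]) auto
  next
    assume "dicolourable D K"
    then obtain c where c: "c ` verts D \<subseteq> K" "dicolouring D c" unfolding dicolourable_def by blast
    have "|c ` verts D| \<le>o |verts D|" by (rule card_of_image)
    then obtain g where g: "inj_on g (c ` verts D)" "g ` c ` verts D \<subseteq> verts D"
      unfolding card_of_ordLeq[symmetric] by blast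
    have "dicolouring D (g \<circ> c)" using dicolouring_comp[OF wf c(2) g(1)] .
    then have "dicolourable D (Field |g ` c ` verts D| )"
      unfolding dicolourable_def by (auto simp: Field_card_of intro!: exI[of _ "g \<circ> c"])
    then have "dichromatic_number D \<le>o |g ` c ` verts D|" by (intro s(3) card_of_Card_order)
    also have "|g ` c ` verts D| \<le>o |c ` verts D|" by (rule card_of_image)
    also have "|c ` verts D| \<le>o |K|" using c(1) by (rule card_of_mono1)
    finally show "dichromatic_number D \<le>o |K|" . }
qed

lemma Field_below: "Well_order r \<Longrightarrow> Field (below r \<beta>) = underS r \<beta>"
  unfolding below_def by (rule Refl_Field_Restr2)
    (auto simp: order_on_defs underS_def Field_def)

lemma reverts_Well_order: "reverts D C r D' \<Longrightarrow> Well_order r"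
  by (induction rule: reverts.induct) auto

lemma below_below:
  assumes "Well_order r" "(\<xi>, \<beta>) \<in> r" "\<xi> \<noteq> \<beta>"
  shows "below (below r \<beta>) \<xi> = below r \<xi>"
proof -
  have t: "trans r" "antisym r" using assms(1) by (auto simp: order_on_defs)
  have "(x, \<beta>) \<in> r" if "(x,\<xi>) \<in> r" for x using t(1) that assms(2) by (rule transD)
  moreover have "x \<noteq> \<beta>" if "(x,\<xi>) \<in> r" for x using that assms(2,3) t(2) by (meson antisymD)
  ultimately have 1: "underS r \<xi> \<subseteq> underS r \<beta>" unfolding underS_def by blast
  have "underS (below r \<beta>) \<xi> = underS r \<xi>"
    using 1 assms(2,3) unfolding below_def by (auto simp: underS_def)
  then show ?thesis using 1 unfolding below_def[of "below r \<beta>"] unfolding below_def by blast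
qed

lemma reverts_underlying:
  "reverts D C r D' \<Longrightarrow> verts D' = verts D \<and> arcs D' = arcs D \<and>
     (\<forall>e. {tail D' e, head D' e} = {tail D e, head D e})"
proof (induction rule: reverts.induct)
  case zero then show ?case by simp
next
  case (succ r \<beta> D') then show ?case by (auto simp: reverse_arcs_def)
next
  case (limit r F L)
  obtain b where b: "b \<in> Field r" using limit by blast
  have "{tail L e, head L e} = {tail D e, head D e}" for e
  proof -
    obtain x where "x\<in>Field r" "\<forall>\<xi>. (x, \<xi>) \<in> r \<longrightarrow>
        tail (F \<xi>) e = tail L e \<and> head (F \<xi>) e = head L e"
      using limit unfolding is_limit_orientation_def by blast
    moreover have "(x,x) \<in> r" using calculation(1) limit(1)
      by (auto simp: well_order_on_def linear_order_on_def partial_order_on_def preorder_on_def refl_on_def)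
    moreover have "{tail (F x) e, head (F x) e} = {tail D e, head D e}"
      using limit.IH \<open>x \<in> Field r\<close> by blast
    ultimately show ?thesis by auto
  qed
  moreover have "verts L = verts D \<and> arcs L = arcs D"
    using limit.IH limit.hyps b unfolding is_limit_orientation_def by auto
  ultimately show ?case by blast
qed

lemma is_limit_unique:
  assumes w: "Well_order r" and 1: "is_limit_orientation r F L" and 2: "is_limit_orientation r F' L'"
    and eq: "\<forall>\<beta>\<in>Field r. F \<beta> = F' \<beta>" and ne: "Field r \<noteq> {}"
  shows "verts L = verts L' \<and> arcs L = arcs L' \<and> tail L = tail L' \<and> head L = head L'"
proof -
  obtain b where b: "b \<in> Field r" using ne by blast
  have "tail L e = tail L' e \<and> head L e = head L' e" for e
  proof -
    obtain x where x: "x\<in>Field r" "\<forall>\<xi>. (x, \<xi>) \<in> r \<longrightarrow>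
        tail (F \<xi>) e = tail L e \<and> head (F \<xi>) e = head L e"
      using 1 unfolding is_limit_orientation_def by blast
    obtain y where y: "y\<in>Field r" "\<forall>\<xi>. (y, \<xi>) \<in> r \<longrightarrow>
        tail (F' \<xi>) e = tail L' e \<and> head (F' \<xi>) e = head L' e"
      using 2 unfolding is_limit_orientation_def by blast
    have "\<exists>z\<in>Field r. (x,z)\<in>r \<and> (y,z)\<in>r" using x(1) y(1) w
      by (metis wo_rel.REFL wo_rel.TOTALS wo_rel.intro refl_onD)
    then show ?thesis using x y eq by metis
  qed
  then show ?thesis using b eq 1 2 unfolding is_limit_orientation_def by auto
qed

lemma reverts_unique: "reverts D C r D' \<Longrightarrow> reverts D C r D'' \<Longrightarrow> D'' = D'"
proof (induction arbitrary: D'' rule: reverts.induct)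
  case zero
  from zero show ?case by cases auto
next
  case (succ r \<beta> D')
  note h = succ.hyps and ih = succ.IH
  from \<open>reverts D C r D''\<close> consider "r = {}"
    | \<gamma> E where "D'' = reverse_arcs E (set (C \<gamma>))" "\<gamma> \<in> Field r" "\<forall>\<xi>\<in>Field r. (\<xi>, \<gamma>) \<in> r"
       "reverts D C (below r \<gamma>) E"
    | "\<forall>\<beta>\<in>Field r. \<exists>\<xi>\<in>Field r. (\<xi>, \<beta>) \<notin> r"
    by (cases rule: reverts.cases) blast+
  then show ?case
  proof cases
    case 1
    then have "Field r = {}" by simp
    then show ?thesis using h(2) by blast
  next
    case 2
    have "(\<gamma>,\<beta>) \<in> r" "(\<beta>,\<gamma>) \<in> r" using 2 h by blast+
    then have "\<gamma> = \<beta>" using wo_rel.ANTISYM[OF wo_rel.intro[OF h(1)]] by (meson antisymD)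
    then show ?thesis using 2 ih by blast
  next
    case 3
    then show ?thesis using h by blast
  qed
next
  case (limit r F L)
  note h = limit.hyps and ih = limit.IH
  from \<open>reverts D C r D''\<close> consider "r = {}"
    | \<gamma> where "\<gamma> \<in> Field r" "\<forall>\<xi>\<in>Field r. (\<xi>, \<gamma>) \<in> r"
    | F' where "\<forall>\<beta>\<in>Field r. reverts D C (below r \<beta>) (F' \<beta>)" "is_limit_orientation r F' D''"
    by (cases rule: reverts.cases) blast+
  then show ?case
  proof cases
    case 1
    then have "Field r = {}" by simp
    then show ?thesis using h(2) by blast
  next
    case 2
    then show ?thesis using h by blast
  next
    case 3
    then have "\<forall>\<beta>\<in>Field r. F' \<beta> = F \<beta>" using ih by blast
    from is_limit_unique[OF h(1) 3(2) h(4) this h(2)] show ?thesis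
      by (simp add: pre_digraph.equality)
  qed
qed

lemma reverts_no_loops:
  assumes "loopfree_digraph D" "reverts D C r D'" "e \<in> arcs D"
  shows "tail D' e \<noteq> head D' e"
proof -
  have "{tail D' e, head D' e} = {tail D e, head D e}"
    using reverts_underlying[OF assms(2)] by blast
  then show ?thesis using loopfree_digraph.no_loops[OF assms(1,3)] by auto
qed

lemma reverts_below:
  assumes "reverts D C r D'" "\<beta> \<in> Field r"
  shows "\<exists>E. reverts D C (below r \<beta>) E \<and> pre_digraph.cycle E (C \<beta>)"
  using assms
proof (induction arbitrary: \<beta> rule: reverts.induct)
  case zero then show ?case by simp
next
  case (succ r \<gamma> D')
  show ?case
  proof (cases "\<beta> = \<gamma>")
    case True then show ?thesis using succ by blast
  next
    case False
    then have "(\<beta>,\<gamma>) \<in> r" using succ by blast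
    moreover from this False have "\<beta> \<in> Field (below r \<gamma>)"
      by (simp add: Field_below[OF succ.hyps(1)] underS_def)
    ultimately show ?thesis using succ.IH[of \<beta>] below_below[OF succ.hyps(1), of \<beta> \<gamma>] False by simp
  qed
next
  case (limit r F L)
  then obtain \<gamma> where g: "\<gamma> \<in> Field r" "(\<gamma>,\<beta>) \<notin> r" by blast
  then have "(\<beta>,\<gamma>) \<in> r" "\<beta> \<noteq> \<gamma>" using limit.hyps limit.prems
    by (metis wo_rel.TOTALS wo_rel.intro, metis wo_rel.TOTALS wo_rel.intro)
  moreover from this have "\<beta> \<in> Field (below r \<gamma>)"
    by (simp add: Field_below[OF limit.hyps(1)] underS_def)
  ultimately show ?case using limit.IH g(1) below_below[OF limit.hyps(1), of \<beta> \<gamma>] by metis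
qed

lemma reverts_finite:
  assumes D: "loopfree_digraph D" and "reverts D C r D'" and e: "e \<in> arcs D"
  shows "finite {\<xi>\<in>Field r. e \<in> set (C \<xi>)}"
  using assms(2)
proof (induction rule: reverts.induct)
  case zero then show ?case by simp
next
  case (succ r \<beta> D')
  have "{\<xi>\<in>Field r. e \<in> set (C \<xi>)} \<subseteq> insert \<beta> {\<xi>\<in>Field (below r \<beta>). e \<in> set (C \<xi>)}"
    using succ.hyps(3) by (auto simp: Field_below[OF succ.hyps(1)] Order_Relation.underS_def)
  then show ?case using succ.IH finite_subset by blast
next
  case (limit r F L)
  interpret wo_rel r using limit.hyps(1) by (rule wo_rel.intro)
  obtain x where x: "x\<in>Field r" "\<And>\<xi>. (x, \<xi>) \<in> r \<Longrightarrow> tail (F \<xi>) e = tail L e"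
    using limit unfolding is_limit_orientation_def by blast
  have "{\<xi>\<in>Field r. e \<in> set (C \<xi>)} \<subseteq> {\<xi>\<in>Field (below r x). e \<in> set (C \<xi>)}"
  proof (intro subsetI CollectI, elim CollectE conjE, rule ccontr)
    fix \<xi> assume xi: "\<xi> \<in> Field r" "e \<in> set (C \<xi>)"
      and "\<not> (\<xi> \<in> Field (below r x) \<and> e \<in> set (C \<xi>))"
    then have "(x,\<xi>) \<in> r" using x(1) TOTALS REFL
      by (auto simp: Field_below[OF limit.hyps(1)] Order_Relation.underS_def refl_on_def)
    define y where "y = suc {\<xi>}"
    obtain z where z: "z \<in> Field r" "(z,\<xi>) \<notin> r" using limit.hyps(3) xi by blast
    have ab: "\<exists>z. z \<in> AboveS {\<xi>}" using z xi TOTALS REFL unfolding AboveS_def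
      by (auto simp: refl_on_def)
    have y: "(\<xi>,y) \<in> r" "y \<noteq> \<xi>" "y \<in> Field r"
      using suc_greater[of "{\<xi>}" \<xi>] suc_inField[of "{\<xi>}"] ab xi unfolding y_def by auto
    have uS: "Order_Relation.underS r y = insert \<xi> (Order_Relation.underS r \<xi>)"
    proof -
      have "(w,\<xi>) \<in> r" if "(w,y) \<in> r" "w \<noteq> y" for w
      proof (rule ccontr)
        assume "(w,\<xi>) \<notin> r"
        moreover have w: "w \<in> Field r" using that by (auto simp: Field_def)
        ultimately have "w \<in> AboveS {\<xi>}" using xi TOTALS REFL unfolding AboveS_def
          by (auto simp: refl_on_def)
        then have "(y,w) \<in> r" unfolding y_def by (rule suc_least_AboveS)
        then show False using that ANTISYM by (auto dest: antisymD)
      qed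
      moreover have "(w,y) \<in> r" "w \<noteq> y" if "(w,\<xi>) \<in> r" "w \<noteq> \<xi>" for w
        using that y TRANS ANTISYM by (auto dest: antisymD transD)
      ultimately show ?thesis using y unfolding Order_Relation.underS_def by auto
    qed
    have rF: "reverts D C (below r y) (F y)" "reverts D C (below r \<xi>) (F \<xi>)" 
      using limit.IH y xi by auto
    have wb: "Well_order (below r y)" using rF reverts_Well_order by blast
    have fy: "Field (below r y) = insert \<xi> (Order_Relation.underS r \<xi>)" using uS by (simp add: Field_below[OF limit.hyps(1)])
    have top: "\<forall>w\<in>Field (below r y). (w,\<xi>) \<in> below r y" 
      unfolding fy using uS xi REFL unfolding below_def by (auto simp: Order_Relation.underS_def refl_on_def)
    have bb: "below (below r y) \<xi> = below r \<xi>" using below_below[OF limit.hyps(1) y(1)] y(2) by simp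
    obtain E where "reverts D C (below r \<xi>) E" "pre_digraph.cycle E (C \<xi>)"
      using reverts_below[OF rF(1), of \<xi>] fy bb by auto
    then have cy: "pre_digraph.cycle (F \<xi>) (C \<xi>)" using reverts_unique rF(2) by blast
    have "reverts D C (below r y) (reverse_arcs (F \<xi>) (set (C \<xi>)))"
      using reverts.succ[of "below r y" \<xi> D C "F \<xi>"] wb fy top bb rF(2) cy by simp
    then have "F y = reverse_arcs (F \<xi>) (set (C \<xi>))" using reverts_unique rF(1) by blast
    then have "tail (F y) e = head (F \<xi>) e" using xi(2) by (simp add: reverse_arcs_def)
    moreover have "(x,y) \<in> r" using TRANS \<open>(x,\<xi>) \<in> r\<close> y(1) by (rule transD)
    ultimately have "tail (F \<xi>) e = head (F \<xi>) e" using x(2) \<open>(x,\<xi>) \<in> r\<close> by metis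
    then show False using reverts_no_loops[OF D rF(2) e] by simp
  qed
  then show ?case using limit.IH x(1) finite_subset by blast
qed

lemma mem_dir_image:
  assumes "inj_on f (Field r)" "a \<in> Field r" "b \<in> Field r"
  shows "(f a, f b) \<in> dir_image r f \<longleftrightarrow> (a,b) \<in> r"
proof
  assume "(f a, f b) \<in> dir_image r f"
  then obtain c d where cd: "f a = f c" "f b = f d" "(c,d) \<in> r" unfolding dir_image_def by blast
  then have "c \<in> Field r" "d \<in> Field r" by (auto simp: Field_def)
  then show "(a,b) \<in> r" using assms cd by (metis inj_onD)
qed (auto simp: dir_image_def)

lemma below_dir_image:
  assumes "Well_order r" "inj_on f (Field r)" "\<beta> \<in> Field r"
  shows "below (dir_image r f) (f \<beta>) = dir_image (below r \<beta>) f" (is "?L = ?R")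
proof
  have us: "f a \<in> underS (dir_image r f) (f \<beta>) \<longleftrightarrow> a \<in> underS r \<beta>" if "a \<in> Field r" for a
    using mem_dir_image[OF assms(2) that assms(3)] that assms(2,3)
    by (auto simp: underS_def inj_on_def)
  show "?L \<subseteq> ?R"
  proof
    fix p assume p: "p \<in> ?L"
    then obtain a b where ab: "p = (f a, f b)" "(a,b) \<in> r" unfolding below_def dir_image_def by blast
    then have "a \<in> Field r" "b \<in> Field r" by (auto simp: Field_def)
    then show "p \<in> ?R" using p ab us unfolding below_def by (auto simp: dir_image_def)
  qed
  show "?R \<subseteq> ?L"
  proof
    fix p assume p: "p \<in> ?R"
    then obtain a b where ab: "p = (f a, f b)" "(a,b) \<in> r" "a \<in> underS r \<beta>" "b \<in> underS r \<beta>"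
      unfolding below_def dir_image_def by blast
    then have "a \<in> Field r" "b \<in> Field r" by (auto simp: Field_def)
    then show "p \<in> ?L" using ab us unfolding below_def by (auto simp: dir_image_def)
  qed
qed

lemma Field_dir_image: "Field (dir_image r f) = f ` Field r"
  by (rule dir_image_Field)

lemma reverts_reindex:
  assumes "reverts D C r D'" "inj_on f (Field r)" "\<forall>\<xi>\<in>Field r. C' (f \<xi>) = C \<xi>"
  shows "reverts D C' (dir_image r f) D'"
  using assms
proof (induction rule: reverts.induct)
  case zero then show ?case using reverts.zero by (simp add: dir_image_def)
next
  case (succ r \<beta> D')
  have sub: "Field (below r \<beta>) \<subseteq> Field r" by (auto simp: below_def Field_def)
  have "reverts D C' (dir_image (below r \<beta>) f) D'"
    using succ.IH succ.prems sub by (meson inj_on_subset subset_iff)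
  moreover have "\<forall>\<xi>\<in>Field (dir_image r f). (\<xi>, f \<beta>) \<in> dir_image r f"
    using succ.hyps mem_dir_image[OF succ.prems(1)] unfolding Field_dir_image by blast
  moreover have "Well_order (dir_image r f)" using Well_order_dir_image succ by blast
  moreover have "f \<beta> \<in> Field (dir_image r f)" using succ.hyps(2) by (simp add: Field_dir_image)
  moreover have eq: "C' (f \<beta>) = C \<beta>" using succ.prems(2) succ.hyps(2) by blast
  ultimately have "reverts D C' (dir_image r f) (reverse_arcs D' (set (C' (f \<beta>))))"
    using reverts.succ[of "dir_image r f" "f \<beta>" D C' D']
      below_dir_image[OF succ.hyps(1) succ.prems(1) succ.hyps(2)] succ.hyps(5) by metis
  then show ?case unfolding eq .
next
  case (limit r F L)
  define F' where "F' = F \<circ> inv_into (Field r) f"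
  have F': "F' (f \<beta>) = F \<beta>" if "\<beta> \<in> Field r" for \<beta> using that limit.prems(1) by (simp add: F'_def)
  have sub: "Field (below r \<beta>) \<subseteq> Field r" for \<beta> by (auto simp: below_def Field_def)
  have 1: "Well_order (dir_image r f)" using Well_order_dir_image limit by blast
  have iff: "(f a, f b) \<in> dir_image r f \<longleftrightarrow> (a,b) \<in> r" if "a \<in> Field r" "b \<in> Field r" for a b
    using mem_dir_image[OF limit.prems(1) that] .
  have 3: "\<forall>\<beta>\<in>Field (dir_image r f). \<exists>\<xi>\<in>Field (dir_image r f). (\<xi>, \<beta>) \<notin> dir_image r f"
    using limit.hyps(3) iff unfolding Field_dir_image by blast
  have 4: "\<forall>\<beta>\<in>Field (dir_image r f). reverts D C' (below (dir_image r f) \<beta>) (F' \<beta>)"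
    unfolding Field_dir_image
  proof safe
    fix \<beta> assume b: "\<beta> \<in> Field r"
    have "reverts D C' (dir_image (below r \<beta>) f) (F \<beta>)"
      using limit.IH b limit.prems sub by (meson inj_on_subset subset_iff)
    then show "reverts D C' (below (dir_image r f) (f \<beta>)) (F' (f \<beta>))"
      by (simp add: F' b below_dir_image[OF limit.hyps(1) limit.prems(1)])
  qed
  have "is_limit_orientation (dir_image r f) F' L"
    unfolding is_limit_orientation_def
  proof (intro conjI allI)
    show "\<forall>\<xi>\<in>Field (dir_image r f). verts (F' \<xi>) = verts L \<and> arcs (F' \<xi>) = arcs L"
      using limit.hyps(4) unfolding is_limit_orientation_def by (auto simp: Field_dir_image F')
    fix e
    obtain x where x: "x\<in>Field r" "\<forall>\<xi>. (x, \<xi>) \<in> r \<longrightarrow>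
        tail (F \<xi>) e = tail L e \<and> head (F \<xi>) e = head L e"
      using limit.hyps(4) unfolding is_limit_orientation_def by blast
    have "tail (F' \<xi>) e = tail L e \<and> head (F' \<xi>) e = head L e" if fx: "(f x, \<xi>) \<in> dir_image r f" for \<xi>
    proof -
      obtain y where y: "y \<in> Field r" "\<xi> = f y" using FieldI2[OF fx] unfolding Field_dir_image by blast
      then have "(x,y) \<in> r" using fx x(1) iff by blast
      then show ?thesis using y x F' by simp
    qed
    then show "\<exists>\<xi>\<^sub>0\<in>Field (dir_image r f). \<forall>\<xi>. (\<xi>\<^sub>0, \<xi>) \<in> dir_image r f \<longrightarrow>
        tail (F' \<xi>) e = tail L e \<and> head (F' \<xi>) e = head L e"
      using x(1) by (auto simp: Field_dir_image)
  qed
  then show ?case using reverts.limit[OF 1 _ 3 4] limit.hyps(2) by (simp add: Field_dir_image)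
qed

text \<open>
  Since every arc is reversed only finitely often, the length of a reversion sequence is an ordinal
  of cardinality at most that of \<^typ>\<open>'e \<times> nat\<close>. So quantifying over the well-orders on subsets
  of this type amounts to quantifying over all ordinals.
\<close>

theorem reverts_bounded_length:
  fixes D :: "('v, 'e) pre_digraph" and r :: "'i rel"
  assumes D: "loopfree_digraph D" and r: "reverts D C r D'"
  shows "\<exists>(r' :: ('e \<times> nat) rel) C'. r' =o r \<and> reverts D C' r' D'"
proof -
  have w: "Well_order r" using r reverts_Well_order by blast
  interpret wo_rel r using w by (rule wo_rel.intro)
  define f where "f \<xi> = (hd (C \<xi>), card {\<eta>\<in>Field r. hd (C \<xi>) \<in> set (C \<eta>) \<and> (\<eta>, \<xi>) \<in> r})" for \<xi>
  have C: "C \<xi> \<noteq> []" "hd (C \<xi>) \<in> set (C \<xi>)" "hd (C \<xi>) \<in> arcs D" if xi: "\<xi> \<in> Field r" for \<xi>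
  proof -
    obtain E where E: "reverts D C (below r \<xi>) E" "pre_digraph.cycle E (C \<xi>)"
      using reverts_below[OF r xi] by blast
    then have "arcs E = arcs D" using reverts_underlying by blast
    then show 1: "C \<xi> \<noteq> []" and "hd (C \<xi>) \<in> arcs D" using E(2)
      by (auto simp: pre_digraph.cycle_def pre_digraph.awalk_def)
    show "hd (C \<xi>) \<in> set (C \<xi>)" using 1 by simp
  qed
  have ne: "f \<xi> \<noteq> f \<eta>" if xe: "\<xi> \<in> Field r" "\<eta> \<in> Field r" "(\<xi>,\<eta>) \<in> r" "\<xi> \<noteq> \<eta>" for \<xi> \<eta>
  proof
    assume eq: "f \<xi> = f \<eta>"
    then have h: "hd (C \<xi>) = hd (C \<eta>)" by (simp add: f_def)
    let ?A = "{\<zeta>\<in>Field r. hd (C \<eta>) \<in> set (C \<zeta>) \<and> (\<zeta>, \<xi>) \<in> r}"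
    let ?B = "{\<zeta>\<in>Field r. hd (C \<eta>) \<in> set (C \<zeta>) \<and> (\<zeta>, \<eta>) \<in> r}"
    have "\<eta> \<in> ?B" using xe C REFL by (auto simp: refl_on_def)
    moreover have "\<eta> \<notin> ?A" using xe ANTISYM by (auto dest: antisymD)
    moreover have "?A \<subseteq> ?B" using xe TRANS by (auto dest: transD)
    ultimately have "?A \<subset> ?B" by blast
    moreover have "finite {\<zeta>\<in>Field r. hd (C \<eta>) \<in> set (C \<zeta>)}"
      using reverts_finite[OF D r] C(3) xe by blast
    then have "finite ?B" by (rule rev_finite_subset) auto
    ultimately have "card ?A < card ?B" by (simp add: psubset_card_mono)
    then show False using eq h by (simp add: f_def)
  qed
  have inj: "inj_on f (Field r)" using ne TOTALS unfolding inj_on_def by metis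
  have "reverts D (C \<circ> inv_into (Field r) f) (dir_image r f) D'"
    by (rule reverts_reindex[OF r inj]) (simp add: inj)
  moreover have "dir_image r f =o r" using dir_image_ordIso[OF w inj] ordIso_symmetric by blast
  ultimately show ?thesis by blast
qed

end

theory Submission
  imports Defs "HOL-Analysis.Function_Topology"
begin

text \<open>
  Reversing the edges of a finite set \<open>B\<close> is a finite sequence of cycle reversals iff \<open>B\<close> is balanced,
  that is, an edge-disjoint union of directed cycles. On a countable set of edges every limit of such
  reversals (in the product topology on orientations) is reached by an \<open>\<omega>\<close>-sequence that settles one
  edge at a time, and these sequences can be concatenated over disjoint countable pieces.

  If the edges can be partitioned into countable pieces such that every directed cycle lies in one of
  them, compactness reduces the colouring to finite sets \<open>F\<close> of edges. Fix a linear order of the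
  vertices and minimise the number of increasing edges of \<open>F\<close>. Then no cycle in \<open>F\<close> has more
  increasing than decreasing edges, hence there is an integer potential that drops along increasing
  edges and grows by at most one along decreasing ones, and its parity is a colouring.

  So it remains to reach an orientation with all cycles in countable pieces. This goes by induction
  on the number of edges: an uncountable set is filtered into smaller closed stages. A path that
  leaves a closed stage and returns to it connects two vertices \<open>x\<close>, \<open>y\<close> that no small set of edges
  separates; such a jump is treated as a virtual arc from \<open>x\<close> to \<open>y\<close>. Each stage is reoriented so that
  its edges and the increasing virtual arcs do not form cycles together; the linear order which
  decides between mutual virtual arcs has to be coherent over all cardinalities of separating sets.
\<close>

section \<open>Walks and balanced sets of edges\<close>

text \<open>A countable piece can be settled edge by edge because only finitely many edges precede
  each one; the obstacle is a cycle that crosses pieces. Such a cycle leaves a stage and returns to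
  it by a detour through later edges, and reversals inside the stage cannot remove the detour, so
  the stage has to be oriented with the detour in mind. Detours from \<open>x\<close> to
  \<open>y\<close> and from \<open>y\<close> to \<open>x\<close> may both be possible. Two opposite
  virtual arcs already form a cycle, so a linear order \<open>\<rho>\<close> admits the increasing
  ones only; a decreasing detour is excluded since an increasing virtual arc would close it up. This
  is why the induction concerns closed walks that contain virtual arcs and not only cycles.
  Inseparability depends on the size of the separating sets, and the admissible size grows with the
  stages: a pair may be inseparable early and separable later. The order has to rule out closed
  walks that mix arcs of different levels. All inseparability is measured in the original
  orientation; this is sound because limits of cycle reversals inside a set of edges create no new
  reachability within it.\<close>

fun chain :: "('i \<Rightarrow> 'v) \<Rightarrow> ('i \<Rightarrow> 'v) \<Rightarrow> 'v \<Rightarrow> 'i list \<Rightarrow> 'v \<Rightarrow> bool" where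
  "chain s d u [] v \<longleftrightarrow> u = v"
| "chain s d u (x # xs) v \<longleftrightarrow> s x = u \<and> chain s d (d x) xs v"

lemma chain_append:
  "chain s d u (xs @ ys) v \<longleftrightarrow> (\<exists>w. chain s d u xs w \<and> chain s d w ys v)"
  by (induction xs arbitrary: u) auto

lemma chain_rotate:
  "chain s d u (xs @ ys) u \<Longrightarrow> \<exists>w. chain s d w (ys @ xs) w"
  unfolding chain_append by blast

lemma chain_cong:
  assumes "\<And>x. x \<in> set xs \<Longrightarrow> s x = s' x" "\<And>x. x \<in> set xs \<Longrightarrow> d x = d' x"
  shows "chain s d u xs v \<longleftrightarrow> chain s' d' u xs v"
  using assms by (induction xs arbitrary: u) auto

lemma chain_rtrancl:
  assumes "chain s d u xs v" "\<And>x. x \<in> set xs \<Longrightarrow> (s x, d x) \<in> R\<^sup>*"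
  shows "(u, v) \<in> R\<^sup>*"
  using assms by (induction xs arbitrary: u) (auto intro: rtrancl_trans)

text \<open>In a shortest walk on the same items a repeated source, or an early visit to the end,
  would leave a closed piece to cut out. A closed walk shrinks to the empty one.\<close>

lemma chain_vertex_simple:
  assumes "chain s d u xs v"
  shows "\<exists>ys. set ys \<subseteq> set xs \<and> chain s d u ys v \<and> distinct (map s ys) \<and> v \<notin> s ` set ys"
proof -
  let ?P = "\<lambda>ys. set ys \<subseteq> set xs \<and> chain s d u ys v"
  obtain ys where ys: "?P ys" and min: "\<And>zs. ?P zs \<Longrightarrow> length ys \<le> length zs"
    using assms ex_has_least_nat[of ?P xs length] by blast
  have "distinct (map s ys)"
  proof (rule ccontr)
    assume "\<not> distinct (map s ys)"
    then obtain as bs cs w where "map s ys = as @ [w] @ bs @ [w] @ cs"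
      using not_distinct_decomp by blast
    then obtain a b c x y where d: "ys = a @ x # b @ y # c" "s x = w" "s y = w"
      by (auto simp: map_eq_append_conv append_eq_map_conv map_eq_Cons_conv Cons_eq_map_conv)
    have "?P (a @ y # c)" using ys d by (auto simp: chain_append)
    from min[OF this] show False using d by simp
  qed
  moreover have "v \<notin> s ` set ys"
  proof
    assume "v \<in> s ` set ys"
    then obtain x where x: "x \<in> set ys" "s x = v" by blast
    then obtain a b where "ys = a @ x # b" by (auto dest: split_list)
    then have "?P a" "length a < length ys" using ys x by (auto simp: chain_append)
    with min[of a] show False by simp
  qed
  ultimately show ?thesis using ys by blast
qed

section \<open>Symmetric differences as composition of reversals\<close>

definition sdiff :: "'a set \<Rightarrow> 'a set \<Rightarrow> 'a set" (infixl "\<oplus>\<oplus>" 65)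
  where "A \<oplus>\<oplus> B = (A - B) \<union> (B - A)"

lemma mem_sdiff [simp]: "x \<in> A \<oplus>\<oplus> B \<longleftrightarrow> (x \<in> A) \<noteq> (x \<in> B)"
  by (auto simp: sdiff_def)

lemma finite_sdiff [simp]: "finite A \<Longrightarrow> finite B \<Longrightarrow> finite (A \<oplus>\<oplus> B)"
  by (simp add: sdiff_def)

lemma sdiff_empty [simp]: "A \<oplus>\<oplus> {} = A" "{} \<oplus>\<oplus> A = A"
  by (auto simp: sdiff_def)

lemma sdiff_self [simp]: "A \<oplus>\<oplus> A = {}" "A \<oplus>\<oplus> (A \<oplus>\<oplus> B) = B"
  by auto

text \<open>
  The orientations of a graph with ends \<open>t\<close> and \<open>h\<close> are represented by the set \<open>A\<close> of the edges
  that point from \<open>h\<close> to \<open>t\<close>.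
\<close>

locale ends =
  fixes t h :: "'e \<Rightarrow> 'v"
begin

definition src :: "'e set \<Rightarrow> 'e \<Rightarrow> 'v" where "src A e = (if e \<in> A then h e else t e)"
definition dst :: "'e set \<Rightarrow> 'e \<Rightarrow> 'v" where "dst A e = (if e \<in> A then t e else h e)"

definition step :: "'e set \<Rightarrow> 'e set \<Rightarrow> 'v rel" where
  "step A N = (\<lambda>e. (src A e, dst A e)) ` N"

text \<open>This is the net outflow of \<open>B\<close> at \<open>v\<close>, so a balanced set is a
  finite circulation. A linear condition composes more easily under reversals than a decomposition
  into cycles.\<close>

definition excess :: "'e set \<Rightarrow> 'e set \<Rightarrow> 'v \<Rightarrow> int" where
  "excess A B v = (\<Sum>e\<in>B. of_bool (src A e = v) - of_bool (dst A e = v))"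

definition balanced :: "'e set \<Rightarrow> 'e set \<Rightarrow> bool" where
  "balanced A B \<longleftrightarrow> finite B \<and> (\<forall>v. excess A B v = 0)"

text \<open>
  Starting from the orientation \<open>A0\<close>, reversing \<open>A \<inter> N\<close> is a limit of finite sequences
  of cycle reversals inside \<open>N\<close>.
\<close>

definition approximable :: "'e set \<Rightarrow> 'e set \<Rightarrow> 'e set \<Rightarrow> bool" where
  "approximable A0 N A \<longleftrightarrow> (\<forall>F. finite F \<and> F \<subseteq> N \<longrightarrow> (\<exists>B\<subseteq>N. balanced A0 B \<and> B \<inter> F = A \<inter> F))"

lemma src_cong: "(e \<in> A \<longleftrightarrow> e \<in> B) \<Longrightarrow> src A e = src B e"
  and dst_cong: "(e \<in> A \<longleftrightarrow> e \<in> B) \<Longrightarrow> dst A e = dst B e"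
  by (auto simp: src_def dst_def)

lemma step_mono: "N \<subseteq> N' \<Longrightarrow> step A N \<subseteq> step A N'"
  by (auto simp: step_def)

lemma step_cong: "A \<inter> N = B \<inter> N \<Longrightarrow> step A N = step B N"
  unfolding step_def by (rule image_cong) (auto simp: src_def dst_def)

lemma balanced_empty [simp]: "balanced A {}"
  by (simp add: balanced_def excess_def)

lemma excess_cong: "A \<inter> C = B \<inter> C \<Longrightarrow> excess A C v = excess B C v"
  unfolding excess_def by (rule sum.cong) (auto simp: src_def dst_def)

text \<open>Reversing \<open>B\<close> negates the contribution of its edges, so the edges in
  \<open>B \<inter> C\<close> cancel and all others are counted once on either side.\<close>

lemma excess_sdiff:
  assumes "finite B" "finite C"
  shows "excess A (B \<oplus>\<oplus> C) v = excess A B v + excess (A \<oplus>\<oplus> B) C v"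
proof -
  define f where "f X e = (of_bool (src X e = v) - of_bool (dst X e = v) :: int)" for X e
  have ex: "excess X Y v = (\<Sum>e\<in>B \<union> C. if e \<in> Y then f X e else 0)" if "Y \<subseteq> B \<union> C" for X Y
    unfolding excess_def f_def using assms that
    by (simp add: sum.If_cases Int_absorb1 flip: Int_def)
  have "excess A (B \<oplus>\<oplus> C) v = (\<Sum>e\<in>B \<union> C. if e \<in> B \<oplus>\<oplus> C then f A e else 0)"
    by (rule ex) auto
  also have "\<dots> = (\<Sum>e\<in>B \<union> C. (if e \<in> B then f A e else 0) + (if e \<in> C then f (A \<oplus>\<oplus> B) e else 0))"
    by (rule sum.cong) (auto simp: f_def src_def dst_def)
  also have "\<dots> = excess A B v + excess (A \<oplus>\<oplus> B) C v"
    using ex[of B A] ex[of C "A \<oplus>\<oplus> B"] by (simp add: sum.distrib)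
  finally show ?thesis .
qed

text \<open>From right to left this composes two reversals. From left to right, with
  \<open>C\<close> the difference of two balanced sets, it shows that passing from one to the other
  is again the reversal of a circulation.\<close>

lemma balanced_sdiff:
  assumes "balanced A B" "finite C"
  shows "balanced A (B \<oplus>\<oplus> C) \<longleftrightarrow> balanced (A \<oplus>\<oplus> B) C"
  using assms excess_sdiff[of B C A] by (auto simp: balanced_def)

lemma chain_excess:
  assumes "chain (src A) (dst A) u es v" "distinct es"
  shows "excess A (set es) w = of_bool (u = w) - of_bool (v = w)"
  using assms by (induction es arbitrary: u) (auto simp: excess_def)

lemma chain_balanced:
  "chain (src A) (dst A) u es u \<Longrightarrow> distinct es \<Longrightarrow> balanced A (set es)"
  by (simp add: balanced_def chain_excess)

lemma rtrancl_step_chain: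
  assumes "(u, v) \<in> (step A N)\<^sup>*"
  shows "\<exists>es. set es \<subseteq> N \<and> chain (src A) (dst A) u es v \<and>
    distinct (map (src A) es) \<and> v \<notin> src A ` set es"
proof -
  have "\<exists>es. set es \<subseteq> N \<and> chain (src A) (dst A) u es v"
    using assms
  proof (induction rule: rtrancl_induct)
    case base
    show ?case by (rule exI[of _ "[]"]) simp
  next
    case (step y z)
    then obtain es e where "set es \<subseteq> N" "chain (src A) (dst A) u es y" "e \<in> N"
      "src A e = y" "dst A e = z" unfolding step_def by auto
    then show ?case by (intro exI[of _ "es @ [e]"]) (auto simp: chain_append)
  qed
  then obtain es where es: "set es \<subseteq> N" "chain (src A) (dst A) u es v" by blast
  from chain_vertex_simple[OF es(2)] es(1) show ?thesis by blast
qed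

lemma chain_rtrancl_step:
  "chain (src A) (dst A) u es v \<Longrightarrow> set es \<subseteq> N \<Longrightarrow> (u, v) \<in> (step A N)\<^sup>*"
  by (erule chain_rtrancl) (auto simp: step_def)

text \<open>Summing the excess over \<open>U\<close> gives the number of edges of \<open>B\<close>
  leaving \<open>U\<close> minus the number of those entering it. This is 0, and none
  leaves.\<close>

lemma balanced_cut:
  assumes B: "balanced A B" and out: "\<And>e. e \<in> B \<Longrightarrow> src A e \<in> U \<Longrightarrow> dst A e \<in> U"
    and e: "e \<in> B" "dst A e \<in> U"
  shows "src A e \<in> U"
proof -
  have fin: "finite B" using B by (simp add: balanced_def)
  \<comment> \<open>\<open>U\<close> may be infinite; only its vertices that are ends of edges in
    \<open>B\<close> contribute.\<close>
  define V where "V = src A ` B \<union> dst A ` B"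
  have V: "finite V" using fin by (simp add: V_def)
  have "0 = (\<Sum>v\<in>V \<inter> U. excess A B v)" using B by (simp add: balanced_def)
  also have "\<dots> = (\<Sum>e\<in>B. \<Sum>v\<in>V \<inter> U. of_bool (src A e = v) - of_bool (dst A e = v))"
    unfolding excess_def by (rule sum.swap)
  also have "\<dots> = (\<Sum>e\<in>B. of_bool (src A e \<in> U) - of_bool (dst A e \<in> U))"
  proof (rule sum.cong[OF refl])
    fix e assume "e \<in> B"
    have "(\<Sum>v\<in>V \<inter> U. of_bool (x = v)) = (of_bool (x \<in> V \<inter> U) :: int)" for x
      using V by (simp add: of_bool_def)
    then show "(\<Sum>v\<in>V \<inter> U. of_bool (src A e = v) - of_bool (dst A e = v)) =
      (of_bool (src A e \<in> U) - of_bool (dst A e \<in> U) :: int)"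
      using \<open>e \<in> B\<close> by (simp add: sum_subtractf V_def)
  qed
  finally have s: "(\<Sum>e\<in>B. of_bool (dst A e \<in> U) - of_bool (src A e \<in> U)) = (0 :: int)"
    by (simp add: sum_subtractf)
  have nonneg: "(0 :: int) \<le> of_bool (dst A e \<in> U) - of_bool (src A e \<in> U)" if "e \<in> B" for e
    using out[OF that] by auto
  then have "\<forall>e\<in>B. of_bool (dst A e \<in> U) - of_bool (src A e \<in> U) = (0 :: int)"
    using sum_nonneg_eq_0_iff[OF fin nonneg] s by simp
  then have "of_bool (dst A e \<in> U) = (of_bool (src A e \<in> U) :: int)"
    using e(1) by force
  with e(2) show ?thesis by (simp add: of_bool_def split: if_splits)
qed

text \<open>No edge of \<open>B\<close> leaves the set reachable from the head of \<open>e\<close>,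
  so by the cut argument \<open>e\<close> also starts in it, and a path back to its tail closes
  up.\<close>

lemma balanced_cycle:
  assumes B: "balanced A B" and e: "e \<in> B"
  shows "\<exists>es u. set es \<subseteq> B \<and> e \<in> set es \<and> chain (src A) (dst A) u es u \<and> distinct (map (src A) es)"
proof -
  define U where "U = {v. (dst A e, v) \<in> (step A B)\<^sup>*}"
  have "dst A f \<in> U" if "f \<in> B" "src A f \<in> U" for f
    using that unfolding U_def step_def by (auto intro: rtrancl_into_rtrancl)
  then have "src A e \<in> U"
    using balanced_cut[OF B _ e, of U] by (auto simp: U_def)
  then obtain es where es: "set es \<subseteq> B" "chain (src A) (dst A) (dst A e) es (src A e)"
    "distinct (map (src A) es)" "src A e \<notin> src A ` set es"
    unfolding U_def using rtrancl_step_chain[of "dst A e" "src A e" A B] by blast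
  then show ?thesis using e by (intro exI[of _ "e # es"] exI[of _ "src A e"]) auto
qed

text \<open>A walk has finitely many edges, so a balanced set \<open>B\<close> can stand in for
  \<open>A\<close>. No edge leaves the originally reachable set \<open>U\<close>, hence no edge of
  \<open>B\<close> enters it from outside, and reversing \<open>B\<close> opens no way out.\<close>

lemma reach_invariant:
  assumes A: "approximable {} X A"
  shows "(step A X)\<^sup>* \<subseteq> (step {} X)\<^sup>*"
proof (intro subrelI)
  fix u v assume "(u, v) \<in> (step A X)\<^sup>*"
  then obtain es where es: "set es \<subseteq> X" "chain (src A) (dst A) u es v"
    using rtrancl_step_chain by blast
  then obtain B where B: "B \<subseteq> X" "balanced {} B" "B \<inter> set es = A \<inter> set es"
    using A unfolding approximable_def by (metis finite_set)
  define U where "U = {v. (u, v) \<in> (step {} X)\<^sup>*}"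
  have out: "dst {} e \<in> U" if "e \<in> X" "src {} e \<in> U" for e
    using that unfolding U_def step_def by (auto intro: rtrancl_into_rtrancl)
  have "dst B e \<in> U" if "e \<in> X" "src B e \<in> U" for e
  proof (cases "e \<in> B")
    case True
    with balanced_cut[OF B(2), of U e] out B(1) that show ?thesis
      by (auto simp: src_def dst_def)
  next
    case False
    then show ?thesis using out that by (auto simp: src_def dst_def)
  qed
  moreover have "chain (src B) (dst B) u es v"
    using es(2) B(3) by (subst chain_cong[where s' = "src A" and d' = "dst A"])
      (auto simp: src_def dst_def)
  moreover have "u \<in> U" by (simp add: U_def)
  ultimately have "v \<in> U" using es(1)
  proof (induction es arbitrary: u)
    case (Cons e es)
    then show ?case by auto
  qed simp
  then show "(u, v) \<in> (step {} X)\<^sup>*" by (simp add: U_def)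
qed

section \<open>Gluing and composing approximable reorientations\<close>

lemma balanced_Un_disjoint:
  assumes "balanced A B" "balanced A C" "B \<inter> C = {}"
  shows "balanced A (B \<union> C)"
  using assms by (auto simp: balanced_def excess_def sum.union_disjoint)

lemma balanced_UN_disjoint:
  assumes "finite I" "\<And>i. i \<in> I \<Longrightarrow> balanced A (B i)" "disjoint_family_on B I"
  shows "balanced A (\<Union>i\<in>I. B i)"
  using assms
proof (induction I rule: finite_induct)
  case (insert i I)
  then show ?case
    by (auto simp: disjoint_family_on_def intro!: balanced_Un_disjoint)
qed simp

lemma approximable_Union:
  assumes dj: "disjoint P" and ap: "\<And>N. N \<in> P \<Longrightarrow> approximable A0 N A"
  shows "approximable A0 (\<Union>P) A"
  unfolding approximable_def
proof (intro allI impI, elim conjE)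
  fix F assume F: "finite F" "F \<subseteq> \<Union>P"
  then obtain Q where Q: "finite Q" "Q \<subseteq> P" "F \<subseteq> \<Union>Q"
    using finite_subset_Union[of F P] by blast
  have "\<forall>N\<in>Q. \<exists>B\<subseteq>N. balanced A0 B \<and> B \<inter> (F \<inter> N) = A \<inter> (F \<inter> N)"
    using ap Q(2) F(1) unfolding approximable_def by (meson finite_Int inf_le2 subsetD)
  then obtain B where B: "\<And>N. N \<in> Q \<Longrightarrow> B N \<subseteq> N" "\<And>N. N \<in> Q \<Longrightarrow> balanced A0 (B N)"
    "\<And>N. N \<in> Q \<Longrightarrow> B N \<inter> (F \<inter> N) = A \<inter> (F \<inter> N)" by metis
  have "disjoint_family_on B Q"
    unfolding disjoint_family_on_def
  proof (intro ballI impI)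
    fix N N' assume N: "N \<in> Q" "N' \<in> Q" "N \<noteq> N'"
    then have "N \<inter> N' = {}" using dj Q(2) by (auto dest: disjointD)
    then show "B N \<inter> B N' = {}" using B(1)[OF N(1)] B(1)[OF N(2)] by blast
  qed
  then have "balanced A0 (\<Union>N\<in>Q. B N)" using B(2) Q(1) by (intro balanced_UN_disjoint) auto
  moreover have "(\<Union>N\<in>Q. B N) \<inter> F = A \<inter> F"
  proof (intro set_eqI iffI)
    fix e assume "e \<in> (\<Union>N\<in>Q. B N) \<inter> F"
    then obtain N where N: "N \<in> Q" "e \<in> B N" "e \<in> F" by blast
    with B(1,3)[OF N(1)] show "e \<in> A \<inter> F" by blast
  next
    fix e assume e: "e \<in> A \<inter> F"
    then obtain N where N: "N \<in> Q" "e \<in> N" using Q by blast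
    with B(3)[OF N(1)] e show "e \<in> (\<Union>N\<in>Q. B N) \<inter> F" by blast
  qed
  moreover have "(\<Union>N\<in>Q. B N) \<subseteq> \<Union>P"
  proof (rule UN_least)
    fix N assume N: "N \<in> Q"
    show "B N \<subseteq> \<Union>P" using B(1)[OF N] N Q(2) by blast
  qed
  ultimately show "\<exists>B\<subseteq>\<Union>P. balanced A0 B \<and> B \<inter> F = A \<inter> F"
    by (intro exI[of _ "\<Union>N\<in>Q. B N"] conjI)
qed

lemma approximable_cong: "A \<inter> N = A' \<inter> N \<Longrightarrow> approximable A0 N A \<longleftrightarrow> approximable A0 N A'"
proof -
  assume "A \<inter> N = A' \<inter> N"
  then have "A \<inter> F = A' \<inter> F" if "F \<subseteq> N" for F using that by blast
  then show ?thesis unfolding approximable_def by simp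
qed

lemma approximable_sdiff:
  assumes "approximable A0 N A1" "approximable (A0 \<oplus>\<oplus> A1) N A2"
  shows "approximable A0 N (A1 \<oplus>\<oplus> A2)"
  unfolding approximable_def
proof (intro allI impI, elim conjE)
  fix F assume F: "finite F" "F \<subseteq> N"
  then obtain B2 where B2: "B2 \<subseteq> N" "balanced (A0 \<oplus>\<oplus> A1) B2" "B2 \<inter> F = A2 \<inter> F"
    using assms(2) unfolding approximable_def by meson
  \<comment> \<open>The second set is chosen first. Being finite, it can be added to the test set
    for the first one, and then it stays balanced when \<open>B1\<close> is reversed in place of
    \<open>A1\<close>.\<close>
  have fin: "finite (F \<union> B2)" "F \<union> B2 \<subseteq> N" using F B2 by (auto simp: balanced_def)
  then obtain B1 where B1: "B1 \<subseteq> N" "balanced A0 B1" "B1 \<inter> (F \<union> B2) = A1 \<inter> (F \<union> B2)"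
    using assms(1) unfolding approximable_def by meson
  have "excess (A0 \<oplus>\<oplus> B1) B2 v = excess (A0 \<oplus>\<oplus> A1) B2 v" for v
    using B1(3) by (intro excess_cong) auto
  then have "balanced (A0 \<oplus>\<oplus> B1) B2" using B2(2) by (simp add: balanced_def)
  then have "balanced A0 (B1 \<oplus>\<oplus> B2)" using balanced_sdiff[OF B1(2)] fin by auto
  moreover have "(B1 \<oplus>\<oplus> B2) \<inter> F = (A1 \<oplus>\<oplus> A2) \<inter> F" using B1(3) B2(3) by auto
  moreover have "B1 \<oplus>\<oplus> B2 \<subseteq> N" using B1(1) B2(1) by auto
  ultimately show "\<exists>B\<subseteq>N. balanced A0 B \<and> B \<inter> F = (A1 \<oplus>\<oplus> A2) \<inter> F" by blast
qed

end

section \<open>Reversion sequences on countable pieces\<close>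

text \<open>Compactness of the two-valued functions: \<open>g\<close> is a cluster point of the net
  \<open>s\<close> indexed by finite sets. If there were none, finitely many of the basic open sets
  \<open>U g\<close> would cover everything, yet \<open>s\<close> at the union of their supports
  would lie in none of them.\<close>

lemma finite_selection:
  fixes s :: "'x set \<Rightarrow> 'x \<Rightarrow> bool"
  shows "\<exists>g. \<forall>F. finite F \<longrightarrow> (\<exists>F'. finite F' \<and> F \<subseteq> F' \<and> (\<forall>x\<in>F. g x = s F' x))"
proof (rule ccontr)
  assume "\<not> ?thesis"
  then obtain F where F: "\<And>g. finite (F g)"
    "\<And>g F'. finite F' \<Longrightarrow> F g \<subseteq> F' \<Longrightarrow> \<exists>x\<in>F g. g x \<noteq> s F' x"
    by metis
  define X where "X = product_topology (\<lambda>_::'x. discrete_topology (UNIV :: bool set)) UNIV"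
  define U where "U g = {f. \<forall>x\<in>F g. f x = g x}" for g
  have top: "topspace X = UNIV" by (simp add: X_def)
  have "compact_space X"
    unfolding X_def by (subst compact_space_product_topology) (simp add: compact_space_discrete_topology)
  moreover have "openin X (U g)" for g
  proof -
    have "U g = (\<Pi>\<^sub>E x\<in>UNIV. if x \<in> F g then {g x} else UNIV)"
      by (auto simp: U_def PiE_iff split: if_splits)
    moreover have "finite {x. \<not> (if x \<in> F g then {g x} else UNIV) = (UNIV :: bool set)}"
      by (rule finite_subset[OF _ F(1)[of g]]) auto
    ultimately show ?thesis unfolding X_def by (simp add: openin_PiE_gen)
  qed
  moreover have "topspace X \<subseteq> \<Union>(range U)" by (auto simp: top U_def)
  ultimately obtain \<F> where \<F>: "finite \<F>" "\<F> \<subseteq> range U" "UNIV \<subseteq> \<Union>\<F>"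
    unfolding compact_space_alt top by (metis (no_types, lifting) imageE)
  then obtain G where G: "finite G" "\<F> = U ` G" by (meson finite_subset_image)
  define F' where "F' = (\<Union>g\<in>G. F g)"
  have "finite F'" using G F(1) by (simp add: F'_def)
  obtain g where g: "g \<in> G" "s F' \<in> U g" using \<F>(3) G by blast
  then have "F g \<subseteq> F'" by (auto simp: F'_def)
  with F(2)[OF \<open>finite F'\<close> this] g(2) show False by (auto simp: U_def)
qed

section \<open>A closed form for the result of a reversion sequence\<close>

lemma reverse_arcs_reverse_arcs:
  "reverse_arcs (reverse_arcs D A) B = reverse_arcs D (A \<oplus>\<oplus> B)"
  by (rule pre_digraph.equality) (auto simp: reverse_arcs_def)

lemma reverse_arcs_empty [simp]: "reverse_arcs D {} = D"
  by (rule pre_digraph.equality) (auto simp: reverse_arcs_def)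

lemma reverse_arcs_simps [simp]:
  "verts (reverse_arcs D A) = verts D" "arcs (reverse_arcs D A) = arcs D"
  "tail (reverse_arcs D A) e = (if e \<in> A then head D e else tail D e)"
  "head (reverse_arcs D A) e = (if e \<in> A then tail D e else head D e)"
  by (auto simp: reverse_arcs_def)

text \<open>An edge ends up reversed iff it lies in an odd number of the cycles. With this closed
  form for the proper initial segments, the limit case only needs that the parity of each edge is
  eventually constant, which is finiteness.\<close>

lemma reverts_parity_step:
  fixes C :: "'i \<Rightarrow> 'e list"
  defines "X \<equiv> \<lambda>I. {e. odd (card {\<eta>\<in>I. e \<in> set (C \<eta>)})}"
  assumes w: "Well_order r" and fin: "\<And>e. finite {\<xi>\<in>Field r. e \<in> set (C \<xi>)}"
    and cyc: "\<And>\<xi>. \<xi> \<in> Field r \<Longrightarrow> pre_digraph.cycle (reverse_arcs D (X (underS r \<xi>))) (C \<xi>)"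
    and below: "\<And>\<xi>. \<xi> \<in> Field r \<Longrightarrow> reverts D C (below r \<xi>) (reverse_arcs D (X (underS r \<xi>)))"
  shows "reverts D C r (reverse_arcs D (X (Field r)))"
proof -
  have TRANS: "trans r" and ANTISYM: "antisym r" and REFL: "refl_on (Field r) r"
    and TOTALS: "\<forall>a\<in>Field r. \<forall>b\<in>Field r. (a, b) \<in> r \<or> (b, a) \<in> r"
    using w wo_rel.TOTALS[OF wo_rel.intro[OF w]] by (auto simp: order_on_defs)
  have sub: "underS r \<xi> \<subseteq> Field r" for \<xi> by (auto simp: underS_def Field_def)
  consider "Field r = {}" | m where "m \<in> Field r" "\<forall>\<xi>\<in>Field r. (\<xi>, m) \<in> r"
    | "Field r \<noteq> {}" "\<forall>\<beta>\<in>Field r. \<exists>\<xi>\<in>Field r. (\<xi>, \<beta>) \<notin> r" by blast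
  then show ?thesis
  proof cases
    case 1
    then have "r = {}" by (auto simp: Field_def)
    moreover have "X (Field r) = {}" using 1 by (simp add: X_def)
    ultimately show ?thesis using reverts.zero[of D C] by simp
  next
    case 2
    have F: "Field r = insert m (underS r m)" "m \<notin> underS r m"
      using 2 sub[of m] by (auto simp: underS_def)
    have "X (Field r) = X (underS r m) \<oplus>\<oplus> set (C m)"
    proof (rule set_eqI)
      fix e
      have fm: "finite {\<eta>\<in>underS r m. e \<in> set (C \<eta>)}" using F(1) by (intro finite_subset[OF _ fin[of e]]) auto
      show "e \<in> X (Field r) \<longleftrightarrow> e \<in> X (underS r m) \<oplus>\<oplus> set (C m)"
      proof (cases "e \<in> set (C m)")
        case True
        then have "{\<eta>\<in>Field r. e \<in> set (C \<eta>)} = insert m {\<eta>\<in>underS r m. e \<in> set (C \<eta>)}"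
          using F by auto
        then show ?thesis using True fm F(2) by (simp add: X_def)
      next
        case False
        then have "{\<eta>\<in>Field r. e \<in> set (C \<eta>)} = {\<eta>\<in>underS r m. e \<in> set (C \<eta>)}"
          using F by auto
        then show ?thesis using False by (simp add: X_def)
      qed
    qed
    then have "reverse_arcs D (X (Field r)) = reverse_arcs (reverse_arcs D (X (underS r m))) (set (C m))"
      by (simp add: reverse_arcs_reverse_arcs)
    then show ?thesis
      using reverts.succ[OF w 2 below[OF 2(1)] cyc[OF 2(1)]] by simp
  next
    case 3
    have "\<exists>\<xi>\<^sub>0\<in>Field r. \<forall>\<xi>. (\<xi>\<^sub>0, \<xi>) \<in> r \<longrightarrow> (e \<in> X (underS r \<xi>) \<longleftrightarrow> e \<in> X (Field r))" for e
    proof -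
      define S where "S = {\<xi>\<in>Field r. e \<in> set (C \<xi>)}"
      have "finite S" "S \<subseteq> Field r" using fin by (auto simp: S_def)
      \<comment> \<open>There is no last index, so finitely many indices have a strict upper bound;
        from there on the parity of \<open>e\<close> does not change.\<close>
      then have "\<exists>z\<in>Field r. \<forall>s\<in>S. (s, z) \<in> r \<and> s \<noteq> z"
      proof (induction S rule: finite_induct)
        case empty
        then show ?case using 3(1) by auto
      next
        case (insert s S)
        then obtain z where z: "z \<in> Field r" "\<forall>s\<in>S. (s, z) \<in> r \<and> s \<noteq> z" by auto
        obtain y where y: "y \<in> Field r" "(y, s) \<notin> r" using 3(2) insert.prems by blast
        then have ys: "(s, y) \<in> r" "s \<noteq> y" using TOTALS REFL insert.prems by (auto simp: refl_on_def)
        show ?case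
        proof (cases "(z, y) \<in> r")
          case True
          then have "(x, y) \<in> r \<and> x \<noteq> y" if "x \<in> S" for x
            using that z(2) TRANS ANTISYM by (meson antisymD transD)
          then show ?thesis using y(1) ys by (intro bexI[of _ y]) auto
        next
          case False
          then have "(y, z) \<in> r" using y z TOTALS by blast
          then have "(s, z) \<in> r" "s \<noteq> z" using ys TRANS ANTISYM by (meson antisymD transD)+
          then show ?thesis using z by (intro bexI[of _ z]) auto
        qed
      qed
      then obtain z where z: "z \<in> Field r" "\<And>s. s \<in> S \<Longrightarrow> (s, z) \<in> r \<and> s \<noteq> z" by blast
      have "{\<eta>\<in>underS r \<xi>. e \<in> set (C \<eta>)} = {\<eta>\<in>Field r. e \<in> set (C \<eta>)}" if "(z, \<xi>) \<in> r" for \<xi>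
      proof (rule set_eqI)
        fix \<eta>
        have "(\<eta>, \<xi>) \<in> r \<and> \<eta> \<noteq> \<xi>" if "\<eta> \<in> S"
          using z(2)[OF that] \<open>(z, \<xi>) \<in> r\<close> TRANS ANTISYM by (meson antisymD transD)
        then show "\<eta> \<in> {\<eta>\<in>underS r \<xi>. e \<in> set (C \<eta>)} \<longleftrightarrow> \<eta> \<in> {\<eta>\<in>Field r. e \<in> set (C \<eta>)}"
          using sub[of \<xi>] by (auto simp: underS_def S_def)
      qed
      then show ?thesis using z(1) by (intro bexI[of _ z]) (simp_all add: X_def)
    qed
    then have "is_limit_orientation r (\<lambda>\<beta>. reverse_arcs D (X (underS r \<beta>))) (reverse_arcs D (X (Field r)))"
      unfolding is_limit_orientation_def by simp metis
    then show ?thesis using below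
      by (intro reverts.limit[OF w 3, where F = "\<lambda>\<beta>. reverse_arcs D (X (underS r \<beta>))"]) blast+
  qed
qed

lemma underS_below:
  assumes "Well_order r" "\<xi> \<in> underS r \<beta>"
  shows "underS (below r \<beta>) \<xi> = underS r \<xi>"
proof -
  have "trans r" "antisym r" using assms(1) by (auto simp: order_on_defs)
  then show ?thesis using assms(2) unfolding below_def underS_def
    by (auto dest: transD antisymD)
qed

text \<open>This removes the recursion from \<open>reverts\<close>: it suffices that each index
  carries a cycle of an explicitly given orientation and that no edge is used infinitely
  often.\<close>

lemma reverts_parity:
  fixes C :: "'i \<Rightarrow> 'e list"
  defines "X \<equiv> \<lambda>I. {e. odd (card {\<eta>\<in>I. e \<in> set (C \<eta>)})}"
  assumes w: "Well_order r" and fin: "\<And>e. finite {\<xi>\<in>Field r. e \<in> set (C \<xi>)}"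
    and cyc: "\<And>\<xi>. \<xi> \<in> Field r \<Longrightarrow> pre_digraph.cycle (reverse_arcs D (X (underS r \<xi>))) (C \<xi>)"
  shows "reverts D C r (reverse_arcs D (X (Field r)))"
proof -
  have sub: "underS r \<xi> \<subseteq> Field r" for \<xi> by (auto simp: underS_def Field_def)
  have "\<beta> \<in> Field r \<longrightarrow> reverts D C (below r \<beta>) (reverse_arcs D (X (underS r \<beta>)))" for \<beta>
  proof (induction \<beta> rule: wo_rel.well_order_induct[OF wo_rel.intro[OF w]])
    case (1 \<beta>)
    show ?case
    proof
      assume \<beta>: "\<beta> \<in> Field r"
      have wb: "Well_order (below r \<beta>)" unfolding below_def using w by (rule Well_order_Restr)
      note F = Field_below[OF w, of \<beta>]
      have "reverts D C (below r \<beta>) (reverse_arcs D (X (Field (below r \<beta>))))"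
        unfolding X_def
      proof (rule reverts_parity_step[OF wb])
        show "finite {\<xi>\<in>Field (below r \<beta>). e \<in> set (C \<xi>)}" for e
          using sub[of \<beta>] by (intro finite_subset[OF _ fin[of e]]) (auto simp: F)
      next
        fix \<xi> assume "\<xi> \<in> Field (below r \<beta>)"
        then have x: "\<xi> \<in> underS r \<beta>" by (simp add: F)
        then have xr: "(\<xi>, \<beta>) \<in> r" "\<xi> \<noteq> \<beta>" by (auto simp: underS_def)
        show "pre_digraph.cycle (reverse_arcs D {e. odd (card {\<eta> \<in> underS (below r \<beta>) \<xi>. e \<in> set (C \<eta>)})}) (C \<xi>)"
          using cyc[of \<xi>] x sub[of \<beta>] unfolding X_def underS_below[OF w x] by blast
        have "reverts D C (below r \<xi>) (reverse_arcs D (X (underS r \<xi>)))"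
          using 1 xr x sub[of \<beta>] by blast
        then show "reverts D C (below (below r \<beta>) \<xi>)
            (reverse_arcs D {e. odd (card {\<eta> \<in> underS (below r \<beta>) \<xi>. e \<in> set (C \<eta>)})})"
          unfolding X_def underS_below[OF w x] below_below[OF w xr] .
      qed
      then show "reverts D C (below r \<beta>) (reverse_arcs D (X (underS r \<beta>)))" by (simp add: F)
    qed
  qed
  then show ?thesis using reverts_parity_step[OF w fin, where D = D] cyc unfolding X_def by blast
qed

lemma (in wf_digraph) cycle_iff_chain:
  "cycle p \<longleftrightarrow> p \<noteq> [] \<and> set p \<subseteq> arcs G \<and> distinct (map (tail G) p) \<and> (\<exists>u. chain (tail G) (head G) u p u)"
proof -
  have cas: "cas u q v \<longleftrightarrow> chain (tail G) (head G) u q v" for u q v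
    by (induction q arbitrary: u) auto
  \<comment> \<open>Both lists run once around the closed walk; they differ only in the position of
    \<open>u\<close>.\<close>
  have d: "distinct (tl (awalk_verts u p)) \<longleftrightarrow> distinct (map (tail G) p)"
    if p': "p \<noteq> []" "chain (tail G) (head G) u p u" for u
  proof -
    obtain e q where p: "p = e # q" using p'(1) by (cases p) auto
    have "chain (tail G) (head G) x q y \<Longrightarrow> awalk_verts x q = map (tail G) q @ [y]" for x y
      by (induction q arbitrary: x) auto
    then have "awalk_verts (head G e) q = map (tail G) q @ [u]" using p'(2) p by auto
    then show ?thesis using p'(2) p by auto
  qed
  show ?thesis
  proof
    assume "cycle p"
    then show "p \<noteq> [] \<and> set p \<subseteq> arcs G \<and> distinct (map (tail G) p) \<and> (\<exists>u. chain (tail G) (head G) u p u)"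
      unfolding cycle_def awalk_def cas using d by blast
  next
    assume R: "p \<noteq> [] \<and> set p \<subseteq> arcs G \<and> distinct (map (tail G) p) \<and> (\<exists>u. chain (tail G) (head G) u p u)"
    then obtain u where u: "chain (tail G) (head G) u p u" by blast
    then have "u \<in> verts G" using R by (cases p) auto
    then show "cycle p" unfolding cycle_def awalk_def cas using R u d by blast
  qed
qed


section \<open>Realising one countable piece by a sequence of cycles\<close>

context ends
begin

text \<open>Before step \<open>n\<close> the reversed set agrees with \<open>A\<close> on the first
  \<open>n\<close> edges. If the next edge is wrong, a better approximation differs from the current
  set by a circulation through this edge that avoids the earlier ones, and a single cycle of it
  repairs the edge.\<close>

lemma countable_cycle_sequence:
  assumes N: "countable N" and A: "approximable {} N A"
  defines "S \<equiv> \<lambda>c n. {e. odd (card {m. m < n \<and> e \<in> set (c m)})}"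
  shows "\<exists>c :: nat \<Rightarrow> 'e list.
    (\<forall>n. set (c n) \<subseteq> N \<and> distinct (map (src (S c n)) (c n)) \<and>
         (\<exists>u. chain (src (S c n)) (dst (S c n)) u (c n) u)) \<and>
    (\<forall>e. finite {n. e \<in> set (c n)}) \<and> (\<forall>e\<in>N. odd (card {n. e \<in> set (c n)}) \<longleftrightarrow> e \<in> A)"
proof (cases "N = {}")
  case True
  then show ?thesis by (intro exI[of _ "\<lambda>_. []"]) auto
next
  case False
  define f where "f = from_nat_into N"
  have f: "range f = N" unfolding f_def using N False by (simp add: range_from_nat_into)
  define Good where "Good n B \<longleftrightarrow> B \<subseteq> N \<and> balanced {} B \<and> B \<inter> f ` {..<n} = A \<inter> f ` {..<n}" for n B
  define Next where "Next n B B' \<longleftrightarrow> (\<exists>es. set es \<subseteq> N \<and> distinct (map (src B) es) \<and>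
    (\<exists>u. chain (src B) (dst B) u es u) \<and> set es \<inter> f ` {..<n} = {} \<and> B' = B \<oplus>\<oplus> set es)" for n B B'
  have nxt: "\<exists>B'. Good (Suc n) B' \<and> Next n B B'" if B: "Good n B" for n B
  proof (cases "f n \<in> B \<longleftrightarrow> f n \<in> A")
    case True
    then have "Good (Suc n) B" using B by (auto simp: Good_def lessThan_Suc)
    \<comment> \<open>The empty list stands for a step that has nothing to repair.\<close>
    moreover have "Next n B B" unfolding Next_def by (intro exI[of _ "[]"]) auto
    ultimately show ?thesis by blast
  next
    case False
    have "finite (f ` {..<Suc n})" "f ` {..<Suc n} \<subseteq> N" using f by auto
    then obtain B' where B': "B' \<subseteq> N" "balanced {} B'" "B' \<inter> f ` {..<Suc n} = A \<inter> f ` {..<Suc n}"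
      using A unfolding approximable_def by meson
    have fin: "finite B" "finite B'" using B B' by (auto simp: Good_def balanced_def)
    have "balanced B (B \<oplus>\<oplus> B')"
      using balanced_sdiff[of "{}" B "B \<oplus>\<oplus> B'"] B B'(2) fin by (simp add: Good_def)
    moreover have "f n \<in> B \<oplus>\<oplus> B'" using False B'(3) by (auto simp: lessThan_Suc)
    ultimately obtain es u where es: "set es \<subseteq> B \<oplus>\<oplus> B'" "f n \<in> set es"
      "chain (src B) (dst B) u es u" "distinct (map (src B) es)"
      using balanced_cycle by blast
    have disj: "set es \<inter> f ` {..<n} = {}"
    proof -
      have "f ` {..<n} \<subseteq> f ` {..<Suc n}" by auto
      then have "B \<inter> f ` {..<n} = B' \<inter> f ` {..<n}" using B B'(3) unfolding Good_def by blast
      then show ?thesis using es(1) by (auto simp: sdiff_def)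
    qed
    have sub: "set es \<subseteq> N" using es(1) B B'(1) unfolding Good_def by (auto simp: sdiff_def)
    have "balanced B (set es)" using chain_balanced[OF es(3)] es(4) by (simp add: distinct_map)
    then have "balanced {} (B \<oplus>\<oplus> set es)" using balanced_sdiff[of "{}" B "set es"] B by (simp add: Good_def)
    moreover have "(B \<oplus>\<oplus> set es) \<inter> f ` {..<Suc n} = A \<inter> f ` {..<Suc n}"
    proof (rule set_eqI)
      fix x
      show "x \<in> (B \<oplus>\<oplus> set es) \<inter> f ` {..<Suc n} \<longleftrightarrow> x \<in> A \<inter> f ` {..<Suc n}"
      proof (cases "x \<in> f ` {..<n}")
        case True
        then have "x \<in> B \<longleftrightarrow> x \<in> A" using B unfolding Good_def by blast
        then show ?thesis using True disj by (auto simp: lessThan_Suc)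
      next
        case False
        then show ?thesis using es(2) \<open>\<not> (f n \<in> B \<longleftrightarrow> f n \<in> A)\<close> by (auto simp: lessThan_Suc)
      qed
    qed
    moreover have "B \<oplus>\<oplus> set es \<subseteq> N" using sub B by (auto simp: Good_def sdiff_def)
    ultimately have "Good (Suc n) (B \<oplus>\<oplus> set es)" by (simp add: Good_def)
    moreover have "Next n B (B \<oplus>\<oplus> set es)" unfolding Next_def using es sub disj by blast
    ultimately show ?thesis by blast
  qed
  have "\<exists>B. B 0 = {} \<and> (\<forall>n. Good n (B n) \<and> Next n (B n) (B (Suc n)))"
  proof -
    define P where "P n B \<longleftrightarrow> Good n B \<and> (n = 0 \<longrightarrow> B = {})" for n B
    have "P 0 {}" by (simp add: P_def Good_def)
    then obtain B where "\<forall>n. P n (B n)" "\<forall>n. Next n (B n) (B (Suc n))"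
      using dependent_nat_choice[of P Next] nxt unfolding P_def by (metis nat.distinct(1))
    then show ?thesis unfolding P_def by blast
  qed
  then obtain B where B0: "B 0 = {}" and G: "\<And>n. Good n (B n)" and Nx: "\<And>n. Next n (B n) (B (Suc n))"
    by blast
  obtain c where c: "\<And>n. set (c n) \<subseteq> N" "\<And>n. distinct (map (src (B n)) (c n))"
    "\<And>n. \<exists>u. chain (src (B n)) (dst (B n)) u (c n) u" "\<And>n. set (c n) \<inter> f ` {..<n} = {}"
    "\<And>n. B (Suc n) = B n \<oplus>\<oplus> set (c n)"
    using Nx unfolding Next_def by metis
  have S: "S c n = B n" for n
  proof (induction n)
    case 0
    then show ?case by (simp add: S_def B0)
  next
    case (Suc n)
    show ?case
    proof (rule set_eqI)
      fix e
      have "{m. m < Suc n \<and> e \<in> set (c m)} = {m. m < n \<and> e \<in> set (c m)} \<union> (if e \<in> set (c n) then {n} else {})"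
        by (auto simp: less_Suc_eq)
      then show "e \<in> S c (Suc n) \<longleftrightarrow> e \<in> B (Suc n)"
        unfolding c(5) Suc[symmetric] S_def by auto
    qed
  qed
  \<comment> \<open>Step \<open>m\<close> avoids the first \<open>m\<close> edges, so the edge with
    number \<open>k\<close> is used by steps up to \<open>k\<close> only.\<close>
  have late: "m \<le> k" if "f k \<in> set (c m)" for m k
    using c(4)[of m] that by (metis disjoint_iff imageI lessThan_iff not_le)
  have bound: "\<exists>k. \<forall>m. e \<in> set (c m) \<longrightarrow> m < k" for e
  proof (cases "e \<in> N")
    case True
    then obtain k where "e = f k" using f by blast
    then show ?thesis using late by (intro exI[of _ "Suc k"]) (auto simp: less_Suc_eq_le)
  qed (use c(1) in blast)
  have "finite {n. e \<in> set (c n)}" for e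
    using bound[of e] by (auto simp: finite_nat_set_iff_bounded)
  moreover have "odd (card {n. e \<in> set (c n)}) \<longleftrightarrow> e \<in> A" if e: "e \<in> N" for e
  proof -
    obtain k where k: "e = f k" using e f by blast
    have "{n. e \<in> set (c n)} = {n. n < Suc k \<and> e \<in> set (c n)}"
      using late k by (auto simp: less_Suc_eq_le)
    then have "odd (card {n. e \<in> set (c n)}) \<longleftrightarrow> e \<in> B (Suc k)"
      unfolding S[symmetric] S_def by simp
    also have "\<dots> \<longleftrightarrow> e \<in> A" using G[of "Suc k"] k unfolding Good_def by blast
    finally show ?thesis .
  qed
  ultimately show ?thesis using c(1,2,3) by (intro exI[of _ c]) (auto simp: S)
qed

end

text \<open>Blocks of type at most omega are placed one after another along \<open>R\<close>; the
  restriction to \<open>I\<close> allows them to be finite or empty.\<close>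

lemma Well_order_lex_nat:
  fixes I :: "('a \<times> nat) set"
  assumes R: "Well_order R" "Field R = UNIV"
  defines "r \<equiv> {(a, b). a \<in> I \<and> b \<in> I \<and> (fst a = fst b \<and> snd a \<le> snd b \<or> (fst a, fst b) \<in> R \<and> fst a \<noteq> fst b)}"
  shows "Well_order r" "Field r = I"
proof -
  have R': "trans R" "antisym R" "wf (R - Id)" "\<And>x y. (x, y) \<in> R \<or> (y, x) \<in> R"
    using R wo_rel.TOTALS[OF wo_rel.intro[OF R(1)]] by (auto simp: order_on_defs well_order_on_def)
  define L where "L a b \<longleftrightarrow> fst a = fst b \<and> snd a \<le> snd b \<or> (fst a, fst b) \<in> R \<and> fst a \<noteq> fst b"
    for a b :: "'a \<times> nat"
  have r: "(a, b) \<in> r \<longleftrightarrow> a \<in> I \<and> b \<in> I \<and> L a b" for a b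
    unfolding r_def L_def by simp
  have L_refl: "L a a" for a by (simp add: L_def)
  have L_trans: "L a c" if "L a b" "L b c" for a b c
  proof (cases "fst a = fst b \<or> fst b = fst c")
    case True
    then show ?thesis using that unfolding L_def by (metis order_trans)
  next
    case False
    then have *: "(fst a, fst b) \<in> R" "(fst b, fst c) \<in> R" using that unfolding L_def by blast+
    then have "(fst a, fst c) \<in> R" using R'(1) by (meson transD)
    moreover have "fst a \<noteq> fst c" using * False R'(2) by (metis antisymD)
    ultimately show ?thesis unfolding L_def by blast
  qed
  have L_antisym: "a = b" if "L a b" "L b a" for a b
  proof -
    have "fst a = fst b" using that R'(2) unfolding L_def by (metis antisymD)
    with that show ?thesis unfolding L_def by (metis order_antisym prod_eqI)
  qed
  have L_total: "L a b \<or> L b a" for a b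
    using R'(4)[of "fst a" "fst b"] nat_le_linear[of "snd a" "snd b"] unfolding L_def by metis
  show F: "Field r = I" using r L_refl unfolding Field_def by blast
  have "refl_on I r" using r L_refl by (auto simp: refl_on_def)
  moreover have "r \<subseteq> I \<times> I" using r by auto
  moreover have "trans r" using r L_trans by (meson transI)
  moreover have "antisym r" using r L_antisym by (meson antisymI)
  moreover have "total_on I r" using r L_total by (meson total_onI)
  moreover have "wf (r - Id)"
  proof (rule wf_subset)
    show "wf ((R - Id) <*lex*> less_than)" using R'(3) by auto
    show "r - Id \<subseteq> (R - Id) <*lex*> less_than"
    proof
      fix p assume "p \<in> r - Id"
      then obtain a b where p: "p = (a, b)" "L a b" "a \<noteq> b" using r by (cases p) auto
      then show "p \<in> (R - Id) <*lex*> less_than"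
        by (cases a, cases b) (auto simp: L_def)
    qed
  qed
  ultimately show "Well_order r" unfolding F by (simp add: order_on_defs)
qed

text \<open>The cycles of one piece do not touch the edges of another. So on the edges of
  \<open>N\<close> the orientation before index \<open>(N, n)\<close> depends only on the first
  \<open>n\<close> entries of the sequence for \<open>N\<close>, wherever this block is
  placed.\<close>

lemma (in wf_digraph) reverts_of_countable_pieces:
  assumes P: "disjoint P" "\<Union>P = arcs G" "\<And>N. N \<in> P \<Longrightarrow> countable N"
    and A: "A \<subseteq> arcs G" "\<And>N. N \<in> P \<Longrightarrow> ends.approximable (tail G) (head G) {} N A"
  shows "\<exists>(r :: ('b set \<times> nat) rel) C. reverts G C r (reverse_arcs G A)"
proof -
  interpret ends "tail G" "head G" .
  define S where "S c n = {e. odd (card {m. m < n \<and> e \<in> set (c m)})}" for c :: "nat \<Rightarrow> 'b list" and n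
  define Q where "Q N c \<longleftrightarrow> (\<forall>n. set (c n) \<subseteq> N \<and> distinct (map (src (S c n)) (c n)) \<and>
         (\<exists>u. chain (src (S c n)) (dst (S c n)) u (c n) u)) \<and>
    (\<forall>e. finite {n. e \<in> set (c n)}) \<and> (\<forall>e\<in>N. odd (card {n. e \<in> set (c n)}) \<longleftrightarrow> e \<in> A)" for N c
  have "\<forall>N\<in>P. \<exists>c. Q N c"
    unfolding Q_def S_def using countable_cycle_sequence[OF P(3) A(2)] by (rule ballI)
  then obtain c where Q: "\<And>N. N \<in> P \<Longrightarrow> Q N (c N)" using bchoice by metis
  have c: "set (c N n) \<subseteq> N" "distinct (map (src (S (c N) n)) (c N n))"
    "\<exists>u. chain (src (S (c N) n)) (dst (S (c N) n)) u (c N n) u"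
    "finite {n. e \<in> set (c N n)}"
    "e \<in> N \<Longrightarrow> odd (card {n. e \<in> set (c N n)}) \<longleftrightarrow> e \<in> A" if "N \<in> P" for N n e
    using Q[OF that, unfolded Q_def] by (metis, metis, metis, metis, metis)
  define C where "C \<xi> = c (fst \<xi>) (snd \<xi>)" for \<xi>
  \<comment> \<open>Empty entries reverse nothing and are not cycles, so their indices are
    dropped.\<close>
  define I where "I = {(N, n). N \<in> P \<and> c N n \<noteq> []}"
  obtain R :: "'b set rel" where R: "Well_order R" "Field R = UNIV"
    using well_ordering[where 'a = "'b set"] by (elim exE conjE) (rule that)
  define r where "r = {(a, b). a \<in> I \<and> b \<in> I \<and> (fst a = fst b \<and> snd a \<le> snd b \<or> (fst a, fst b) \<in> R \<and> fst a \<noteq> fst b)}"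
  have r: "Well_order r" "Field r = I" using Well_order_lex_nat[OF R, of I] by (auto simp: r_def)
  have uniq: "N = N'" if "N \<in> P" "N' \<in> P" "e \<in> N" "e \<in> N'" for N N' e
  proof (rule ccontr)
    assume "N \<noteq> N'"
    from disjointD[OF P(1) that(1,2) this] that(3,4) show False by blast
  qed
  have own: "(M, m) \<in> I \<and> e \<in> set (c M m) \<longleftrightarrow> M = N \<and> e \<in> set (c N m)"
    if N: "N \<in> P" "e \<in> N" for N e M m
  proof -
    have "M = N" if "M \<in> P" "e \<in> set (c M m)"
      using uniq[OF that(1) N(1) _ N(2)] c(1)[OF that(1)] that(2) by blast
    moreover have "c N m \<noteq> []" if "e \<in> set (c N m)" using that by auto
    ultimately show ?thesis using N(1) by (auto simp: I_def)
  qed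
  have hit: "{\<xi>\<in>I. e \<in> set (C \<xi>)} = Pair N ` {n. e \<in> set (c N n)}" if N: "N \<in> P" "e \<in> N" for N e
  proof (rule set_eqI)
    fix \<xi> :: "'b set \<times> nat"
    obtain M m where \<xi>: "\<xi> = (M, m)" by (cases \<xi>)
    show "\<xi> \<in> {\<xi>\<in>I. e \<in> set (C \<xi>)} \<longleftrightarrow> \<xi> \<in> Pair N ` {n. e \<in> set (c N n)}"
      using own[OF N, of M m] by (simp add: \<xi> C_def image_iff)
  qed
  have hit_below: "{\<xi>\<in>underS r (N, n). e \<in> set (C \<xi>)} = Pair N ` {m. m < n \<and> e \<in> set (c N m)}"
    if N: "N \<in> P" "e \<in> N" and n: "(N, n) \<in> I" for N e n
  proof (rule set_eqI)
    fix \<xi> :: "'b set \<times> nat"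
    obtain M m where \<xi>: "\<xi> = (M, m)" by (cases \<xi>)
    have "(N, m) \<in> underS r (N, n) \<longleftrightarrow> (N, m) \<in> I \<and> m < n"
      using n by (auto simp: underS_def r_def)
    moreover have "(M, m) \<in> underS r (N, n) \<Longrightarrow> (M, m) \<in> I"
      by (simp add: underS_def r_def)
    ultimately show "\<xi> \<in> {\<xi>\<in>underS r (N, n). e \<in> set (C \<xi>)} \<longleftrightarrow>
        \<xi> \<in> Pair N ` {m. m < n \<and> e \<in> set (c N m)}"
      using own[OF N, of M m] unfolding \<xi> C_def by auto
  qed
  have none: "{\<xi>\<in>I. e \<in> set (C \<xi>)} = {}" if "e \<notin> arcs G" for e
  proof -
    have "e \<notin> set (c N n)" if "N \<in> P" for N n
      using \<open>e \<notin> arcs G\<close> c(1)[OF that, of n] that P(2) by blast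
    then show ?thesis by (auto simp: I_def C_def)
  qed
  have "reverts G C r (reverse_arcs G {e. odd (card {\<eta> \<in> Field r. e \<in> set (C \<eta>)})})"
  proof (rule reverts_parity[OF r(1)])
    fix e
    show "finite {\<xi> \<in> Field r. e \<in> set (C \<xi>)}"
    proof (cases "e \<in> arcs G")
      case True
      then obtain N where "N \<in> P" "e \<in> N" using P(2) by blast
      then show ?thesis using hit c(4) by (simp add: r(2))
    qed (simp add: none r(2))
  next
    fix \<xi> assume "\<xi> \<in> Field r"
    then obtain N n where x: "\<xi> = (N, n)" "(N, n) \<in> I" "N \<in> P" "c N n \<noteq> []" by (auto simp: r(2) I_def)
    let ?X = "{e. odd (card {\<eta> \<in> underS r \<xi>. e \<in> set (C \<eta>)})}"
    interpret H: wf_digraph "reverse_arcs G ?X"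
      by unfold_locales auto
    have t: "tail (reverse_arcs G ?X) = src ?X" "head (reverse_arcs G ?X) = dst ?X"
      by (auto simp: src_def dst_def)
    have X: "e \<in> ?X \<longleftrightarrow> e \<in> S (c N) n" if "e \<in> N" for e
      using hit_below[OF x(3) that x(2)] by (simp add: x(1) S_def card_image inj_on_def)
    have eq: "src ?X e = src (S (c N) n) e" "dst ?X e = dst (S (c N) n) e" if "e \<in> set (c N n)" for e
      using X[of e] c(1)[OF x(3), of n] that by (auto simp: src_def dst_def)
    have "map (src ?X) (c N n) = map (src (S (c N) n)) (c N n)"
      by (rule map_cong[OF refl eq(1)])
    then have "distinct (map (src ?X) (c N n))" using c(2)[OF x(3), of n] by (rule ssubst)
    moreover obtain u where "chain (src (S (c N) n)) (dst (S (c N) n)) u (c N n) u"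
      using c(3)[OF x(3), of n] by (rule exE)
    then have "\<exists>u. chain (src ?X) (dst ?X) u (c N n) u"
      by (intro exI[of _ u] iffD2[OF chain_cong[OF eq]])
    moreover have "set (c N n) \<subseteq> arcs G" using c(1)[OF x(3)] x(3) P(2) by blast
    ultimately show "pre_digraph.cycle (reverse_arcs G ?X) (C \<xi>)"
      unfolding H.cycle_iff_chain t using x(4) by (simp add: C_def x(1))
  qed
  moreover have "{e. odd (card {\<eta> \<in> Field r. e \<in> set (C \<eta>)})} = A"
  proof (rule set_eqI)
    fix e
    show "e \<in> {e. odd (card {\<eta> \<in> Field r. e \<in> set (C \<eta>)})} \<longleftrightarrow> e \<in> A"
    proof (cases "e \<in> arcs G")
      case True
      then obtain N where N: "N \<in> P" "e \<in> N" using P(2) by blast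
      then show ?thesis using hit[OF N] c(5)[OF N] by (simp add: r(2) card_image inj_on_def)
    qed (use A(1) in \<open>auto simp: none r(2)\<close>)
  qed
  ultimately show ?thesis by metis
qed

section \<open>Two-colouring by compactness\<close>

lemma chain_trancl:
  assumes "chain s d u xs v" "xs \<noteq> []" "\<And>x. x \<in> set xs \<Longrightarrow> (s x, d x) \<in> R"
  shows "(u, v) \<in> R\<^sup>+"
  using assms
proof (induction xs arbitrary: u)
  case (Cons x xs)
  show ?case
  proof (cases "xs = []")
    case True
    then show ?thesis using Cons.prems by auto
  next
    case False
    then have "(d x, v) \<in> R\<^sup>+" using Cons by auto
    moreover have "(u, d x) \<in> R" using Cons.prems by auto
    ultimately show ?thesis by (rule trancl_into_trancl2[rotated])
  qed
qed simp

section \<open>Potentials, finite colourings and their limits\<close>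

context ends
begin

text \<open>A repeated edge splits the walk into a shorter walk and a closed one, whose weight is
  nonnegative by induction. Without repetition there are at most \<open>card F\<close> edges, each
  of weight at least -1.\<close>

lemma walk_weight_bounds:
  fixes w :: "'e \<Rightarrow> int"
  assumes F: "finite F" and w: "\<And>e. e \<in> F \<Longrightarrow> - 1 \<le> w e"
    and cyc: "\<And>es u. chain (src A) (dst A) u es u \<Longrightarrow> set es \<subseteq> F \<Longrightarrow> distinct es \<Longrightarrow> 0 \<le> sum w (set es)"
  shows "chain (src A) (dst A) u es v \<Longrightarrow> set es \<subseteq> F \<Longrightarrow>
    - int (card F) \<le> sum_list (map w es) \<and> (u = v \<longrightarrow> 0 \<le> sum_list (map w es))"
proof (induction "length es" arbitrary: es u v rule: less_induct)
  case less
  show ?case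
  proof (cases "distinct es")
    case True
    then have s: "sum_list (map w es) = sum w (set es)" by (rule sum_list_distinct_conv_sum_set)
    have "- int (card F) \<le> - int (card (set es))" using less.prems F by (simp add: card_mono)
    also have "\<dots> = (\<Sum>e\<in>set es. - 1)" by simp
    also have "\<dots> \<le> sum w (set es)" using w less.prems(2) by (intro sum_mono) auto
    finally show ?thesis using s cyc less.prems True by auto
  next
    case False
    then obtain a b c e where d: "es = a @ [e] @ b @ [e] @ c" using not_distinct_decomp by blast
    have 1: "chain (src A) (dst A) u (a @ e # c) v" "set (a @ e # c) \<subseteq> F"
      using less.prems d by (auto simp: chain_append)
    have 2: "chain (src A) (dst A) (src A e) (e # b) (src A e)" "set (e # b) \<subseteq> F"
      using less.prems d by (auto simp: chain_append)
    have "length (a @ e # c) < length es" "length (e # b) < length es" using d by auto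
    from less.hyps[OF this(1) 1] less.hyps[OF this(2) 2]
    show ?thesis using d by auto
  qed
qed

text \<open>The potential is a distance function: the least weight of a walk that ends at the
  vertex. The lower bound on walks makes it exist, and the shift by \<open>card F\<close> turns it
  into a natural number, so that \<open>LEAST\<close> applies.\<close>

lemma potential_exists:
  fixes w :: "'e \<Rightarrow> int"
  assumes F: "finite F" and w: "\<And>e. e \<in> F \<Longrightarrow> - 1 \<le> w e"
    and cyc: "\<And>es u. chain (src A) (dst A) u es u \<Longrightarrow> set es \<subseteq> F \<Longrightarrow> distinct es \<Longrightarrow> 0 \<le> sum w (set es)"
  shows "\<exists>\<pi> :: 'v \<Rightarrow> int. \<forall>e\<in>F. \<pi> (dst A e) \<le> \<pi> (src A e) + w e"
proof -
  define Q where "Q v k \<longleftrightarrow> (\<exists>es u. chain (src A) (dst A) u es v \<and> set es \<subseteq> F \<and>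
    int k = sum_list (map w es) + int (card F))" for v k
  define \<pi> where "\<pi> v = int (LEAST k. Q v k)" for v
  have "Q v (card F)" for v unfolding Q_def by (intro exI[of _ "[]"]) auto
  then have Q: "Q v (LEAST k. Q v k)" for v by (rule LeastI)
  have "\<pi> (dst A e) \<le> \<pi> (src A e) + w e" if e: "e \<in> F" for e
  proof -
    obtain es u where es: "chain (src A) (dst A) u es (src A e)" "set es \<subseteq> F"
      "\<pi> (src A e) = sum_list (map w es) + int (card F)"
      using Q[of "src A e"] unfolding Q_def \<pi>_def by blast
    have 1: "chain (src A) (dst A) u (es @ [e]) (dst A e)" "set (es @ [e]) \<subseteq> F"
      using es e by (auto simp: chain_append)
    have "- int (card F) \<le> sum_list (map w (es @ [e]))"
      by (rule conjunct1[OF walk_weight_bounds[OF F, where w = w and A = A]]) (fact w cyc 1)+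
    then have "0 \<le> sum_list (map w (es @ [e])) + int (card F)" by linarith
    then have k: "int (nat (sum_list (map w (es @ [e])) + int (card F))) = sum_list (map w (es @ [e])) + int (card F)"
      by simp
    then have "Q (dst A e) (nat (sum_list (map w (es @ [e])) + int (card F)))"
      unfolding Q_def using 1 by blast
    then have "(LEAST k. Q (dst A e) k) \<le> nat (sum_list (map w (es @ [e])) + int (card F))"
      by (rule Least_le)
    then have "\<pi> (dst A e) \<le> sum_list (map w (es @ [e])) + int (card F)"
      unfolding \<pi>_def using k by linarith
    also have "\<dots> = \<pi> (src A e) + w e" using es(3) by simp
    finally show ?thesis .
  qed
  then show ?thesis by blast
qed

text \<open>Closed walks replace cycles here: they include all cycles and need no condition on
  repeated vertices.\<close>

definition dicolours :: "'e set \<Rightarrow> 'e set \<Rightarrow> ('v \<Rightarrow> bool) \<Rightarrow> bool" where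
  "dicolours A F c \<longleftrightarrow> (\<forall>es u. es \<noteq> [] \<and> set es \<subseteq> F \<and> chain (src A) (dst A) u es u \<longrightarrow>
     \<not> (\<exists>k. \<forall>e\<in>set es. c (src A e) = k))"

lemma finite_two_colouring:
  assumes F: "finite F" "F \<subseteq> E" "\<And>e. e \<in> F \<Longrightarrow> t e \<noteq> h e"
    and L: "trans L" "irrefl L" "total (L :: 'v rel)"
  shows "\<exists>B\<subseteq>E. balanced A B \<and> (\<exists>c. dicolours (A \<oplus>\<oplus> B) F c)"
proof -
  have tot: "x \<noteq> y \<Longrightarrow> (x, y) \<in> L \<or> (y, x) \<in> L" and irr: "(x, x) \<notin> L"
    and tr: "(x, y) \<in> L \<Longrightarrow> (y, z) \<in> L \<Longrightarrow> (x, z) \<in> L" for x y z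
    using L by (auto simp: total_on_def irrefl_def dest: transD)
  define fwd where "fwd B e \<longleftrightarrow> (src (A \<oplus>\<oplus> B) e, dst (A \<oplus>\<oplus> B) e) \<in> L" for B e
  define g where "g B = card {e\<in>F. fwd B e}" for B
  have "B = {} \<Longrightarrow> B \<subseteq> E \<and> balanced A B" for B by simp
  then obtain B where B: "B \<subseteq> E" "balanced A B" and min: "\<And>B'. B' \<subseteq> E \<Longrightarrow> balanced A B' \<Longrightarrow> g B \<le> g B'"
    using ex_has_least_nat[of "\<lambda>B. B \<subseteq> E \<and> balanced A B" "{}" g] by auto
  define Z where "Z = A \<oplus>\<oplus> B"
  \<comment> \<open>Reversing an edge changes the count \<open>g\<close> by its weight, so by
    minimality of \<open>B\<close> closed walks without repeated edges have nonnegative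
    weight.\<close>
  define w where "w e = (if fwd B e then - 1 else 1 :: int)" for e
  have cyc: "0 \<le> sum w (set es)"
    if es: "chain (src Z) (dst Z) u es u" "set es \<subseteq> F" "distinct es" for es u
  proof -
    let ?B = "B \<oplus>\<oplus> set es"
    have "balanced A ?B" using balanced_sdiff[OF B(2)] chain_balanced[OF es(1,3)] by (simp add: Z_def)
    moreover have "?B \<subseteq> E" using B(1) es(2) F(2) by (auto simp: sdiff_def)
    ultimately have "g B \<le> g ?B" using min by blast
    have gs: "int (g X) = (\<Sum>e\<in>F. of_bool (fwd X e))" for X
      using F(1) by (simp add: g_def of_bool_def sum.If_cases Int_def)
    have "of_bool (fwd ?B e) = of_bool (fwd B e) + (if e \<in> set es then w e else 0)" if e: "e \<in> F" for e
    proof (cases "e \<in> set es")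
      case True
      then have rev: "src (A \<oplus>\<oplus> ?B) e = dst (A \<oplus>\<oplus> B) e" "dst (A \<oplus>\<oplus> ?B) e = src (A \<oplus>\<oplus> B) e"
        by (auto simp: src_def dst_def)
      have ne: "src (A \<oplus>\<oplus> B) e \<noteq> dst (A \<oplus>\<oplus> B) e" using F(3)[OF e] by (auto simp: src_def dst_def)
      have "fwd ?B e \<longleftrightarrow> \<not> fwd B e"
        unfolding fwd_def rev using tot[OF ne] irr tr by blast
      then show ?thesis using True by (simp add: w_def)
    next
      case False
      then have "src (A \<oplus>\<oplus> ?B) e = src (A \<oplus>\<oplus> B) e" "dst (A \<oplus>\<oplus> ?B) e = dst (A \<oplus>\<oplus> B) e"
        by (auto simp: src_def dst_def)
      then show ?thesis using False by (simp add: fwd_def)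
    qed
    then have "int (g ?B) = (\<Sum>e\<in>F. of_bool (fwd B e) + (if e \<in> set es then w e else 0))"
      unfolding gs by (intro sum.cong) auto
    also have "\<dots> = int (g B) + (\<Sum>e\<in>F. if e \<in> set es then w e else 0)"
      by (simp add: sum.distrib gs)
    also have "(\<Sum>e\<in>F. if e \<in> set es then w e else 0) = sum w (set es)"
      using F(1) es(2) by (simp add: sum.If_cases Int_absorb1 flip: Int_def)
    finally show ?thesis using \<open>g B \<le> g ?B\<close> by linarith
  qed
  have "- 1 \<le> w e" for e by (simp add: w_def)
  with potential_exists[OF F(1), of w Z] cyc
  obtain \<pi> :: "'v \<Rightarrow> int" where \<pi>: "\<And>e. e \<in> F \<Longrightarrow> \<pi> (dst Z e) \<le> \<pi> (src Z e) + w e"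
    by blast
  define c where "c v \<longleftrightarrow> even (\<pi> v)" for v
  \<comment> \<open>On a monochromatic closed walk the potential changes by even amounts, so a
    decreasing edge cannot raise it by one. Hence every edge descends in this order: the potential
    drops, or it stays and the edge goes down in \<open>L\<close>.\<close>
  define R where "R = {(x, y). \<pi> y < \<pi> x \<or> \<pi> y = \<pi> x \<and> (y, x) \<in> L}"
  have "trans R" using tr by (intro transI) (auto simp: R_def)
  have False if es: "es \<noteq> []" "set es \<subseteq> F" "chain (src Z) (dst Z) u es u" and k: "\<forall>e\<in>set es. c (src Z e) = k"
    for es u k
  proof -
    have dc: "c (dst Z e) = k" if "e \<in> set es" for e
    proof -
      have "chain s d v xs y \<Longrightarrow> x \<in> set xs \<Longrightarrow> d x = y \<or> d x \<in> s ` set xs" for s d :: "'e \<Rightarrow> 'v" and v xs y x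
      proof (induction xs arbitrary: v)
        case (Cons z xs)
        then show ?case by (cases xs) auto
      qed simp
      from this[OF es(3) that] have "dst Z e \<in> src Z ` set es"
        using es(1,3) by (cases es) auto
      then show ?thesis using k by auto
    qed
    have "(src Z e, dst Z e) \<in> R" if e: "e \<in> set es" for e
    proof -
      have eF: "e \<in> F" using e es(2) by blast
      have par: "even (\<pi> (dst Z e)) = even (\<pi> (src Z e))" using dc[OF e] k e by (auto simp: c_def)
      have le: "\<pi> (dst Z e) \<le> \<pi> (src Z e) + w e" using \<pi>[OF eF] .
      show ?thesis
      proof (cases "fwd B e")
        case True
        then show ?thesis using le by (simp add: R_def w_def)
      next
        case False
        have "src Z e \<noteq> dst Z e" using F(3)[OF eF] by (auto simp: src_def dst_def)
        then have "(dst Z e, src Z e) \<in> L"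
          using False tot unfolding fwd_def Z_def[symmetric] by blast
        moreover have "\<pi> (dst Z e) \<noteq> \<pi> (src Z e) + 1" using par by auto
        then have "\<pi> (dst Z e) \<le> \<pi> (src Z e)" using le False by (simp add: w_def)
        ultimately show ?thesis by (auto simp: R_def)
      qed
    qed
    then have "(u, u) \<in> R\<^sup>+" using chain_trancl[OF es(3,1)] by blast
    then have "(u, u) \<in> R" using \<open>trans R\<close> by simp
    then show False using irr by (auto simp: R_def)
  qed
  then have "dicolours Z F c" unfolding dicolours_def by blast
  then show ?thesis using B unfolding Z_def by blast
qed

text \<open>Peel cycles off \<open>B\<close> one at a time; each of them lies inside
  \<open>N\<close> or is disjoint from it.\<close>

lemma balanced_Int_piece:
  assumes cyc: "\<And>es u. es \<noteq> [] \<Longrightarrow> set es \<subseteq> E \<Longrightarrow> chain (src A) (dst A) u es u \<Longrightarrow>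
      distinct (map (src A) es) \<Longrightarrow> \<exists>N\<in>P. set es \<subseteq> N"
    and P: "disjoint P" "N \<in> P" and B: "B \<subseteq> E" "balanced A B"
  shows "balanced A (B \<inter> N)"
  using B
proof (induction "card B" arbitrary: B rule: less_induct)
  case less
  have fin: "finite B" using less.prems(2) by (simp add: balanced_def)
  show ?case
  proof (cases "B = {}")
    case False
    then obtain e where "e \<in> B" by blast
    then obtain es u where es: "set es \<subseteq> B" "e \<in> set es" "chain (src A) (dst A) u es u" "distinct (map (src A) es)"
      using balanced_cycle[OF less.prems(2)] by blast
    have bal: "balanced A (set es)" using chain_balanced[OF es(3)] es(4) by (simp add: distinct_map)
    have "excess A B v = excess A (B - set es) v + excess A (set es) v" for v
      unfolding excess_def using fin es(1) by (simp add: sum.subset_diff)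
    then have bal': "balanced A (B - set es)" using bal less.prems(2) fin by (simp add: balanced_def)
    have "card (B - set es) < card B" using fin es(1,2) by (intro psubset_card_mono) auto
    then have IH: "balanced A ((B - set es) \<inter> N)" using less.hyps bal' less.prems(1) by blast
    have "es \<noteq> []" using es(2) by auto
    then obtain N' where N': "N' \<in> P" "set es \<subseteq> N'"
      using cyc[of es u] es less.prems(1) by blast
    show ?thesis
    proof (cases "N' = N")
      case True
      then have "B \<inter> N = ((B - set es) \<inter> N) \<union> set es" using N' es(1) by blast
      then show ?thesis using balanced_Un_disjoint[OF IH bal] by auto
    next
      case False
      then have "N' \<inter> N = {}" using disjointD[OF P(1) N'(1) P(2)] by blast
      then have "B \<inter> N = (B - set es) \<inter> N" using N' by blast
      then show ?thesis using IH by simp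
    qed
  qed simp
qed

lemma two_colouring:
  assumes cyc: "\<And>es u. es \<noteq> [] \<Longrightarrow> set es \<subseteq> E \<Longrightarrow> chain (src A) (dst A) u es u \<Longrightarrow>
      distinct (map (src A) es) \<Longrightarrow> \<exists>N\<in>P. set es \<subseteq> N"
    and P: "disjoint P" "\<Union>P = E" and E: "\<And>e. e \<in> E \<Longrightarrow> t e \<noteq> h e"
    and L: "trans L" "irrefl L" "total (L :: 'v rel)"
  shows "\<exists>A' c. A' \<subseteq> E \<and> (\<forall>N\<in>P. approximable A N A') \<and> dicolours (A \<oplus>\<oplus> A') E c"
proof -
  define Good where "Good F B c \<longleftrightarrow> B \<subseteq> E \<and> balanced A B \<and> dicolours (A \<oplus>\<oplus> B) F c" for F B c
  have "\<exists>B c. Good F B c" if "finite F" "F \<subseteq> E" for F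
  proof -
    have "t e \<noteq> h e" if "e \<in> F" for e using E that \<open>F \<subseteq> E\<close> by blast
    from finite_two_colouring[OF that this L, of A] show ?thesis unfolding Good_def by blast
  qed
  then have "\<forall>F. \<exists>B c. finite F \<and> F \<subseteq> E \<longrightarrow> Good F B c" by blast
  then obtain B c where Bc: "\<And>F. finite F \<Longrightarrow> F \<subseteq> E \<Longrightarrow> Good F (B F) (c F)" by metis
  \<comment> \<open>Orientation and colouring are selected together: a finite subset of the sum type
    tests finitely many edges and vertices, and its edges determine the finite problem whose
    solution is consulted.\<close>
  define edges where "edges S = {e \<in> E. Inl e \<in> S}" for S :: "('e + 'v) set"
  define s where "s S x = (case x of Inl e \<Rightarrow> e \<in> B (edges S) | Inr v \<Rightarrow> c (edges S) v)" for S x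
  obtain g where g: "\<And>F. finite F \<Longrightarrow> \<exists>F'. finite F' \<and> F \<subseteq> F' \<and> (\<forall>x\<in>F. g x = s F' x)"
    using finite_selection[of s] by blast
  have fin: "finite (edges S)" "edges S \<subseteq> E" if "finite S" for S
  proof -
    have "edges S \<subseteq> Inl -` S" by (auto simp: edges_def)
    then show "finite (edges S)" using finite_vimageI[OF that inj_Inl] finite_subset by blast
  qed (auto simp: edges_def)
  define A' where "A' = {e \<in> E. g (Inl e)}"
  define c' where "c' v = g (Inr v)" for v
  have lim: "\<exists>F'. finite F' \<and> F' \<subseteq> E \<and> F \<subseteq> F' \<and> B F' \<inter> F = A' \<inter> F \<and> (\<forall>v\<in>V. c F' v = c' v)"
    if F: "finite F" "F \<subseteq> E" and V: "finite V" for F V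
  proof -
    obtain S where S: "finite S" "Inl ` F \<union> Inr ` V \<subseteq> S" "\<forall>x\<in>Inl ` F \<union> Inr ` V. g x = s S x"
      using g[of "Inl ` F \<union> Inr ` V"] F V by blast
    have "F \<subseteq> edges S" using S(2) F(2) by (auto simp: edges_def)
    moreover have "B (edges S) \<inter> F = A' \<inter> F"
      using S(3) F(2) by (auto simp: A'_def s_def)
    moreover have "\<forall>v\<in>V. c (edges S) v = c' v" using S(3) by (auto simp: c'_def s_def)
    ultimately show ?thesis using fin[OF S(1)] by blast
  qed
  have ap: "approximable A N A'" if N: "N \<in> P" for N
    unfolding approximable_def
  proof (intro allI impI, elim conjE)
    fix F assume F: "finite F" "F \<subseteq> N"
    then have FE: "F \<subseteq> E" using N P(2) by blast
    obtain F' where F': "finite F'" "F' \<subseteq> E" "B F' \<inter> F = A' \<inter> F"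
      using lim[OF F(1) FE finite.emptyI] by metis
    \<comment> \<open>The finite solution is balanced only as a subset of \<open>E\<close>. Its part
      in \<open>N\<close> is balanced because no cycle crosses the pieces.\<close>
    have "balanced A (B F' \<inter> N)"
    proof (rule balanced_Int_piece[OF _ P(1) N])
      show "B F' \<subseteq> E" "balanced A (B F')" using Bc[OF F'(1,2)] by (simp_all add: Good_def)
    qed (fact cyc)
    moreover have "B F' \<inter> N \<inter> F = A' \<inter> F" using F' F(2) by blast
    ultimately show "\<exists>B\<subseteq>N. balanced A B \<and> B \<inter> F = A' \<inter> F" by blast
  qed
  have False if es: "es \<noteq> []" "set es \<subseteq> E" "chain (src (A \<oplus>\<oplus> A')) (dst (A \<oplus>\<oplus> A')) u es u"
    and k: "\<forall>e\<in>set es. c' (src (A \<oplus>\<oplus> A') e) = k" for es u k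
  proof -
    obtain F where F: "finite F" "F \<subseteq> E" "set es \<subseteq> F" "B F \<inter> set es = A' \<inter> set es"
      "\<forall>v\<in>src (A \<oplus>\<oplus> A') ` set es. c F v = c' v"
      using lim[OF finite_set es(2), of "src (A \<oplus>\<oplus> A') ` set es"] by auto
    have eq: "src (A \<oplus>\<oplus> B F) e = src (A \<oplus>\<oplus> A') e" "dst (A \<oplus>\<oplus> B F) e = dst (A \<oplus>\<oplus> A') e" if "e \<in> set es" for e
      using F(4) that by (auto simp: src_def dst_def)
    have "chain (src (A \<oplus>\<oplus> B F)) (dst (A \<oplus>\<oplus> B F)) u es u"
      using es(3) by (intro iffD2[OF chain_cong[OF eq]])
    moreover have "\<forall>e\<in>set es. c F (src (A \<oplus>\<oplus> B F) e) = k" using eq(1) F(5) k by simp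
    ultimately show False using Bc[OF F(1,2)] es(1) F(3) unfolding Good_def dicolours_def by blast
  qed
  then have "dicolours (A \<oplus>\<oplus> A') E c'" unfolding dicolours_def by blast
  moreover have "A' \<subseteq> E" by (auto simp: A'_def)
  ultimately show ?thesis using ap by blast
qed

end

section \<open>Removing virtual arcs from cycles\<close>

lemma rtrancl_Un_image_finite:
  assumes "(x, y) \<in> (f ` X \<union> J)\<^sup>*"
  shows "\<exists>F. finite F \<and> F \<subseteq> X \<and> (x, y) \<in> (f ` F \<union> J)\<^sup>*"
  using assms
proof (induction rule: rtrancl_induct)
  case base
  show ?case by (intro exI[of _ "{}"]) auto
next
  case (step y z)
  then obtain F where F: "finite F" "F \<subseteq> X" "(x, y) \<in> (f ` F \<union> J)\<^sup>*" by blast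
  from step(2) show ?case
  proof
    assume "(y, z) \<in> f ` X"
    then obtain e where e: "e \<in> X" "(y, z) = f e" by blast
    have "(x, y) \<in> (f ` insert e F \<union> J)\<^sup>*"
      using F(3) by (rule subsetD[OF rtrancl_mono, rotated]) auto
    moreover have "(y, z) \<in> f ` insert e F \<union> J" using e by auto
    ultimately have "(x, z) \<in> (f ` insert e F \<union> J)\<^sup>*" by (rule rtrancl_into_rtrancl)
    then show ?case using F e by (intro exI[of _ "insert e F"]) auto
  next
    assume "(y, z) \<in> J"
    then have "(x, z) \<in> (f ` F \<union> J)\<^sup>*" using F(3) by (meson UnI2 rtrancl_into_rtrancl)
    then show ?case using F by blast
  qed
qed

text \<open>For a strict well-order \<open>R\<close> this is the lexicographic order of
  characteristic functions: at the first difference it is \<open>B\<close> that has the element.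
  Proper subsets come first.\<close>

definition lexless :: "'a rel \<Rightarrow> 'a set \<Rightarrow> 'a set \<Rightarrow> bool" where
  "lexless R A B \<longleftrightarrow> (\<exists>m. m \<in> B \<and> m \<notin> A \<and> (\<forall>k. (k, m) \<in> R \<longrightarrow> (k \<in> A \<longleftrightarrow> k \<in> B)))"

lemma lexless_irrefl: "\<not> lexless R A A"
  by (simp add: lexless_def)

lemma lexless_trans:
  assumes R: "trans R" "total_on Z R" and sub: "B \<subseteq> Z" "C \<subseteq> Z"
    and lt: "lexless R A B" "lexless R B C"
  shows "lexless R A C"
proof -
  obtain m n where m: "m \<in> B" "m \<notin> A" "\<And>k. (k, m) \<in> R \<Longrightarrow> k \<in> A \<longleftrightarrow> k \<in> B"
    and n: "n \<in> C" "n \<notin> B" "\<And>k. (k, n) \<in> R \<Longrightarrow> k \<in> B \<longleftrightarrow> k \<in> C"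
    using lt unfolding lexless_def by blast
  have "m \<noteq> n" using m n by blast
  then consider "(m, n) \<in> R" | "(n, m) \<in> R"
    using R(2) m(1) n(1) sub unfolding total_on_def by blast
  then show ?thesis
  proof cases
    case 1
    then have "m \<in> C" using n(3) m(1) by blast
    moreover have "k \<in> A \<longleftrightarrow> k \<in> C" if "(k, m) \<in> R" for k
      using m(3)[OF that] n(3)[of k] transD[OF R(1) that 1] by blast
    ultimately show ?thesis using m(2) unfolding lexless_def by blast
  next
    case 2
    then have "n \<notin> A" using m(3) n(2) by blast
    moreover have "k \<in> A \<longleftrightarrow> k \<in> C" if "(k, n) \<in> R" for k
      using n(3)[OF that] m(3)[of k] transD[OF R(1) that 2] by blast
    ultimately show ?thesis using n(1) unfolding lexless_def by blast
  qed
qed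

lemma lexless_total:
  assumes R: "wf R" and ne: "A \<noteq> B"
  shows "lexless R A B \<or> lexless R B A"
proof -
  obtain x where x: "x \<in> A \<oplus>\<oplus> B" using ne by auto
  obtain m where m: "m \<in> A \<oplus>\<oplus> B" "\<And>k. (k, m) \<in> R \<Longrightarrow> k \<notin> A \<oplus>\<oplus> B"
    using wfE_min[OF R x] by blast
  have "k \<in> A \<longleftrightarrow> k \<in> B" if "(k, m) \<in> R" for k using m(2)[OF that] by simp
  then show ?thesis using m(1) unfolding lexless_def by auto
qed

lemma card_of_subset_union_infinite:
  assumes "infinite K" "|A| \<le>o |K|" "|B| \<le>o |K|"
  shows "|A \<union> B| \<le>o |K|"
  using assms by (intro card_of_Un_ordLeq_infinite_Field) (auto simp: Field_card_of card_of_card_order_on)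

lemma finite_card_of_ordLeq: "finite A \<Longrightarrow> infinite K \<Longrightarrow> |A| \<le>o |K|"
  using card_of_ordLeq_finite[of K A] not_ordLeq_iff_ordLess[OF card_of_Well_order card_of_Well_order, of K A]
    ordLess_imp_ordLeq by blast

context ends
begin

abbreviation vs :: "'e set \<Rightarrow> 'v set" where "vs N \<equiv> t ` N \<union> h ` N"

lemma src_vs: "e \<in> N \<Longrightarrow> src A e \<in> vs N" and dst_vs: "e \<in> N \<Longrightarrow> dst A e \<in> vs N"
  by (auto simp: src_def dst_def)

text \<open>Edges and virtual arcs become items of the same walk, a virtual arc being a triple with
  \<open>None\<close>. This is why \<open>chain\<close> is generic in its items. Recording the edge
  keeps parallel edges apart.\<close>

definition real_item :: "'e set \<Rightarrow> 'e \<Rightarrow> 'v \<times> 'v \<times> 'e option" where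
  "real_item A e = (src A e, dst A e, Some e)"

lemma excess_Un: "finite P \<Longrightarrow> finite Q \<Longrightarrow> P \<inter> Q = {} \<Longrightarrow> excess A (P \<union> Q) v = excess A P v + excess A Q v"
  unfolding excess_def by (rule sum.union_disjoint)

text \<open>From the last item to the first, virtual arcs are replaced by paths that avoid
  \<open>F\<close>, \<open>B\<close> and the edges taken so far; outside \<open>B\<close> such a
  path has its original direction. Since \<open>r\<close> does not drop along virtual arcs, the drop
  of \<open>r\<close> along the walk is at most that along the real edges \<open>Q\<close>.\<close>

lemma realise_walk:
  fixes r :: "'v \<Rightarrow> int"
  assumes fin: "finite F" "finite B"
    and J: "\<And>a b S. (a, b) \<in> J \<Longrightarrow> finite S \<Longrightarrow> (a, b) \<in> (step {} (X - S))\<^sup>*"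
    and r: "\<And>a b. (a, b) \<in> J \<Longrightarrow> r a \<le> r b"
  shows "chain fst (\<lambda>p. fst (snd p)) u ws v \<Longrightarrow> distinct (map fst ws) \<Longrightarrow>
    set ws \<subseteq> real_item B ` F \<union> {(a, b, None) | a b. (a, b) \<in> J} \<Longrightarrow>
    \<exists>P Q. Q \<subseteq> F \<and> src B ` Q \<subseteq> fst ` set ws \<and> P \<subseteq> X - F \<and> finite P \<and>
      (\<forall>w. excess B (P \<union> Q) w = of_bool (u = w) - of_bool (v = w)) \<and>
      r u - r v \<le> (\<Sum>e\<in>Q. r (src B e) - r (dst B e))"
proof (induction ws arbitrary: u)
  case Nil
  then show ?case by (intro exI[of _ "{}"]) (auto simp: excess_def)
next
  case (Cons it ws)
  obtain a b k where it: "it = (a, b, k)" by (cases it)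
  have a: "a = u" using Cons.prems(1) it by simp
  have ws: "chain fst (\<lambda>p. fst (snd p)) b ws v" "distinct (map fst ws)"
    "set ws \<subseteq> real_item B ` F \<union> {(a, b, None) | a b. (a, b) \<in> J}"
    using Cons.prems it by auto
  from Cons.IH[OF ws] obtain P Q where "Q \<subseteq> F \<and> src B ` Q \<subseteq> fst ` set ws \<and> P \<subseteq> X - F \<and> finite P \<and>
      (\<forall>w. excess B (P \<union> Q) w = of_bool (b = w) - of_bool (v = w)) \<and>
      r b - r v \<le> (\<Sum>e\<in>Q. r (src B e) - r (dst B e))"
    by (elim exE)
  then have PQ: "Q \<subseteq> F" "src B ` Q \<subseteq> fst ` set ws" "P \<subseteq> X - F" "finite P"
    "\<And>w. excess B (P \<union> Q) w = of_bool (b = w) - of_bool (v = w)"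
    "r b - r v \<le> (\<Sum>e\<in>Q. r (src B e) - r (dst B e))" for w
    by simp_all
  have finQ: "finite Q" using PQ(1) fin(1) by (rule finite_subset)
  have "it \<in> real_item B ` F \<union> {(a, b, None) | a b. (a, b) \<in> J}" using Cons.prems(3) by auto
  then consider e where "e \<in> F" "it = real_item B e" | "k = None" "(a, b) \<in> J" using it by auto
  then show ?case
  proof cases
    case 1
    then have e: "src B e = u" "dst B e = b" using it a by (auto simp: real_item_def)
    \<comment> \<open>Distinct sources keep a real edge from being used twice.\<close>
    have "u \<notin> fst ` set ws" using Cons.prems(2) it a by auto
    then have eQ: "e \<notin> Q" using PQ(2) e by blast
    have eP: "e \<notin> P" using PQ(3) 1 by blast
    have "excess B (P \<union> insert e Q) w = of_bool (u = w) - of_bool (v = w)" for w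
    proof -
      have "P \<union> insert e Q = insert e (P \<union> Q)" by blast
      moreover have "excess B (insert e (P \<union> Q)) w = of_bool (u = w) - of_bool (b = w) + excess B (P \<union> Q) w"
        unfolding excess_def using eQ eP e finQ PQ(4) by simp
      ultimately show ?thesis using PQ(5)[of w] by simp
    qed
    moreover have "r u - r v \<le> (\<Sum>e\<in>insert e Q. r (src B e) - r (dst B e))"
      using PQ(6) eQ finQ e by simp
    moreover have "src B ` insert e Q \<subseteq> fst ` set (it # ws)" using PQ(2) e it a by auto
    ultimately show ?thesis using 1(1) PQ(1,3,4)
      by (intro exI[of _ P] exI[of _ "insert e Q"] conjI allI insert_subsetI)
  next
    case 2
    have "(a, b) \<in> (step {} (X - (F \<union> B \<union> P)))\<^sup>*" using J[OF 2(2)] fin PQ(4) by simp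
    then obtain es where es: "set es \<subseteq> X - (F \<union> B \<union> P)" "chain (src {}) (dst {}) a es b"
      "distinct (map (src {}) es)" using rtrancl_step_chain by blast
    have "excess B (set es) w = excess {} (set es) w" for w
      using es(1) by (intro excess_cong) auto
    then have ex: "excess B (set es) w = of_bool (u = w) - of_bool (b = w)" for w
      using chain_excess[OF es(2)] es(3) a by (simp add: distinct_map)
    have "excess B ((P \<union> set es) \<union> Q) w = of_bool (u = w) - of_bool (v = w)" for w
    proof -
      have "(P \<union> set es) \<union> Q = set es \<union> (P \<union> Q)" by blast
      moreover have "excess B (set es \<union> (P \<union> Q)) w = excess B (set es) w + excess B (P \<union> Q) w"
        using es(1) PQ(1) finQ PQ(4) by (intro excess_Un) auto
      ultimately show ?thesis using PQ(5)[of w] ex[of w] by simp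
    qed
    moreover have "r u - r v \<le> (\<Sum>e\<in>Q. r (src B e) - r (dst B e))"
      using PQ(6) r[OF 2(2)] a by simp
    moreover have "P \<union> set es \<subseteq> X - F" "finite (P \<union> set es)" using es(1) PQ(3,4) by auto
    moreover have "src B ` Q \<subseteq> fst ` set (it # ws)" using PQ(2) by auto
    ultimately show ?thesis using PQ(1)
      by (intro exI[of _ "P \<union> set es"] exI[of _ Q] conjI allI)
  qed
qed

text \<open>Rank a vertex by the number of its \<open>J\<close>-predecessors among the ends of
  \<open>F\<close>, and choose \<open>B\<close> to minimise the total drop of the rank along
  \<open>F\<close>. A forbidden walk from \<open>y\<close> to \<open>x\<close>, closed up by a path
  realising \<open>(x, y)\<close>, would yield a circulation whose reversal lowers this
  total.\<close>

lemma finite_thinning: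
  assumes F: "finite F" "F \<subseteq> X"
    and J: "\<And>a b S. (a, b) \<in> J \<Longrightarrow> finite S \<Longrightarrow> (a, b) \<in> (step {} (X - S))\<^sup>*"
    and ord: "trans J" "irrefl J"
  shows "\<exists>B\<subseteq>X. balanced {} B \<and> J\<inverse> \<inter> (step B F \<union> J)\<^sup>* = {}"
proof -
  define r where "r v = card {x \<in> vs F. (x, v) \<in> J}" for v
  have finV: "finite (vs F)" using F(1) by simp
  have rV: "r v \<le> card (vs F)" for v unfolding r_def by (rule card_mono[OF finV]) auto
  have mono: "r a \<le> r b" if "(a, b) \<in> J" for a b
    unfolding r_def using that transD[OF ord(1)] finV by (intro card_mono) auto
  have strict: "r a < r b" if "(a, b) \<in> J" "a \<in> vs F" for a b
    unfolding r_def using that transD[OF ord(1)] finV ord(2)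
    by (intro psubset_card_mono) (auto simp: irrefl_def)
  \<comment> \<open>The shift by \<open>card (vs F)\<close> for each edge bounds the ranks from
    above and makes the total a natural number, so that a minimum exists.\<close>
  define g where "g B = (\<Sum>e\<in>F. r (src B e) + (card (vs F) - r (dst B e)))" for B
  have g: "int (g B) = (\<Sum>e\<in>F. int (r (src B e)) - int (r (dst B e)) + int (card (vs F)))" for B
    unfolding g_def of_nat_sum
  proof (rule sum.cong[OF refl])
    fix e
    show "int (r (src B e) + (card (vs F) - r (dst B e))) =
        int (r (src B e)) - int (r (dst B e)) + int (card (vs F))"
      using rV[of "dst B e"] by (simp add: of_nat_diff trans_le_add2)
  qed
  have "B = {} \<Longrightarrow> B \<subseteq> X \<and> balanced {} B" for B by simp
  then obtain B where B: "B \<subseteq> X" "balanced {} B" and min: "\<And>B'. B' \<subseteq> X \<Longrightarrow> balanced {} B' \<Longrightarrow> g B \<le> g B'"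
    using ex_has_least_nat[of "\<lambda>B. B \<subseteq> X \<and> balanced {} B" "{}" g] by auto
  have finB: "finite B" using B(2) by (simp add: balanced_def)
  let ?I = "real_item B ` F \<union> {(a, b, None) | a b. (a, b) \<in> J}"
  define W where "W x y ws \<longleftrightarrow> (x, y) \<in> J \<and> chain fst (\<lambda>p. fst (snd p)) y ws x \<and> set ws \<subseteq> ?I \<and>
    distinct (map fst ws) \<and> x \<notin> fst ` set ws" for x y ws
  have noW: "\<not> W x y ws" for x y ws
  proof
    assume "W x y ws"
    then have "\<exists>p. case p of (x, y, ws) \<Rightarrow> W x y ws" by (intro exI[of _ "(x, y, ws)"]) simp
    then obtain p where "case p of (x, y, ws) \<Rightarrow> W x y ws"
      and minp: "\<And>q. (case q of (x, y, ws) \<Rightarrow> W x y ws) \<Longrightarrow> length (snd (snd p)) \<le> length (snd (snd q))"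
      using ex_has_least_nat[of "\<lambda>p. case p of (x, y, ws) \<Rightarrow> W x y ws" _ "\<lambda>p. length (snd (snd p))"] by metis
    then obtain x y ws where w: "W x y ws"
      and minw: "\<And>x' y' ws'. W x' y' ws' \<Longrightarrow> length ws \<le> length ws'"
      by (cases p) fastforce
    have "ws \<noteq> []" using w ord(2) by (auto simp: W_def irrefl_def)
    then obtain ws' a b k where ws: "ws = ws' @ [(a, b, k)]" by (metis rev_exhaust prod_cases3)
    have b: "b = x" using w ws by (auto simp: W_def chain_append)
    have "(a, b, k) \<in> ?I" using w ws by (auto simp: W_def)
    \<comment> \<open>A final virtual arc \<open>(a, x)\<close> would compose with
      \<open>(x, y)\<close> to a shorter counterexample. So the last item is a real edge and
      \<open>x\<close> is an end of an edge of \<open>F\<close>; being counted for \<open>y\<close>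
      but not for itself, it makes the rank strictly larger at \<open>y\<close>.\<close>
    moreover have "(a, b) \<notin> J"
    proof
      assume "(a, b) \<in> J"
      then have "(a, y) \<in> J" using w b ord(1) by (auto simp: W_def dest: transD)
      then have "W a y ws'" using w ws by (auto simp: W_def chain_append)
      from minw[OF this] show False using ws by simp
    qed
    ultimately have xV: "x \<in> vs F" using b dst_vs by (auto simp: real_item_def)
    let ?r = "\<lambda>v. int (r v)"
    have Wx: "chain fst (\<lambda>p. fst (snd p)) y ws x" "distinct (map fst ws)" "set ws \<subseteq> ?I" "(x, y) \<in> J" "x \<notin> fst ` set ws"
      using w by (auto simp: W_def)
    have "\<exists>P Q. Q \<subseteq> F \<and> src B ` Q \<subseteq> fst ` set ws \<and> P \<subseteq> X - F \<and> finite P \<and>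
        (\<forall>w. excess B (P \<union> Q) w = of_bool (y = w) - of_bool (x = w)) \<and>
        ?r y - ?r x \<le> (\<Sum>e\<in>Q. ?r (src B e) - ?r (dst B e))"
      by (rule realise_walk[OF F(1) finB _ _ Wx(1,2,3)]) (use J mono in auto)
    then obtain P Q where "Q \<subseteq> F \<and> src B ` Q \<subseteq> fst ` set ws \<and> P \<subseteq> X - F \<and> finite P \<and>
        (\<forall>w. excess B (P \<union> Q) w = of_bool (y = w) - of_bool (x = w)) \<and>
        ?r y - ?r x \<le> (\<Sum>e\<in>Q. ?r (src B e) - ?r (dst B e))"
      by (elim exE)
    then have PQ: "Q \<subseteq> F" "P \<subseteq> X - F" "finite P"
      "excess B (P \<union> Q) w = of_bool (y = w) - of_bool (x = w)"
      "?r y - ?r x \<le> (\<Sum>e\<in>Q. ?r (src B e) - ?r (dst B e))"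
      for w by simp_all
    have "(x, y) \<in> (step {} (X - (F \<union> B \<union> P)))\<^sup>*" using J[OF Wx(4)] F(1) finB PQ(3) by simp
    then obtain es where es: "set es \<subseteq> X - (F \<union> B \<union> P)" "chain (src {}) (dst {}) x es y"
      "distinct (map (src {}) es)" using rtrancl_step_chain by blast
    have "excess B (set es) w = excess {} (set es) w" for w
      using es(1) by (intro excess_cong) auto
    then have ex: "excess B (set es) w = of_bool (x = w) - of_bool (y = w)" for w
      using chain_excess[OF es(2)] es(3) by (simp add: distinct_map)
    define T where "T = set es \<union> (P \<union> Q)"
    have finQ: "finite Q" using PQ(1) F(1) by (rule finite_subset)
    have finT: "finite T" using finQ PQ(3) by (simp add: T_def)
    have "excess B T w = 0" for w
    proof -
      have "excess B T w = excess B (set es) w + excess B (P \<union> Q) w"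
        unfolding T_def using es(1) PQ(1,3) finQ by (intro excess_Un) auto
      then show ?thesis using PQ(4)[of w] ex[of w] by simp
    qed
    then have "balanced B T" using finT by (simp add: balanced_def)
    then have "balanced {} (B \<oplus>\<oplus> T)" using balanced_sdiff[OF B(2) finT] by simp
    moreover have "B \<oplus>\<oplus> T \<subseteq> X" using B(1) es(1) PQ(1,2) F(2) by (auto simp: T_def sdiff_def)
    ultimately have "g B \<le> g (B \<oplus>\<oplus> T)" by (rule min[rotated])
    \<comment> \<open>Within \<open>F\<close> exactly the edges of \<open>Q\<close> are reversed,
      and each reversal negates a difference of ranks; hence the factor 2.\<close>
    moreover have "int (g (B \<oplus>\<oplus> T)) = int (g B) - 2 * (\<Sum>e\<in>Q. ?r (src B e) - ?r (dst B e))"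
    proof -
      have TF: "e \<in> T \<longleftrightarrow> e \<in> Q" if "e \<in> F" for e using that es(1) PQ(1,2) by (auto simp: T_def)
      have "int (g (B \<oplus>\<oplus> T)) = (\<Sum>e\<in>F. (?r (src B e) - ?r (dst B e) + int (card (vs F))) -
          (if e \<in> Q then 2 * (?r (src B e) - ?r (dst B e)) else 0))"
        unfolding g by (rule sum.cong) (auto simp: src_def dst_def TF)
      also have "\<dots> = int (g B) - (\<Sum>e\<in>F. if e \<in> Q then 2 * (?r (src B e) - ?r (dst B e)) else 0)"
        by (simp add: sum_subtractf g)
      also have "(\<Sum>e\<in>F. if e \<in> Q then 2 * (?r (src B e) - ?r (dst B e)) else 0) =
          (\<Sum>e\<in>Q. 2 * (?r (src B e) - ?r (dst B e)))"
        using F(1) PQ(1) by (simp add: sum.If_cases Int_absorb1 flip: Int_def)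
      finally show ?thesis by (simp add: sum_distrib_left)
    qed
    moreover have "?r x < ?r y" using strict[OF Wx(4) xV] by simp
    ultimately show False using PQ(5) by linarith
  qed
  have "J\<inverse> \<inter> (step B F \<union> J)\<^sup>* = {}"
  proof (rule ccontr)
    assume "\<not> ?thesis"
    then obtain x y where xy: "(x, y) \<in> J" "(y, x) \<in> (step B F \<union> J)\<^sup>*" by auto
    from xy(2) have "\<exists>ws. set ws \<subseteq> ?I \<and> chain fst (\<lambda>p. fst (snd p)) y ws x"
    proof (induction rule: rtrancl_induct)
      case base
      show ?case by (intro exI[of _ "[]"]) simp
    next
      case (step a b)
      then obtain ws where ws: "set ws \<subseteq> ?I" "chain fst (\<lambda>p. fst (snd p)) y ws a" by blast
      from step(2) have "\<exists>k. (a, b, k) \<in> ?I" by (auto simp: step_def real_item_def)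
      then obtain k where "(a, b, k) \<in> ?I" by blast
      with ws show ?case by (intro exI[of _ "ws @ [(a, b, k)]"]) (auto simp: chain_append)
    qed
    then obtain ws where ws: "set ws \<subseteq> ?I" "chain fst (\<lambda>p. fst (snd p)) y ws x" by blast
    from chain_vertex_simple[OF ws(2)] obtain ws' where "set ws' \<subseteq> set ws"
      "chain fst (\<lambda>p. fst (snd p)) y ws' x" "distinct (map fst ws')" "x \<notin> fst ` set ws'" by blast
    then have "W x y ws'" using ws(1) xy(1) unfolding W_def by blast
    then show False using noW by blast
  qed
  then show ?thesis using B by blast
qed

definition conn :: "'e set \<Rightarrow> 'v rel" where
  "conn X = {(x, y). \<forall>S. finite S \<or> |S| <o |X| \<longrightarrow> (x, y) \<in> (step {} (X - S))\<^sup>*}"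

text \<open>A forbidden walk uses finitely many edges, so the finite solutions pass to a limit by
  compactness.\<close>

lemma thinning:
  assumes J: "\<And>a b S. (a, b) \<in> J \<Longrightarrow> finite S \<Longrightarrow> (a, b) \<in> (step {} (X - S))\<^sup>*"
    and ord: "trans J" "irrefl J"
  shows "\<exists>A. approximable {} X A \<and> J\<inverse> \<inter> (step A X \<union> J)\<^sup>* = {}"
proof -
  have "\<forall>F. \<exists>B. finite F \<and> F \<subseteq> X \<longrightarrow> B \<subseteq> X \<and> balanced {} B \<and> J\<inverse> \<inter> (step B F \<union> J)\<^sup>* = {}"
    using finite_thinning[OF _ _ J ord] by blast
  then obtain B where B: "\<And>F. finite F \<Longrightarrow> F \<subseteq> X \<Longrightarrow>
      B F \<subseteq> X \<and> balanced {} (B F) \<and> J\<inverse> \<inter> (step (B F) F \<union> J)\<^sup>* = {}" by metis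
  obtain g where g: "\<And>F. finite F \<Longrightarrow> \<exists>F'. finite F' \<and> F \<subseteq> F' \<and> (\<forall>x\<in>F. g x = (x \<in> B (F' \<inter> X)))"
    using finite_selection[of "\<lambda>F x. x \<in> B (F \<inter> X)"] by blast
  define A where "A = {e. g e}"
  have lim: "\<exists>F'. finite F' \<and> F' \<subseteq> X \<and> F \<subseteq> F' \<and> B F' \<inter> F = A \<inter> F" if F: "finite F" "F \<subseteq> X" for F
  proof -
    obtain F' where F': "finite F'" "F \<subseteq> F'" "\<forall>x\<in>F. g x = (x \<in> B (F' \<inter> X))" using g[OF F(1)] by blast
    then show ?thesis using F(2) by (intro exI[of _ "F' \<inter> X"]) (auto simp: A_def)
  qed
  have "approximable {} X A"
    unfolding approximable_def using lim B by meson
  moreover have "J\<inverse> \<inter> (step A X \<union> J)\<^sup>* = {}"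
  proof (rule ccontr)
    assume "\<not> ?thesis"
    then obtain x y where xy: "(x, y) \<in> J" "(y, x) \<in> (step A X \<union> J)\<^sup>*" by auto
    obtain F where F: "finite F" "F \<subseteq> X" "(y, x) \<in> (step A F \<union> J)\<^sup>*"
      using rtrancl_Un_image_finite[OF xy(2)[unfolded step_def]] unfolding step_def by blast
    obtain F' where F': "finite F'" "F' \<subseteq> X" "F \<subseteq> F'" "B F' \<inter> F = A \<inter> F" using lim[OF F(1,2)] by blast
    have "step A F \<union> J \<subseteq> step (B F') F' \<union> J"
      using step_cong[OF F'(4)] step_mono[OF F'(3), of "B F'"] by auto
    then have "(y, x) \<in> (step (B F') F' \<union> J)\<^sup>*" using F(3) rtrancl_mono by blast
    then show False using B[OF F'(1,2)] xy(1) by blast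
  qed
  ultimately show ?thesis by blast
qed

text \<open>Close off in countably many rounds, each of which adds at most \<open>|K|\<close> sets
  of size at most \<open>|K|\<close>.\<close>

lemma small_closure:
  assumes K: "infinite (K :: 'k set)" and M: "|M| \<le>o |K|" and N0: "|N0| \<le>o |K|"
    and Gen: "\<And>x y. |Gen x y| \<le>o |K|"
  shows "\<exists>N. N0 \<subseteq> N \<and> |N| \<le>o |K| \<and> (\<forall>x\<in>vs (M \<union> N). \<forall>y\<in>vs (M \<union> N). Gen x y \<subseteq> N) \<and>
    N \<subseteq> N0 \<union> (\<Union>x y. Gen x y)"
proof -
  define nxt where "nxt N = N \<union> (\<Union>x\<in>vs (M \<union> N). \<Union>y\<in>vs (M \<union> N). Gen x y)" for N
  define f where "f n = (nxt ^^ n) N0" for n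
  have vsK: "|vs N| \<le>o |K|" if "|N| \<le>o |K|" for N
    using that card_of_image[of t N] card_of_image[of h N] ordLeq_transitive
    by (intro card_of_subset_union_infinite[OF K]) blast+
  have nxtK: "|nxt N| \<le>o |K|" if N: "|N| \<le>o |K|" for N
  proof -
    have V: "|vs (M \<union> N)| \<le>o |K|" by (intro vsK card_of_subset_union_infinite[OF K] M N)
    show ?thesis unfolding nxt_def
      by (intro card_of_subset_union_infinite[OF K N] card_of_UNION_ordLeq_infinite[OF K V] ballI Gen)
  qed
  have fK: "|f n| \<le>o |K|" for n
    unfolding f_def by (induction n) (auto intro: nxtK N0)
  have fS: "f (Suc n) = nxt (f n)" for n by (simp add: f_def)
  have inc: "f n \<subseteq> f (Suc n)" for n by (auto simp: fS nxt_def)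
  have mono: "f m \<subseteq> f n" if "m \<le> n" for m n using that inc by (rule lift_Suc_mono_le[rotated])
  define N where "N = (\<Union>n. f n)"
  have "|N| \<le>o |K|"
    unfolding N_def using K infinite_iff_card_of_nat fK by (intro card_of_UNION_ordLeq_infinite[OF K]) auto
  moreover have "N0 \<subseteq> N" unfolding N_def f_def by (metis UN_upper UNIV_I funpow_0)
  moreover have "Gen x y \<subseteq> N" if xy: "x \<in> vs (M \<union> N)" "y \<in> vs (M \<union> N)" for x y
  proof -
    obtain m n where "x \<in> vs (M \<union> f m)" "y \<in> vs (M \<union> f n)" using xy unfolding N_def by blast
    then have "x \<in> vs (M \<union> f (max m n))" "y \<in> vs (M \<union> f (max m n))"
      using mono[of m "max m n"] mono[of n "max m n"] by auto
    then have "Gen x y \<subseteq> f (Suc (max m n))" unfolding fS nxt_def by blast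
    then show ?thesis unfolding N_def by blast
  qed
  moreover have "f n \<subseteq> N0 \<union> (\<Union>x y. Gen x y)" for n
  proof (induction n)
    case (Suc n)
    then show ?case unfolding fS nxt_def by blast
  qed (simp add: f_def)
  then have "N \<subseteq> N0 \<union> (\<Union>x y. Gen x y)" unfolding N_def by blast
  ultimately show ?thesis by blast
qed

text \<open>A recursion along \<open>|K|\<close> picks pairwise edge-disjoint paths: the earlier
  ones use at most \<open>|K|\<close> edges in total and can be avoided. Fewer than
  \<open>|K|\<close> edges cannot meet all of them.\<close>

lemma disjoint_paths:
  assumes K: "infinite (K :: 'k set)"
    and xy: "\<And>S. |S| \<le>o |K| \<Longrightarrow> (x, y) \<in> (step {} (Y - S))\<^sup>*"
  shows "\<exists>G\<subseteq>Y. |G| \<le>o |K| \<and> (\<forall>S. |S| <o |K| \<longrightarrow> (x, y) \<in> (step {} (G - S))\<^sup>*)"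
proof -
  define r where "r = |K|"
  have w: "Well_order r" "Field r = K" unfolding r_def by (rule card_of_Well_order, rule Field_card_of)
  define P where "P f k s \<longleftrightarrow> s \<subseteq> Y - (\<Union>j\<in>underS r k. f j) \<and> finite s \<and> (x, y) \<in> (step {} s)\<^sup>*"
    for f :: "'k \<Rightarrow> 'e set" and k s
  have "\<exists>f. \<forall>k. P f k (f k)"
  proof (rule dependent_wf_choice[of "r - Id"])
    show "wf (r - Id)" using w(1) by (simp add: well_order_on_def)
    fix f g :: "'k \<Rightarrow> 'e set" and k s assume "\<And>z. (z, k) \<in> r - Id \<Longrightarrow> f z = g z"
    then have "(\<Union>j\<in>underS r k. f j) = (\<Union>j\<in>underS r k. g j)" by (auto simp: underS_def)
    then show "P f k s = P g k s" by (simp add: P_def)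
  next
    fix k f assume IH: "\<And>j. (j, k) \<in> r - Id \<Longrightarrow> P f j (f j)"
    have "underS r k \<subseteq> K" using w(2) by (auto simp: underS_def Field_def)
    then have "|underS r k| \<le>o |K|" by (rule card_of_mono1)
    moreover have "|f j| \<le>o |K|" if "j \<in> underS r k" for j
      using IH[of j] that by (intro finite_card_of_ordLeq[OF _ K]) (auto simp: underS_def P_def)
    ultimately have "|\<Union>j\<in>underS r k. f j| \<le>o |K|"
      by (intro card_of_UNION_ordLeq_infinite[OF K]) auto
    from xy[OF this] obtain es where "set es \<subseteq> Y - (\<Union>j\<in>underS r k. f j)" "chain (src {}) (dst {}) x es y"
      using rtrancl_step_chain by blast
    then have "P f k (set es)" using chain_rtrancl_step by (auto simp: P_def)
    then show "\<exists>s. P f k s" by blast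
  qed
  then obtain f where f: "\<And>k. f k \<subseteq> Y" "\<And>k. finite (f k)" "\<And>k. (x, y) \<in> (step {} (f k))\<^sup>*"
    and dj: "\<And>k j. j \<in> underS r k \<Longrightarrow> f k \<inter> f j = {}" unfolding P_def by blast
  have disj: "f k \<inter> f j = {}" if "k \<in> K" "j \<in> K" "k \<noteq> j" for k j
    using dj[of j k] dj[of k j] that w wo_rel.TOTALS[OF wo_rel.intro[OF w(1)]]
    unfolding underS_def by blast
  define G where "G = (\<Union>k\<in>K. f k)"
  have "|G| \<le>o |K|"
    unfolding G_def using finite_card_of_ordLeq[OF f(2) K]
    by (intro card_of_UNION_ordLeq_infinite[OF K]) (auto intro: ordIso_imp_ordLeq card_of_refl)
  moreover have "G \<subseteq> Y" using f(1) by (auto simp: G_def)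
  moreover have "(x, y) \<in> (step {} (G - S))\<^sup>*" if S: "|S| <o |K|" for S
  proof -
    have "\<exists>k\<in>K. f k \<inter> S = {}"
    proof (rule ccontr)
      assume "\<not> ?thesis"
      then have "\<forall>k\<in>K. \<exists>s. s \<in> f k \<inter> S" by blast
      from bchoice[OF this] obtain s where s: "\<forall>k\<in>K. s k \<in> f k \<inter> S" by (elim exE)
      have "inj_on s K"
      proof (rule inj_onI, rule ccontr)
        fix k j assume kj: "k \<in> K" "j \<in> K" "s k = s j" "k \<noteq> j"
        then have "s k \<in> f k" "s k \<in> f j" using bspec[OF s, of k] bspec[OF s, of j] by auto
        then show False using disj[OF kj(1,2,4)] by blast
      qed
      moreover have "s ` K \<subseteq> S" using s by blast
      ultimately have "|K| \<le>o |S|" using card_of_ordLeq by blast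
      then show False using S not_ordLess_ordLeq by blast
    qed
    then obtain k where k: "k \<in> K" "f k \<inter> S = {}" by blast
    then have "f k \<subseteq> G - S" unfolding G_def by blast
    then have "(step {} (f k))\<^sup>* \<subseteq> (step {} (G - S))\<^sup>*" by (intro rtrancl_mono step_mono)
    then show ?thesis using f(3)[of k] by (rule subsetD)
  qed
  ultimately show ?thesis by blast
qed

end

section \<open>Levels of connectivity\<close>

lemma chain_segments:
  assumes seg: "\<And>sg a b. set sg \<subseteq> set ws \<Longrightarrow> \<forall>x\<in>set sg. \<not> m x \<Longrightarrow> chain s d a sg b \<Longrightarrow>
      a \<in> Y \<Longrightarrow> b \<in> Y \<Longrightarrow> (a, b) \<in> R\<^sup>*"
    and mark: "\<And>x. x \<in> set ws \<Longrightarrow> m x \<Longrightarrow> (s x, d x) \<in> R\<^sup>* \<and> s x \<in> Y \<and> d x \<in> Y"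
  shows "chain s d u ws v \<Longrightarrow> u \<in> Y \<Longrightarrow> v \<in> Y \<Longrightarrow> (u, v) \<in> R\<^sup>*"
proof -
  have "set ys \<subseteq> set ws \<Longrightarrow> chain s d u ys v \<Longrightarrow> u \<in> Y \<Longrightarrow> v \<in> Y \<Longrightarrow> (u, v) \<in> R\<^sup>*" for ys
  proof (induction "length ys" arbitrary: ys u rule: less_induct)
    case less
    show ?case
    proof (cases "\<exists>x\<in>set ys. m x")
      case False
      then show ?thesis using seg less.prems by blast
    next
      case True
      then obtain sg x zs where d: "ys = sg @ x # zs" "m x" "\<forall>y\<in>set sg. \<not> m y"
        using split_list_first_prop[of ys m] by blast
      have x: "(s x, d x) \<in> R\<^sup>*" "s x \<in> Y" "d x \<in> Y" using mark[of x] d less.prems(1) by auto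
      have "chain s d u sg (s x)" "chain s d (d x) zs v" using less.prems(2) d by (auto simp: chain_append)
      then have "(u, s x) \<in> R\<^sup>*" "(d x, v) \<in> R\<^sup>*"
        using seg[of sg u "s x"] less.hyps[of zs "d x"] d less.prems x by auto
      with x(1) show ?thesis by (meson rtrancl_trans)
    qed
  qed
  from this[OF order_refl] show "chain s d u ws v \<Longrightarrow> u \<in> Y \<Longrightarrow> v \<in> Y \<Longrightarrow> (u, v) \<in> R\<^sup>*" .
qed

text \<open>Rotate the walk to start at \<open>i\<close> and cut it at the first and the last marked
  item; the stretch after the last one runs cyclically into the stretch before the first.\<close>

lemma cyclic_split:
  assumes i: "i \<in> set ws" "\<not> m i" and x: "x \<in> set ws" "m x"
  shows "\<exists>n sg rest. rotate n ws = sg @ rest \<and> i \<in> set sg \<and> (\<forall>y\<in>set sg. \<not> m y) \<and>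
    rest \<noteq> [] \<and> m (hd rest) \<and> m (last rest)"
proof -
  obtain p q where ws: "ws = p @ i # q" using split_list[OF i(1)] by blast
  define L where "L = i # q @ p"
  have L: "L = rotate (length p) ws" unfolding L_def ws by (simp add: rotate_append)
  have "\<exists>y\<in>set L. m y" using x L by auto
  then obtain s1 y L' where s1: "L = s1 @ y # L'" "m y" "\<forall>z\<in>set s1. \<not> m z"
    using split_list_first_prop[of L m] by blast
  have "i \<in> set s1" using s1 i(2) L_def by (cases s1) auto
  have "\<exists>z\<in>set (y # L'). m z" using s1(2) by simp
  then obtain a z s2 where s2: "y # L' = a @ z # s2" "m z" "\<forall>y\<in>set s2. \<not> m y"
    using split_list_last_prop[of "y # L'" m] by blast
  have "rotate (length (s1 @ a @ [z])) L = s2 @ s1 @ a @ [z]"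
    unfolding s1(1) s2(1) using rotate_append[of "s1 @ a @ [z]" s2] by simp
  then have "rotate (length (s1 @ a @ [z]) + length p) ws = (s2 @ s1) @ (a @ [z])"
    unfolding L by (simp add: rotate_rotate)
  moreover have "hd (a @ [z]) = y" using s2(1) by (cases a) auto
  ultimately show ?thesis
    using \<open>i \<in> set s1\<close> s1 s2 by (intro exI[of _ "length (s1 @ a @ [z]) + length p"] exI[of _ "s2 @ s1"] exI[of _ "a @ [z]"]) auto
qed

lemma chain_rotate_n:
  assumes "chain s d u ws u"
  shows "\<exists>w. chain s d w (rotate n ws) w"
proof -
  have "chain s d u (take (n mod length ws) ws @ drop (n mod length ws) ws) u" using assms by simp
  from chain_rotate[OF this] show ?thesis by (simp add: rotate_drop_take)
qed

text \<open>
  \<open>\<rho>\<close> compares first by the levels \<open>C\<close>, then by \<open>\<rho>\<^sub>0\<close>: on every level it linearly orders the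
  classes of mutually related elements, extending the preorder of that level, and the classes are
  intervals.
\<close>

lemma level_order:
  fixes C :: "'i \<Rightarrow> 'v rel" and r :: "'i rel"
  assumes r: "Well_order r"
    and C: "\<And>\<alpha> x. (x, x) \<in> C \<alpha>" "\<And>\<alpha>. trans (C \<alpha>)" "\<And>\<alpha> \<beta>. (\<beta>, \<alpha>) \<in> r \<Longrightarrow> C \<alpha> \<subseteq> C \<beta>"
    and r0: "trans \<rho>\<^sub>0" "irrefl \<rho>\<^sub>0" "total \<rho>\<^sub>0"
  shows "\<exists>\<rho> le. trans \<rho> \<and> irrefl \<rho> \<and> total \<rho> \<and>
    (\<forall>x y. (x, y) \<in> \<rho>\<^sub>0 \<and> (\<forall>\<alpha>\<in>Field r. (x, y) \<in> C \<alpha>) \<longrightarrow> (x, y) \<in> \<rho>) \<and>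
    (\<forall>\<alpha>\<in>Field r. trans (le \<alpha>) \<and> C \<alpha> \<subseteq> le \<alpha> \<and>
      (\<forall>x y. (x, y) \<in> \<rho> \<and> (x, y) \<notin> C \<alpha> \<longrightarrow> (x, y) \<in> le \<alpha> \<and> (y, x) \<notin> le \<alpha>))"
proof -
  have wr: "wf (r - Id)" "trans r" "antisym r" "\<And>a b. a \<in> Field r \<Longrightarrow> b \<in> Field r \<Longrightarrow> (a, b) \<in> r \<or> (b, a) \<in> r"
    using r wo_rel.TOTALS[OF wo_rel.intro[OF r]] by (auto simp: order_on_defs well_order_on_def)
  obtain v :: "'v rel" where v: "Well_order v" "Field v = UNIV"
    using well_ordering[where 'a = 'v] by (elim exE conjE) (rule that)
  have wv: "wf (v - Id)" "trans v" "antisym v" "\<And>a b. (a, b) \<in> v \<or> (b, a) \<in> v"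
    using v wo_rel.TOTALS[OF wo_rel.intro[OF v(1)]] by (auto simp: order_on_defs well_order_on_def)
  define Z where "Z = Field r \<times> (UNIV :: 'v set)"
  define R where "R = (r - Id) <*lex*> (v - Id)"
  have tr: "trans (s - Id)" if "trans s" "antisym s" for s :: "'x rel"
    using that by (auto intro!: transI dest: transD antisymD)
  have R: "wf R" "trans R" "total_on Z R"
    unfolding R_def using wr(1) wv(1) tr[OF wr(2,3)] tr[OF wv(2,3)] wr(4) wv(4)
    by (auto intro!: trans_lex_prod simp: total_on_def Z_def)
  \<comment> \<open>\<open>K x\<close> records the elements below \<open>x\<close> on every level.
    The lexicographic comparison looks at earlier levels first, so restricting it to the levels up
    to \<open>\<alpha>\<close>, as \<open>Ka\<close> does, gives a coarser version of the same
    order.\<close>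
  define K where "K x = {(\<alpha>, w). \<alpha> \<in> Field r \<and> (w, x) \<in> C \<alpha>}" for x
  define Ka where "Ka \<alpha> x = {(\<beta>, w). (\<beta>, \<alpha>) \<in> r \<and> (w, x) \<in> C \<beta>}" for \<alpha> x
  have KZ: "K x \<subseteq> Z" "Ka \<alpha> x \<subseteq> Z" for x \<alpha> by (auto simp: K_def Ka_def Z_def Field_def)
  define \<rho> where "\<rho> = {(x, y). lexless R (K x) (K y) \<or> K x = K y \<and> (x, y) \<in> \<rho>\<^sub>0}"
  define le where "le \<alpha> = {(x, y). Ka \<alpha> x = Ka \<alpha> y \<or> lexless R (Ka \<alpha> x) (Ka \<alpha> y)}" for \<alpha>
  note lt = lexless_trans[OF R(2,3)]
  have sub: "lexless R A B" if "A \<subset> B" for A B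
  proof -
    have ne: "A \<noteq> B" using that by auto
    have "\<not> lexless R B A" using psubsetD[OF that] unfolding lexless_def by metis
    then show ?thesis using lexless_total[OF R(1) ne] by simp
  qed
  have "trans \<rho>"
  proof (rule transI)
    fix x y z assume "(x, y) \<in> \<rho>" "(y, z) \<in> \<rho>"
    then have "lexless R (K x) (K y) \<or> K x = K y \<and> (x, y) \<in> \<rho>\<^sub>0"
      "lexless R (K y) (K z) \<or> K y = K z \<and> (y, z) \<in> \<rho>\<^sub>0" by (simp_all add: \<rho>_def)
    then have "lexless R (K x) (K z) \<or> K x = K z \<and> (x, z) \<in> \<rho>\<^sub>0"
      using lt[OF KZ(1) KZ(1), of "K x" y z] transD[OF r0(1), of x y z] by metis
    then show "(x, z) \<in> \<rho>" by (simp add: \<rho>_def)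
  qed
  moreover have "irrefl \<rho>" using r0(2) lexless_irrefl by (auto simp: \<rho>_def irrefl_def)
  moreover have "total \<rho>"
    unfolding total_on_def
  proof (intro ballI impI)
    fix x y :: 'v assume "x \<noteq> y"
    then have "(x, y) \<in> \<rho>\<^sub>0 \<or> (y, x) \<in> \<rho>\<^sub>0" using r0(3) by (simp add: total_on_def)
    moreover have "K x = K y \<or> lexless R (K x) (K y) \<or> lexless R (K y) (K x)"
      using lexless_total[OF R(1), of "K x" "K y"] by blast
    ultimately have "(lexless R (K x) (K y) \<or> K x = K y \<and> (x, y) \<in> \<rho>\<^sub>0) \<or>
        (lexless R (K y) (K x) \<or> K y = K x \<and> (y, x) \<in> \<rho>\<^sub>0)" by metis
    then show "(x, y) \<in> \<rho> \<or> (y, x) \<in> \<rho>" by (simp add: \<rho>_def)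
  qed
  moreover have "(x, y) \<in> \<rho>" if "(x, y) \<in> \<rho>\<^sub>0" "\<forall>\<alpha>\<in>Field r. (x, y) \<in> C \<alpha>" for x y
  proof -
    have "K x \<subseteq> K y" using that(2) C(2) unfolding K_def by (auto dest: transD)
    then show ?thesis using that(1) sub[of "K x" "K y"] unfolding \<rho>_def by blast
  qed
  moreover have "trans (le \<alpha>) \<and> C \<alpha> \<subseteq> le \<alpha> \<and>
      (\<forall>x y. (x, y) \<in> \<rho> \<and> (x, y) \<notin> C \<alpha> \<longrightarrow> (x, y) \<in> le \<alpha> \<and> (y, x) \<notin> le \<alpha>)" if \<alpha>: "\<alpha> \<in> Field r" for \<alpha>
  proof (intro conjI allI impI)
    show "trans (le \<alpha>)"
    proof (rule transI)
      fix x y z assume "(x, y) \<in> le \<alpha>" "(y, z) \<in> le \<alpha>"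
      then have "Ka \<alpha> x = Ka \<alpha> y \<or> lexless R (Ka \<alpha> x) (Ka \<alpha> y)"
        "Ka \<alpha> y = Ka \<alpha> z \<or> lexless R (Ka \<alpha> y) (Ka \<alpha> z)" by (simp_all add: le_def)
      then have "Ka \<alpha> x = Ka \<alpha> z \<or> lexless R (Ka \<alpha> x) (Ka \<alpha> z)"
        using lt[OF KZ(2) KZ(2), of "Ka \<alpha> x" \<alpha> y \<alpha> z] by metis
      then show "(x, z) \<in> le \<alpha>" by (simp add: le_def)
    qed
    show "C \<alpha> \<subseteq> le \<alpha>"
    proof (intro subrelI)
      fix x y assume "(x, y) \<in> C \<alpha>"
      then have "Ka \<alpha> x \<subseteq> Ka \<alpha> y" using C(2,3) unfolding Ka_def by (blast dest: transD)
      then show "(x, y) \<in> le \<alpha>" using sub[of "Ka \<alpha> x" "Ka \<alpha> y"] unfolding le_def by blast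
    qed
    fix x y assume xy: "(x, y) \<in> \<rho> \<and> (x, y) \<notin> C \<alpha>"
    \<comment> \<open>By reflexivity \<open>(\<alpha>, x)\<close> tells \<open>K x\<close> from
      \<open>K y\<close>. So their first difference occurs at a level not beyond
      \<open>\<alpha>\<close> and is still visible in \<open>Ka\<close>.\<close>
    have refl: "(\<alpha>, x) \<in> K x" "(\<alpha>, x) \<notin> K y" using \<alpha> C(1) xy by (auto simp: K_def)
    then have "lexless R (K x) (K y)" using xy unfolding \<rho>_def by auto
    then obtain m where m: "m \<in> K y" "m \<notin> K x" "\<And>k. (k, m) \<in> R \<Longrightarrow> k \<in> K x \<longleftrightarrow> k \<in> K y"
      unfolding lexless_def by blast
    obtain \<beta> w where mw: "m = (\<beta>, w)" by (cases m)
    have \<beta>: "\<beta> \<in> Field r" using m(1) mw by (simp add: K_def)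
    have "(\<beta>, \<alpha>) \<in> r"
    proof (rule ccontr)
      assume n: "(\<beta>, \<alpha>) \<notin> r"
      then have "(\<alpha>, \<beta>) \<in> r - Id" using wr(4)[OF \<alpha> \<beta>] by auto
      then have "((\<alpha>, x), m) \<in> R" by (simp add: R_def mw)
      then show False using m(3) refl by blast
    qed
    have inKa: "p \<in> Ka \<alpha> z \<longleftrightarrow> p \<in> K z \<and> (fst p, \<alpha>) \<in> r" for p z
      by (auto simp: Ka_def K_def Field_def)
    have "lexless R (Ka \<alpha> x) (Ka \<alpha> y)"
      unfolding lexless_def
    proof (intro exI[of _ m] conjI allI impI)
      show "m \<in> Ka \<alpha> y" "m \<notin> Ka \<alpha> x" using m(1,2) \<open>(\<beta>, \<alpha>) \<in> r\<close> inKa mw by auto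
      show "k \<in> Ka \<alpha> x \<longleftrightarrow> k \<in> Ka \<alpha> y" if "(k, m) \<in> R" for k using m(3)[OF that] inKa by simp
    qed
    then show "(x, y) \<in> le \<alpha>" by (simp add: le_def)
    show "(y, x) \<notin> le \<alpha>"
    proof
      assume "(y, x) \<in> le \<alpha>"
      then have "Ka \<alpha> y = Ka \<alpha> x \<or> lexless R (Ka \<alpha> y) (Ka \<alpha> x)" by (simp add: le_def)
      then have "lexless R (Ka \<alpha> x) (Ka \<alpha> x)"
        using \<open>lexless R (Ka \<alpha> x) (Ka \<alpha> y)\<close> lt[OF KZ(2) KZ(2), of "Ka \<alpha> x" \<alpha> y \<alpha> x] by metis
      then show False using lexless_irrefl by blast
    qed
  qed
  ultimately show ?thesis by (intro exI[of _ \<rho>] exI[of _ le]) blast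
qed

section \<open>Levels, separators and the filtration\<close>

context ends
begin

text \<open>\<open>|X|\<close> is a cardinal well-order on \<open>X\<close> itself, so the edges of
  \<open>X\<close> serve as indices of the stages and each has fewer than \<open>|X|\<close>
  predecessors.\<close>

abbreviation preds :: "'e set \<Rightarrow> 'e \<Rightarrow> 'e set" where
  "preds X \<alpha> \<equiv> underS |X| \<alpha>"

text \<open>The copy of \<open>nat\<close> turns the number of predecessors into an infinite
  cardinal, namely its maximum with aleph-0.\<close>

abbreviation Kset :: "'e set \<Rightarrow> 'e \<Rightarrow> ('e + nat) set" where
  "Kset X \<alpha> \<equiv> preds X \<alpha> <+> (UNIV :: nat set)"

text \<open>The threshold bounds the size of all stages up to \<open>\<alpha>\<close> together, so a
  pair of this level stays connected after their removal.\<close>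

definition level :: "'e set \<Rightarrow> 'e \<Rightarrow> 'v rel" where
  "level X \<alpha> = {(x, y). \<forall>S. |S| \<le>o |Kset X \<alpha>| \<longrightarrow> (x, y) \<in> (step {} (X - S))\<^sup>*}"

lemma infinite_Kset: "infinite (Kset X \<alpha>)"
  by (simp add: finite_Plus_iff)

lemma card_of_subset_mono: "A \<subseteq> B \<Longrightarrow> |B| \<le>o |K| \<Longrightarrow> |A| \<le>o |K|"
  using card_of_mono1 ordLeq_transitive by blast

lemma underS_subset_of: "(\<beta>, \<alpha>) \<in> |X| \<Longrightarrow> preds X \<beta> \<subseteq> preds X \<alpha>"
  using card_of_Well_order[of X] by (auto simp: underS_def order_on_defs dest: transD antisymD)

lemma Kset_mono: "(\<beta>, \<alpha>) \<in> |X| \<Longrightarrow> |Kset X \<beta>| \<le>o |Kset X \<alpha>|"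
  using underS_subset_of by (intro card_of_mono1) auto

lemma level_mono: "(\<beta>, \<alpha>) \<in> |X| \<Longrightarrow> level X \<alpha> \<subseteq> level X \<beta>"
  unfolding level_def using Kset_mono ordLeq_transitive by blast

lemma level_refl: "(x, x) \<in> level X \<alpha>"
  by (simp add: level_def)

lemma level_trans: "trans (level X \<alpha>)"
  unfolding level_def by (intro transI) (auto intro: rtrancl_trans)

lemma levelD: "(x, y) \<in> level X \<alpha> \<Longrightarrow> |S| \<le>o |Kset X \<alpha>| \<Longrightarrow> (x, y) \<in> (step {} (X - S))\<^sup>*"
  unfolding level_def by blast

lemma reach_antimono: "(x, y) \<in> (step A Y)\<^sup>* \<Longrightarrow> Y \<subseteq> Y' \<Longrightarrow> (x, y) \<in> (step A Y')\<^sup>*"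
  using rtrancl_mono[OF step_mono] by blast

lemma Kset_less:
  assumes "uncountable X" "\<alpha> \<in> X"
  shows "|Kset X \<alpha>| <o |X|"
proof -
  have inf: "infinite X" using assms(1) uncountable_infinite by blast
  have "|preds X \<alpha>| <o |X|" using card_of_underS[of "|X|" \<alpha>] assms(2)
    by (simp add: card_of_card_order_on Field_card_of)
  moreover have "|UNIV :: nat set| <o |X|"
  proof (rule ccontr)
    assume "\<not> ?thesis"
    then have "|X| \<le>o |UNIV :: nat set|"
      using not_ordLeq_iff_ordLess[OF card_of_Well_order card_of_Well_order] by blast
    then have "countable X" unfolding card_of_ordLeq[symmetric] countable_def by auto
    then show False using assms(1) by blast
  qed
  ultimately show ?thesis using card_of_Plus_ordLess_infinite[OF inf] by blast
qed

lemma conn_subset_level: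
  assumes "uncountable X" "\<alpha> \<in> X"
  shows "conn X \<subseteq> level X \<alpha>"
  unfolding conn_def level_def using ordLeq_ordLess_trans[OF _ Kset_less[OF assms]] by blast

text \<open>At the first index with infinitely many predecessors where \<open>(x, y)\<close> drops
  out of the level, some separator is no larger than the set of predecessors. An injection
  \<open>h\<close> into it spreads the separator out: \<open>Z \<delta>\<close> is the part with
  codes up to \<open>\<delta>\<close>. If each stage absorbs its own part, the union of the stages
  before such an index already contains the whole separator.\<close>

lemma separators:
  "\<exists>Z. (\<forall>\<alpha>. |Z \<alpha>| \<le>o |Kset X \<alpha>| ) \<and> (\<forall>\<alpha> \<beta>. (\<alpha>, \<beta>) \<in> |X| \<longrightarrow> Z \<alpha> \<subseteq> Z \<beta>) \<and>
    (\<forall>\<alpha>\<in>X. infinite (preds X \<alpha>) \<and> (x, y) \<notin> level X \<alpha> \<longrightarrow>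
      (x, y) \<notin> (step {} (X - (\<Union>\<delta>\<in>preds X \<alpha>. Z \<delta>)))\<^sup>*)"
proof -
  let ?r = "|X|"
  have w: "Well_order ?r" "Field ?r = X" by (rule card_of_Well_order, rule Field_card_of)
  have wr: "trans ?r" "antisym ?r" "refl_on X ?r"
    using w by (auto simp: order_on_defs)
  define Q where "Q = {\<alpha>\<in>X. infinite (underS ?r \<alpha>) \<and> (x, y) \<notin> level X \<alpha>}"
  show ?thesis
  proof (cases "Q = {}")
    case True
    then show ?thesis unfolding Q_def by (intro exI[of _ "\<lambda>_. {}"]) (auto simp: card_of_empty)
  next
    case False
    have "Q \<subseteq> Field ?r" using w(2) by (auto simp: Q_def)
    then obtain \<alpha>\<^sub>0 where a0: "\<alpha>\<^sub>0 \<in> Q" "\<And>\<alpha>. \<alpha> \<in> Q \<Longrightarrow> (\<alpha>\<^sub>0, \<alpha>) \<in> ?r"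
      using wo_rel.minim_in[OF wo_rel.intro[OF w(1)] _ False] wo_rel.minim_least[OF wo_rel.intro[OF w(1)], of Q]
      by blast
    then obtain S where S: "|S| \<le>o |Kset X \<alpha>\<^sub>0|" "(x, y) \<notin> (step {} (X - S))\<^sup>*"
      by (auto simp: Q_def level_def)
    have "|UNIV :: nat set| \<le>o |underS ?r \<alpha>\<^sub>0|" using a0(1) infinite_iff_card_of_nat by (auto simp: Q_def)
    then have "|Kset X \<alpha>\<^sub>0| =o |underS ?r \<alpha>\<^sub>0|" using a0(1) by (intro card_of_Plus_infinite1) (auto simp: Q_def)
    then have "|S| \<le>o |underS ?r \<alpha>\<^sub>0|" using S(1) ordLeq_ordIso_trans by blast
    then obtain h where h: "inj_on h S" "h ` S \<subseteq> underS ?r \<alpha>\<^sub>0" unfolding card_of_ordLeq[symmetric] by blast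
    define Z where "Z \<delta> = {s\<in>S. (h s, \<delta>) \<in> ?r}" for \<delta>
    have "|Z \<alpha>| \<le>o |Kset X \<alpha>|" for \<alpha>
    proof -
      have "h ` Z \<alpha> \<subseteq> underS ?r \<alpha> \<union> {\<alpha>}" by (auto simp: Z_def underS_def)
      moreover have "inj_on h (Z \<alpha>)" using h(1) by (rule inj_on_subset) (auto simp: Z_def)
      ultimately have "|Z \<alpha>| \<le>o |underS ?r \<alpha> \<union> {\<alpha>}|" unfolding card_of_ordLeq[symmetric] by blast
      moreover have "|underS ?r \<alpha> \<union> {\<alpha>}| \<le>o |Kset X \<alpha>|"
        by (intro card_of_subset_union_infinite infinite_Kset card_of_Plus1 finite_card_of_ordLeq) auto
      ultimately show ?thesis by (rule ordLeq_transitive)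
    qed
    moreover have "Z \<alpha> \<subseteq> Z \<beta>" if "(\<alpha>, \<beta>) \<in> ?r" for \<alpha> \<beta>
      using that wr(1) by (auto simp: Z_def dest: transD)
    moreover have "(x, y) \<notin> (step {} (X - (\<Union>\<delta>\<in>underS ?r \<alpha>. Z \<delta>)))\<^sup>*" if "\<alpha> \<in> Q" for \<alpha>
    proof
      assume xy: "(x, y) \<in> (step {} (X - (\<Union>\<delta>\<in>underS ?r \<alpha>. Z \<delta>)))\<^sup>*"
      have "s \<in> (\<Union>\<delta>\<in>underS ?r \<alpha>. Z \<delta>)" if s: "s \<in> S" for s
      proof
        have hs: "h s \<in> underS ?r \<alpha>\<^sub>0" using h(2) s by blast
        then show "h s \<in> underS ?r \<alpha>" using underS_subset_of[OF a0(2)[OF \<open>\<alpha> \<in> Q\<close>]] by blast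
        have "h s \<in> X" using hs w(2) by (auto simp: underS_def Field_def)
        then show "s \<in> Z (h s)" using s wr(3) by (auto simp: Z_def refl_on_def)
      qed
      then have "X - (\<Union>\<delta>\<in>underS ?r \<alpha>. Z \<delta>) \<subseteq> X - S" by blast
      from reach_antimono[OF xy this] show False using S(2) by blast
    qed
    ultimately show ?thesis unfolding Q_def by (intro exI[of _ Z]) blast
  qed
qed

text \<open>The last three conditions make the stage closed. Vertices of \<open>N\<close> are joined
  outside \<open>M \<union> N\<close> only if they form a pair of the level; for such a pair
  \<open>N\<close> itself has enough paths, so the induction hypothesis for \<open>N\<close> can
  treat the jump as a virtual arc; and the prescribed parts of separators are absorbed.\<close>

definition stage :: "'e set \<Rightarrow> ('v \<Rightarrow> 'v \<Rightarrow> 'e \<Rightarrow> 'e set) \<Rightarrow> 'e \<Rightarrow> 'e set \<Rightarrow> 'e set \<Rightarrow> bool" where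
  "stage X Z \<alpha> M N \<longleftrightarrow> N \<subseteq> X - M \<and> (\<alpha> \<in> X \<longrightarrow> \<alpha> \<in> M \<union> N) \<and> |N| \<le>o |Kset X \<alpha>| \<and>
    (\<forall>x\<in>vs N. \<forall>y\<in>vs N. (x, y) \<in> (step {} (X - (M \<union> N)))\<^sup>* \<longrightarrow> (x, y) \<in> level X \<alpha>) \<and>
    (\<forall>x\<in>vs N. \<forall>y\<in>vs N. (x, y) \<in> level X \<alpha> \<longrightarrow> (x, y) \<in> conn N) \<and>
    (\<forall>x\<in>vs (M \<union> N). \<forall>y\<in>vs (M \<union> N). Z x y \<alpha> \<inter> X \<subseteq> M \<union> N)"

text \<open>Each pair of vertices contributes a family of disjoint paths avoiding \<open>M\<close>
  if it is in the level, and a separator otherwise. \<open>N\<close> is closed off under these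
  contributions.\<close>

lemma stage_exists:
  assumes M: "|M| \<le>o |Kset X \<alpha>|" and Z: "\<And>x y. |Z x y \<alpha>| \<le>o |Kset X \<alpha>|"
  shows "\<exists>N. stage X Z \<alpha> M N"
proof -
  let ?K = "Kset X \<alpha>"
  note K = infinite_Kset[of X \<alpha>]
  have "\<exists>G\<subseteq>X - M. |G| \<le>o |?K| \<and>
      ((x, y) \<in> level X \<alpha> \<longrightarrow> (\<forall>S. |S| <o |?K| \<longrightarrow> (x, y) \<in> (step {} (G - S))\<^sup>*)) \<and>
      ((x, y) \<notin> level X \<alpha> \<longrightarrow> (x, y) \<notin> (step {} (X - (M \<union> G)))\<^sup>*)" for x y
  proof (cases "(x, y) \<in> level X \<alpha>")
    case True
    have "(x, y) \<in> (step {} (X - M - S))\<^sup>*" if "|S| \<le>o |?K|" for S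
      using levelD[OF True, of "M \<union> S"] card_of_subset_union_infinite[OF K M that]
      by (simp add: Diff_eq Int_assoc)
    from disjoint_paths[OF K this] show ?thesis using True by blast
  next
    case False
    then obtain S where S: "|S| \<le>o |?K|" "(x, y) \<notin> (step {} (X - S))\<^sup>*" by (auto simp: level_def)
    have "|S \<inter> X - M| \<le>o |?K|" using S(1) by (rule card_of_subset_mono[rotated]) auto
    moreover have "(x, y) \<notin> (step {} (X - (M \<union> (S \<inter> X - M))))\<^sup>*"
      using S(2) reach_antimono[of x y "{}" "X - (M \<union> (S \<inter> X - M))" "X - S"] by blast
    ultimately show ?thesis using False by (intro exI[of _ "S \<inter> X - M"]) auto
  qed
  then obtain G where G: "\<And>x y. G x y \<subseteq> X - M" "\<And>x y. |G x y| \<le>o |?K|"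
    "\<And>x y S. (x, y) \<in> level X \<alpha> \<Longrightarrow> |S| <o |?K| \<Longrightarrow> (x, y) \<in> (step {} (G x y - S))\<^sup>*"
    "\<And>x y. (x, y) \<notin> level X \<alpha> \<Longrightarrow> (x, y) \<notin> (step {} (X - (M \<union> G x y)))\<^sup>*"
    by metis
  define Gen where "Gen x y = G x y \<union> (Z x y \<alpha> \<inter> X - M)" for x y
  have GenK: "|Gen x y| \<le>o |?K|" for x y
    unfolding Gen_def
    by (intro card_of_subset_union_infinite[OF K G(2)] card_of_subset_mono[OF _ Z]) auto
  have N0: "|{\<alpha>} \<inter> X - M| \<le>o |?K|" by (rule finite_card_of_ordLeq[OF _ K]) simp
  obtain N where "{\<alpha>} \<inter> X - M \<subseteq> N \<and> |N| \<le>o |?K| \<and>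
      (\<forall>x\<in>vs (M \<union> N). \<forall>y\<in>vs (M \<union> N). Gen x y \<subseteq> N) \<and> N \<subseteq> ({\<alpha>} \<inter> X - M) \<union> (\<Union>x y. Gen x y)"
    using small_closure[where Gen = Gen, OF K M N0 GenK] by (elim exE)
  then have N: "{\<alpha>} \<inter> X - M \<subseteq> N" "|N| \<le>o |?K|"
    "x \<in> vs (M \<union> N) \<Longrightarrow> y \<in> vs (M \<union> N) \<Longrightarrow> Gen x y \<subseteq> N"
    "N \<subseteq> ({\<alpha>} \<inter> X - M) \<union> (\<Union>x y. Gen x y)" for x y
    by (simp_all only:)
  have NX: "N \<subseteq> X - M" using N(4) G(1) unfolding Gen_def by blast
  have GN: "G x y \<subseteq> N" if "x \<in> vs N" "y \<in> vs N" for x y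
    using N(3)[of x y] that unfolding Gen_def by blast
  have "stage X Z \<alpha> M N"
    unfolding stage_def
  proof (intro conjI ballI impI)
    show "N \<subseteq> X - M" "|N| \<le>o |?K|" by (fact NX, fact N(2))
    show "\<alpha> \<in> M \<union> N" if "\<alpha> \<in> X" using N(1) that by blast
  next
    fix x y assume xy: "x \<in> vs N" "y \<in> vs N" "(x, y) \<in> (step {} (X - (M \<union> N)))\<^sup>*"
    have "X - (M \<union> N) \<subseteq> X - (M \<union> G x y)" using GN[OF xy(1,2)] by blast
    from reach_antimono[OF xy(3) this] show "(x, y) \<in> level X \<alpha>" using G(4) by blast
  next
    fix x y assume xy: "x \<in> vs N" "y \<in> vs N" "(x, y) \<in> level X \<alpha>"
    show "(x, y) \<in> conn N"
      unfolding conn_def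
    proof (intro CollectI case_prodI allI impI)
      fix S :: "'e set" assume "finite S \<or> |S| <o |N|"
      then have "|S| <o |?K|"
      proof
        assume "finite S"
        then show ?thesis using K card_of_ordLeq_finite[of ?K S]
            not_ordLeq_iff_ordLess[OF card_of_Well_order card_of_Well_order, of ?K S] by blast
      qed (rule ordLess_ordLeq_trans[OF _ N(2)])
      then have "(x, y) \<in> (step {} (G x y - S))\<^sup>*" by (rule G(3)[OF xy(3)])
      then show "(x, y) \<in> (step {} (N - S))\<^sup>*" by (rule reach_antimono) (use GN[OF xy(1,2)] in blast)
    qed
  next
    fix x y assume "x \<in> vs (M \<union> N)" "y \<in> vs (M \<union> N)"
    from N(3)[OF this] show "Z x y \<alpha> \<inter> X \<subseteq> M \<union> N" unfolding Gen_def by blast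
  qed
  then show ?thesis by blast
qed

lemma filtration_exists:
  assumes Z: "\<And>x y \<alpha>. |Z x y \<alpha>| \<le>o |Kset X \<alpha>|"
  shows "\<exists>N. \<forall>\<alpha>. stage X Z \<alpha> (\<Union>\<beta>\<in>preds X \<alpha>. N \<beta>) (N \<alpha>)"
proof (rule dependent_wf_choice[of "|X| - Id"])
  show "wf ( |X| - Id)" using card_of_Well_order[of X] by (simp add: well_order_on_def)
  fix f g :: "'e \<Rightarrow> 'e set" and \<alpha> N assume "\<And>z. (z, \<alpha>) \<in> |X| - Id \<Longrightarrow> f z = g z"
  then have "(\<Union>\<beta>\<in>preds X \<alpha>. f \<beta>) = (\<Union>\<beta>\<in>preds X \<alpha>. g \<beta>)" by (auto simp: underS_def)
  then show "stage X Z \<alpha> (\<Union>\<beta>\<in>preds X \<alpha>. f \<beta>) N = stage X Z \<alpha> (\<Union>\<beta>\<in>preds X \<alpha>. g \<beta>) N" by simp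
next
  fix \<alpha> and f :: "'e \<Rightarrow> 'e set" assume IH: "\<And>\<beta>. (\<beta>, \<alpha>) \<in> |X| - Id \<Longrightarrow> stage X Z \<beta> (\<Union>\<gamma>\<in>preds X \<beta>. f \<gamma>) (f \<beta>)"
  have "|f \<beta>| \<le>o |Kset X \<alpha>|" if "\<beta> \<in> preds X \<alpha>" for \<beta>
  proof -
    have b: "(\<beta>, \<alpha>) \<in> |X| - Id" using that by (auto simp: underS_def)
    then have "|f \<beta>| \<le>o |Kset X \<beta>|" using IH[OF b] by (simp add: stage_def)
    then show ?thesis using Kset_mono[of \<beta> \<alpha> X] b ordLeq_transitive by blast
  qed
  then have "|\<Union>\<beta>\<in>preds X \<alpha>. f \<beta>| \<le>o |Kset X \<alpha>|"
    by (intro card_of_UNION_ordLeq_infinite[OF infinite_Kset] card_of_Plus1 ballI)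
  from stage_exists[where Z = Z, OF this Z] show "\<exists>N. stage X Z \<alpha> (\<Union>\<beta>\<in>preds X \<alpha>. f \<beta>) N" .
qed

end

section \<open>Closed stages\<close>

lemma (in ends) real_item_mem: "real_item A e \<in> real_item A ` N \<longleftrightarrow> e \<in> N"
  by (auto simp: real_item_def)

text \<open>This collects the closed stages of an uncountable set, the coherent order and the
  outcome of the induction hypothesis: \<open>A\<close> is the common reorientation, and in no stage
  does it allow a closed walk through an increasing virtual arc.\<close>

locale filtration = ends t h for t h :: "'e \<Rightarrow> 'v" +
  fixes X :: "'e set" and Z :: "'v \<Rightarrow> 'v \<Rightarrow> 'e \<Rightarrow> 'e set" and N :: "'e \<Rightarrow> 'e set"
    and \<rho> :: "'v rel" and le :: "'e \<Rightarrow> 'v rel" and A :: "'e set"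
  assumes unc: "uncountable X"
    and Z_mono: "\<And>x y \<alpha> \<beta>. (\<alpha>, \<beta>) \<in> |X| \<Longrightarrow> Z x y \<alpha> \<subseteq> Z x y \<beta>"
    and Z_sep: "\<And>x y \<alpha>. \<alpha> \<in> X \<Longrightarrow> infinite (preds X \<alpha>) \<Longrightarrow> (x, y) \<notin> level X \<alpha> \<Longrightarrow>
      (x, y) \<notin> (step {} (X - (\<Union>\<delta>\<in>preds X \<alpha>. Z x y \<delta>)))\<^sup>*"
    and N_stage: "\<And>\<alpha>. stage X Z \<alpha> (\<Union>\<beta>\<in>preds X \<alpha>. N \<beta>) (N \<alpha>)"
    and rho: "trans \<rho>" "irrefl \<rho>" "total \<rho>"
    and le: "\<And>\<alpha>. \<alpha> \<in> X \<Longrightarrow> trans (le \<alpha>)" "\<And>\<alpha>. \<alpha> \<in> X \<Longrightarrow> level X \<alpha> \<subseteq> le \<alpha>"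
      "\<And>\<alpha> x y. \<alpha> \<in> X \<Longrightarrow> (x, y) \<in> \<rho> \<Longrightarrow> (x, y) \<notin> level X \<alpha> \<Longrightarrow> (x, y) \<in> le \<alpha> \<and> (y, x) \<notin> le \<alpha>"
    and A: "\<And>\<alpha>. \<alpha> \<in> X \<Longrightarrow> approximable {} (N \<alpha>) A"
      "\<And>\<alpha>. \<alpha> \<in> X \<Longrightarrow> (\<rho> \<inter> conn (N \<alpha>))\<inverse> \<inter> (step A (N \<alpha>) \<union> (\<rho> \<inter> conn (N \<alpha>)))\<^sup>* = {}"
begin

definition M :: "'e \<Rightarrow> 'e set" where "M \<alpha> = (\<Union>\<beta>\<in>preds X \<alpha>. N \<beta>)"

lemma wo: "Well_order |X|" "Field |X| = X"
  by (rule card_of_Well_order, rule Field_card_of)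

lemma preds_X: "\<beta> \<in> preds X \<alpha> \<Longrightarrow> \<beta> \<in> X \<and> \<alpha> \<in> X"
  using wo(2) by (auto simp: underS_def Field_def)

lemma preds_total: "\<alpha> \<in> X \<Longrightarrow> \<beta> \<in> X \<Longrightarrow> \<alpha> = \<beta> \<or> \<alpha> \<in> preds X \<beta> \<or> \<beta> \<in> preds X \<alpha>"
  using wo_rel.TOTALS[OF wo_rel.intro[OF wo(1)]] wo(2) by (auto simp: underS_def)

lemma preds_rel: "\<beta> \<in> preds X \<alpha> \<Longrightarrow> (\<beta>, \<alpha>) \<in> |X|"
  by (simp add: underS_def)

section \<open>Stages and their complements\<close>

lemma N_X: "N \<alpha> \<subseteq> X - M \<alpha>"
  and N_new: "\<alpha> \<in> X \<Longrightarrow> \<alpha> \<in> M \<alpha> \<union> N \<alpha>"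
  and N_card: "|N \<alpha>| \<le>o |Kset X \<alpha>|"
  and N_level: "x \<in> vs (N \<alpha>) \<Longrightarrow> y \<in> vs (N \<alpha>) \<Longrightarrow> (x, y) \<in> (step {} (X - (M \<alpha> \<union> N \<alpha>)))\<^sup>* \<Longrightarrow>
    (x, y) \<in> level X \<alpha>"
  and N_conn: "x \<in> vs (N \<alpha>) \<Longrightarrow> y \<in> vs (N \<alpha>) \<Longrightarrow> (x, y) \<in> level X \<alpha> \<Longrightarrow> (x, y) \<in> conn (N \<alpha>)"
  and N_Z: "x \<in> vs (M \<alpha> \<union> N \<alpha>) \<Longrightarrow> y \<in> vs (M \<alpha> \<union> N \<alpha>) \<Longrightarrow> Z x y \<alpha> \<inter> X \<subseteq> M \<alpha> \<union> N \<alpha>"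
  using N_stage[of \<alpha>] unfolding stage_def M_def[symmetric] by blast+

lemma M_mono: "\<beta> \<in> preds X \<alpha> \<Longrightarrow> M \<beta> \<union> N \<beta> \<subseteq> M \<alpha>"
  using underS_subset_of[OF preds_rel] unfolding M_def by blast

lemma N_disjoint: "\<alpha> \<in> X \<Longrightarrow> \<beta> \<in> X \<Longrightarrow> \<alpha> \<noteq> \<beta> \<Longrightarrow> N \<alpha> \<inter> N \<beta> = {}"
  using preds_total[of \<alpha> \<beta>] M_mono[of \<alpha> \<beta>] M_mono[of \<beta> \<alpha>] N_X[of \<alpha>] N_X[of \<beta>] by blast

lemma M_card: "|M \<alpha>| \<le>o |Kset X \<alpha>|" "|M \<alpha> \<union> N \<alpha>| \<le>o |Kset X \<alpha>|"
proof -
  show M: "|M \<alpha>| \<le>o |Kset X \<alpha>|"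
    unfolding M_def
    using ordLeq_transitive[OF N_card Kset_mono[OF preds_rel]]
    by (intro card_of_UNION_ordLeq_infinite[OF infinite_Kset] card_of_Plus1 ballI)
  show "|M \<alpha> \<union> N \<alpha>| \<le>o |Kset X \<alpha>|"
    by (rule card_of_subset_union_infinite[OF infinite_Kset M N_card])
qed

lemma least_stage:
  assumes E: "E \<subseteq> X" "E \<noteq> {}"
  shows "\<exists>\<alpha>\<in>X. E \<inter> N \<alpha> \<noteq> {} \<and> E \<inter> M \<alpha> = {}"
proof -
  obtain e where e: "e \<in> E" "e \<in> X" using E by blast
  then obtain \<beta> where "\<beta> \<in> X" "e \<in> N \<beta>" using N_new[of e] preds_X unfolding M_def by blast
  then have \<beta>: "\<beta> \<in> {\<alpha>\<in>X. E \<inter> N \<alpha> \<noteq> {}}" using e by blast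
  have "wf ( |X| - Id)" using wo(1) by (simp add: well_order_on_def)
  from wfE_min[OF this \<beta>] obtain \<alpha> where \<alpha>: "\<alpha> \<in> {\<alpha>\<in>X. E \<inter> N \<alpha> \<noteq> {}}"
    "\<And>\<gamma>. (\<gamma>, \<alpha>) \<in> |X| - Id \<Longrightarrow> \<gamma> \<notin> {\<alpha>\<in>X. E \<inter> N \<alpha> \<noteq> {}}" by blast
  have "E \<inter> N \<gamma> = {}" if "\<gamma> \<in> preds X \<alpha>" for \<gamma>
    using \<alpha>(2)[of \<gamma>] preds_X[OF that] that by (auto simp: underS_def)
  then show ?thesis using \<alpha>(1) unfolding M_def by (intro bexI[of _ \<alpha>]) auto
qed

lemma approximable_tail_aux:
  assumes "S \<subseteq> X"
  shows "approximable {} (\<Union>\<beta>\<in>S. N \<beta>) A"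
proof (rule approximable_Union)
  show "disjoint (N ` S)"
  proof (rule disjointI)
    fix a b assume "a \<in> N ` S" "b \<in> N ` S" "a \<noteq> b"
    then obtain \<alpha> \<beta> where "a = N \<alpha>" "b = N \<beta>" "\<alpha> \<in> S" "\<beta> \<in> S" "\<alpha> \<noteq> \<beta>" by blast
    then show "a \<inter> b = {}" using N_disjoint assms by blast
  qed
  show "approximable {} n A" if "n \<in> N ` S" for n using that A(1) assms by blast
qed

lemma X_eq: "X = (\<Union>\<beta>\<in>X. N \<beta>)"
proof
  show "X \<subseteq> (\<Union>\<beta>\<in>X. N \<beta>)"
    using N_new preds_X unfolding M_def by blast
  show "(\<Union>\<beta>\<in>X. N \<beta>) \<subseteq> X" using N_X by blast
qed

text \<open>The complement of an initial union is itself a union of stages. This makes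
  \<open>reach_invariant\<close> available for walks that avoid the earlier stages.\<close>

lemma approximable_tail:
  assumes \<alpha>: "\<alpha> \<in> X"
  shows "approximable {} (X - M \<alpha>) A" "approximable {} (X - (M \<alpha> \<union> N \<alpha>)) A"
proof -
  have *: "X - (\<Union>\<beta>\<in>S. N \<beta>) = (\<Union>\<beta>\<in>X - S. N \<beta>)" if S: "S \<subseteq> X" for S
  proof (intro equalityI subsetI)
    fix e assume e: "e \<in> X - (\<Union>\<beta>\<in>S. N \<beta>)"
    then obtain \<beta> where "\<beta> \<in> X" "e \<in> N \<beta>" using X_eq by blast
    then show "e \<in> (\<Union>\<beta>\<in>X - S. N \<beta>)" using e by blast
  next
    fix e assume "e \<in> (\<Union>\<beta>\<in>X - S. N \<beta>)"
    then obtain \<beta> where \<beta>: "\<beta> \<in> X" "\<beta> \<notin> S" "e \<in> N \<beta>" by blast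
    have "e \<notin> N \<gamma>" if "\<gamma> \<in> S" for \<gamma>
      using N_disjoint[OF \<beta>(1), of \<gamma>] \<beta>(2,3) S that by blast
    then show "e \<in> X - (\<Union>\<beta>\<in>S. N \<beta>)" using N_X[of \<beta>] \<beta>(3) by blast
  qed
  have "preds X \<alpha> \<subseteq> X" "insert \<alpha> (preds X \<alpha>) \<subseteq> X" using preds_X \<alpha> by blast+
  moreover have "M \<alpha> \<union> N \<alpha> = (\<Union>\<beta>\<in>insert \<alpha> (preds X \<alpha>). N \<beta>)" unfolding M_def by blast
  ultimately show "approximable {} (X - M \<alpha>) A" "approximable {} (X - (M \<alpha> \<union> N \<alpha>)) A"
    using *[of "preds X \<alpha>"] *[of "insert \<alpha> (preds X \<alpha>)"]
      approximable_tail_aux[of "X - preds X \<alpha>"] approximable_tail_aux[of "X - insert \<alpha> (preds X \<alpha>)"]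
    by (simp_all only: M_def Diff_subset)
qed

text \<open>
  A virtual arc \<open>(x, y)\<close> stands for the possibility of closing up walks by paths from \<open>x\<close> to \<open>y\<close>
  through untouched edges. It may be combined with the edges in \<open>E\<close> only if all of these belong to
  later stages than the one at which the arc becomes available.
\<close>

definition varcs :: "'e set \<Rightarrow> 'v rel" where
  "varcs E = {(x, y). (x, y) \<in> \<rho> \<and> ((x, y) \<in> conn X \<or>
     (\<exists>\<gamma>\<in>X. x \<in> vs (M \<gamma> \<union> N \<gamma>) \<and> y \<in> vs (M \<gamma> \<union> N \<gamma>) \<and> (x, y) \<in> level X \<gamma> \<and> E \<inter> (M \<gamma> \<union> N \<gamma>) = {}))}"

definition items :: "'e set \<Rightarrow> ('v \<times> 'v \<times> 'e option) set" where
  "items E = real_item A ` E \<union> {(x, y, None) | x y. (x, y) \<in> varcs E}"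

abbreviation walk :: "'v \<Rightarrow> ('v \<times> 'v \<times> 'e option) list \<Rightarrow> 'v \<Rightarrow> bool" where
  "walk \<equiv> chain fst (\<lambda>p. fst (snd p))"

definition no_virtual :: "'e set \<Rightarrow> bool" where
  "no_virtual E \<longleftrightarrow> (\<forall>u ws x y. set ws \<subseteq> items E \<longrightarrow> walk u ws u \<longrightarrow> (x, y, None) \<notin> set ws)"

lemma virtual_item_iff: "(x, y, None) \<in> items E \<longleftrightarrow> (x, y) \<in> varcs E"
  by (auto simp: items_def real_item_def)

lemma real_item_iff: "(x, y, Some e) \<in> items E \<longleftrightarrow> e \<in> E \<and> x = src A e \<and> y = dst A e"
  by (auto simp: items_def real_item_def)

lemma varcs_antimono: "E' \<subseteq> E \<Longrightarrow> varcs E \<subseteq> varcs E'"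
  unfolding varcs_def by blast

lemma items_Diff:
  assumes "it \<in> items E" "it \<notin> real_item A ` S"
  shows "it \<in> items (E - S)"
  using assms varcs_antimono[of "E - S" E] unfolding items_def by blast

lemma walk_reach:
  assumes X': "approximable {} X' A" and ws: "walk a ws b"
    and real: "\<And>x y e. (x, y, Some e) \<in> set ws \<Longrightarrow> e \<in> X' \<and> x = src A e \<and> y = dst A e"
    and virt: "\<And>x y. (x, y, None) \<in> set ws \<Longrightarrow> (x, y) \<in> (step {} X')\<^sup>*"
  shows "(a, b) \<in> (step {} X')\<^sup>*"
proof (rule chain_rtrancl[OF ws])
  fix it assume it: "it \<in> set ws"
  obtain x y k where k: "it = (x, y, k)" by (cases it)
  have "(x, y) \<in> (step {} X')\<^sup>*"
  proof (cases k)
    case None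
    then show ?thesis using virt it k by blast
  next
    case (Some e)
    then have "e \<in> X'" "x = src A e" "y = dst A e" using real it k by blast+
    then have "(x, y) \<in> (step A X')\<^sup>*" by (auto simp: step_def)
    then show ?thesis using reach_invariant[OF X'] by blast
  qed
  then show "(fst it, fst (snd it)) \<in> (step {} X')\<^sup>*" by (simp add: k)
qed

text \<open>A virtual arc \<open>(x, y)\<close> outside the level stems from an earlier stage, and
  the order puts \<open>x\<close> strictly below \<open>y\<close> at level \<open>\<alpha>\<close>.
  The way back from \<open>y\<close> to \<open>x\<close> never descends at that level: other arcs of
  this kind rise, and the stretches between them join vertices of \<open>M \<alpha>\<close> outside
  \<open>M \<alpha>\<close>, so they stay in the level because \<open>M \<alpha>\<close> has
  absorbed the separators.\<close>

lemma all_virtual_level: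
  assumes \<alpha>: "\<alpha> \<in> X" and E: "E \<subseteq> X" "E \<inter> M \<alpha> = {}" "E \<inter> N \<alpha> \<noteq> {}"
    and ws: "set ws \<subseteq> items E" "walk u ws u" and v: "(x, y, None) \<in> set ws"
  shows "(x, y) \<in> level X \<alpha>"
proof (rule ccontr)
  assume xy: "(x, y) \<notin> level X \<alpha>"
  obtain p q where pq: "ws = p @ (x, y, None) # q" using split_list[OF v] by blast
  have qp: "walk y (q @ p) x" using ws(2) unfolding pq by (auto simp: chain_append)
  have set_qp: "set (q @ p) \<subseteq> items E" using ws(1) pq by auto
  let ?m = "\<lambda>it :: 'v \<times> 'v \<times> 'e option. snd (snd it) = None \<and> (fst it, fst (snd it)) \<notin> level X \<alpha>"
  have early: "\<exists>\<gamma>\<in>preds X \<alpha>. a \<in> vs (M \<gamma> \<union> N \<gamma>) \<and> b \<in> vs (M \<gamma> \<union> N \<gamma>) \<and> (a, b) \<in> level X \<gamma>"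
    if ab: "(a, b) \<in> varcs E" "(a, b) \<notin> level X \<alpha>" for a b
  proof -
    have "(a, b) \<notin> conn X" using conn_subset_level[OF unc \<alpha>] ab(2) by blast
    then obtain \<gamma> where \<gamma>: "\<gamma> \<in> X" "a \<in> vs (M \<gamma> \<union> N \<gamma>)" "b \<in> vs (M \<gamma> \<union> N \<gamma>)" "(a, b) \<in> level X \<gamma>"
      "E \<inter> (M \<gamma> \<union> N \<gamma>) = {}" using ab(1) unfolding varcs_def by blast
    have "\<gamma> \<in> preds X \<alpha>" using preds_total[OF \<gamma>(1) \<alpha>] \<gamma>(5) E(3) M_mono[of \<alpha> \<gamma>] by blast
    then show ?thesis using \<gamma> by blast
  qed
  have ends_M: "a \<in> vs (M \<alpha>) \<and> b \<in> vs (M \<alpha>)" if ab: "(a, b) \<in> varcs E" "(a, b) \<notin> level X \<alpha>" for a b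
  proof -
    obtain \<gamma> where \<gamma>: "\<gamma> \<in> preds X \<alpha>" "a \<in> vs (M \<gamma> \<union> N \<gamma>)" "b \<in> vs (M \<gamma> \<union> N \<gamma>)"
      using early[OF ab] by blast
    then show ?thesis using M_mono[OF \<gamma>(1)] by blast
  qed
  have xyE: "(x, y) \<in> varcs E" using ws(1) v virtual_item_iff by blast
  \<comment> \<open>With finitely many predecessors the threshold at \<open>\<alpha>\<close> is
    aleph-0, the least possible one, and no pair of an earlier level would be lost.\<close>
  have inf: "infinite (preds X \<alpha>)"
  proof
    assume fin: "finite (preds X \<alpha>)"
    obtain \<gamma> where \<gamma>: "(x, y) \<in> level X \<gamma>" using early[OF xyE xy] by blast
    have "|Kset X \<alpha>| \<le>o |UNIV :: nat set|"
      using fin by (intro ordIso_imp_ordLeq card_of_Plus_infinite2 finite_card_of_ordLeq) auto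
    then have "|Kset X \<alpha>| \<le>o |Kset X \<gamma>|" using card_of_Plus2 ordLeq_transitive by blast
    then have "(x, y) \<in> level X \<alpha>" using \<gamma> ordLeq_transitive unfolding level_def by blast
    then show False using xy by blast
  qed
  have "(y, x) \<in> (le \<alpha>)\<^sup>*"
  proof (rule chain_segments[OF _ _ qp, where m = ?m and Y = "vs (M \<alpha>)"])
    show "x \<in> vs (M \<alpha>)" "y \<in> vs (M \<alpha>)" using ends_M[OF xyE xy] by blast+
  next
    fix it assume it: "it \<in> set (q @ p)" "?m it"
    obtain a b k where k: "it = (a, b, k)" by (cases it)
    have ab: "(a, b) \<in> varcs E" "(a, b) \<notin> level X \<alpha>"
      using it set_qp virtual_item_iff[of a b E] k by auto
    then have "(a, b) \<in> \<rho>" by (simp add: varcs_def)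
    then have "(a, b) \<in> le \<alpha>" using le(3)[OF \<alpha> _ ab(2)] by blast
    then show "(fst it, fst (snd it)) \<in> (le \<alpha>)\<^sup>* \<and> fst it \<in> vs (M \<alpha>) \<and> fst (snd it) \<in> vs (M \<alpha>)"
      using ends_M[OF ab] k by auto
  next
    fix sg a b assume sg: "set sg \<subseteq> set (q @ p)" "\<forall>it\<in>set sg. \<not> ?m it" "walk a sg b"
      and ab: "a \<in> vs (M \<alpha>)" "b \<in> vs (M \<alpha>)"
    have reach: "(a, b) \<in> (step {} (X - M \<alpha>))\<^sup>*"
    proof (rule walk_reach[OF approximable_tail(1)[OF \<alpha>] sg(3)])
      fix x y e assume "(x, y, Some e) \<in> set sg"
      then have "(x, y, Some e) \<in> items E" using sg(1) set_qp by blast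
      then show "e \<in> X - M \<alpha> \<and> x = src A e \<and> y = dst A e" using real_item_iff E(1,2) by blast
    next
      fix x y assume "(x, y, None) \<in> set sg"
      then have "(x, y) \<in> level X \<alpha>" using sg(2) by fastforce
      then show "(x, y) \<in> (step {} (X - M \<alpha>))\<^sup>*" using levelD M_card(1) by blast
    qed
    have "(a, b) \<in> level X \<alpha>"
    proof (rule ccontr)
      assume nl: "(a, b) \<notin> level X \<alpha>"
      obtain \<delta>\<^sub>1 \<delta>\<^sub>2 where d: "\<delta>\<^sub>1 \<in> preds X \<alpha>" "a \<in> vs (N \<delta>\<^sub>1)" "\<delta>\<^sub>2 \<in> preds X \<alpha>" "b \<in> vs (N \<delta>\<^sub>2)"
        using ab unfolding M_def by blast
      \<comment> \<open>A stage absorbs separators only for its own vertices. So pass to an index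
        below \<open>\<alpha>\<close> that is late enough for \<open>a\<close>, \<open>b\<close> and
        \<open>\<delta>\<close>, and use monotonicity of \<open>Z\<close>.\<close>
      have "Z a b \<delta> \<inter> X \<subseteq> M \<alpha>" if \<delta>: "\<delta> \<in> preds X \<alpha>" for \<delta>
      proof -
        have "\<exists>\<eta>\<in>preds X \<alpha>. \<forall>\<delta>'\<in>{\<delta>, \<delta>\<^sub>1, \<delta>\<^sub>2}. \<delta>' = \<eta> \<or> \<delta>' \<in> preds X \<eta>"
        proof -
          have tr: "\<zeta> \<in> preds X \<theta>" if "\<zeta> \<in> preds X \<eta>" "\<eta> \<in> preds X \<theta>" for \<zeta> \<eta> \<theta>
            using underS_subset_of[OF preds_rel[OF that(2)]] that(1) by blast
          have X: "\<delta> \<in> X" "\<delta>\<^sub>1 \<in> X" "\<delta>\<^sub>2 \<in> X" using \<delta> d preds_X by blast+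
          show ?thesis
            using preds_total[OF X(1,2)] preds_total[OF X(1,3)] preds_total[OF X(2,3)] tr \<delta> d(1,3)
            by (auto; blast)
        qed
        then obtain \<eta> where \<eta>: "\<eta> \<in> preds X \<alpha>" "\<And>\<delta>'. \<delta>' \<in> {\<delta>, \<delta>\<^sub>1, \<delta>\<^sub>2} \<Longrightarrow> \<delta>' = \<eta> \<or> \<delta>' \<in> preds X \<eta>"
          by blast
        have NM: "N \<delta>' \<subseteq> M \<eta> \<union> N \<eta>" if "\<delta>' \<in> {\<delta>, \<delta>\<^sub>1, \<delta>\<^sub>2}" for \<delta>'
          using \<eta>(2)[OF that] M_mono[of \<delta>' \<eta>] by blast
        have "a \<in> vs (M \<eta> \<union> N \<eta>)" "b \<in> vs (M \<eta> \<union> N \<eta>)"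
          using d(2,4) NM[of \<delta>\<^sub>1] NM[of \<delta>\<^sub>2] by blast+
        from N_Z[OF this] have "Z a b \<eta> \<inter> X \<subseteq> M \<alpha>" using M_mono[OF \<eta>(1)] by blast
        moreover have "Z a b \<delta> \<subseteq> Z a b \<eta>"
          using \<eta>(2)[of \<delta>] Z_mono[OF preds_rel] by blast
        ultimately show ?thesis by blast
      qed
      then have "X - M \<alpha> \<subseteq> X - (\<Union>\<delta>\<in>preds X \<alpha>. Z a b \<delta>)" by blast
      from reach_antimono[OF reach this] show False using Z_sep[OF \<alpha> inf nl] by blast
    qed
    then show "(a, b) \<in> (le \<alpha>)\<^sup>*" using le(2)[OF \<alpha>] by blast
  qed
  then have "(y, x) \<in> le \<alpha> \<or> y = x" using trancl_id[OF le(1)[OF \<alpha>]] by (auto simp: rtrancl_eq_or_trancl)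
  moreover have "(x, y) \<in> \<rho>" using xyE by (simp add: varcs_def)
  ultimately show False using le(3)[OF \<alpha> _ xy] rho(2) by (auto simp: irrefl_def)
qed

text \<open>The segment runs outside the stage, so closedness puts \<open>(a, b)\<close> into the
  level and thus into \<open>conn (N \<alpha>)\<close>. If \<open>b\<close> were below
  \<open>a\<close> in \<open>\<rho>\<close>, then \<open>(b, a)\<close> would be in the level too,
  hence a virtual arc available for \<open>E\<close>, and it would close the segment to a walk that
  \<open>no_virtual E\<close> forbids.\<close>

lemma segment_conn:
  assumes \<alpha>: "\<alpha> \<in> X" and E: "E \<subseteq> X" "E \<inter> (M \<alpha> \<union> N \<alpha>) = {}" and nv: "no_virtual E"
    and sg: "set sg \<subseteq> items E" "walk a sg b" and lev: "\<And>x y. (x, y, None) \<in> set sg \<Longrightarrow> (x, y) \<in> level X \<alpha>"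
    and ab: "a \<in> vs (N \<alpha>)" "b \<in> vs (N \<alpha>)" "a \<noteq> b"
  shows "(a, b) \<in> \<rho> \<inter> conn (N \<alpha>)"
proof -
  have "(a, b) \<in> (step {} (X - (M \<alpha> \<union> N \<alpha>)))\<^sup>*"
  proof (rule walk_reach[OF approximable_tail(2)[OF \<alpha>] sg(2)])
    fix x y e assume "(x, y, Some e) \<in> set sg"
    then have "(x, y, Some e) \<in> items E" using sg(1) by blast
    then show "e \<in> X - (M \<alpha> \<union> N \<alpha>) \<and> x = src A e \<and> y = dst A e" using real_item_iff E by blast
  next
    fix x y assume "(x, y, None) \<in> set sg"
    then show "(x, y) \<in> (step {} (X - (M \<alpha> \<union> N \<alpha>)))\<^sup>*" using lev levelD M_card(2) by blast
  qed
  from N_level[OF ab(1,2) this] have ab': "(a, b) \<in> level X \<alpha>" .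
  have "(a, b) \<in> \<rho>"
  proof (rule ccontr)
    assume "(a, b) \<notin> \<rho>"
    then have ba: "(b, a) \<in> \<rho>" using rho(3) ab(3) by (auto simp: total_on_def)
    have "(b, a) \<in> level X \<alpha>" using le(3)[OF \<alpha> ba] le(2)[OF \<alpha>] ab' by blast
    then have "(b, a) \<in> varcs E" unfolding varcs_def using ba \<alpha> ab(1,2) E(2) by blast
    then have "set (sg @ [(b, a, None)]) \<subseteq> items E" using sg(1) virtual_item_iff by auto
    moreover have "walk a (sg @ [(b, a, None)]) a" using sg(2) by (auto simp: chain_append)
    ultimately have "(b, a, None) \<notin> set (sg @ [(b, a, None)])" using nv unfolding no_virtual_def by blast
    then show False by simp
  qed
  then show ?thesis using N_conn[OF ab(1,2) ab'] by blast
qed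

text \<open>Stretches outside \<open>N \<alpha>\<close> between distinct vertices of the stage
  contract to its increasing virtual arcs. The stretch through \<open>i\<close> gives an arc from
  \<open>a\<close> to \<open>b\<close>, and the rest leads back from \<open>b\<close> to
  \<open>a\<close>, against the choice of \<open>A\<close> on \<open>N \<alpha>\<close>. The
  assumption \<open>ne\<close> ensures that the stretch through \<open>i\<close> is not closed in
  itself.\<close>

lemma no_crossing:
  assumes \<alpha>: "\<alpha> \<in> X" and E: "E \<subseteq> X" "E \<inter> M \<alpha> = {}" and nv: "no_virtual (E - N \<alpha>)"
    and ws: "set ws \<subseteq> items E" "walk u ws u"
    and lev: "\<And>x y. (x, y, None) \<in> set ws \<Longrightarrow> (x, y) \<in> level X \<alpha>"
    and i: "i \<in> set ws" "i \<notin> real_item A ` N \<alpha>" and x: "x \<in> set ws" "x \<in> real_item A ` N \<alpha>"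
    and ne: "\<And>n sg rest a b. rotate n ws = sg @ rest \<Longrightarrow> i \<in> set sg \<Longrightarrow> rest \<noteq> [] \<Longrightarrow>
      set sg \<subseteq> items (E - N \<alpha>) \<Longrightarrow> walk a sg b \<Longrightarrow> walk b rest a \<Longrightarrow> a \<noteq> b"
  shows False
proof -
  let ?J = "\<rho> \<inter> conn (N \<alpha>)"
  obtain n sg rest where rot: "rotate n ws = sg @ rest" "i \<in> set sg"
    "\<forall>y\<in>set sg. y \<notin> real_item A ` N \<alpha>" "rest \<noteq> []" "hd rest \<in> real_item A ` N \<alpha>" "last rest \<in> real_item A ` N \<alpha>"
    using cyclic_split[where m = "\<lambda>it. it \<in> real_item A ` N \<alpha>", OF i x] by blast
  obtain a where "walk a (sg @ rest) a" using chain_rotate_n[OF ws(2), of n] rot(1) by auto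
  then obtain b where w: "walk a sg b" "walk b rest a" by (auto simp: chain_append)
  have sets: "set sg \<subseteq> set ws" "set rest \<subseteq> set ws"
    using rot(1) by (metis set_append set_rotate Un_upper1, metis set_append set_rotate Un_upper2)
  have unm: "set s \<subseteq> items (E - N \<alpha>)" if s: "set s \<subseteq> set ws" "\<forall>y\<in>set s. y \<notin> real_item A ` N \<alpha>" for s
  proof
    fix it assume it: "it \<in> set s"
    then have "it \<in> items E" "it \<notin> real_item A ` N \<alpha>" using s ws(1) by blast+
    then show "it \<in> items (E - N \<alpha>)" by (rule items_Diff)
  qed
  have E': "E - N \<alpha> \<subseteq> X" "(E - N \<alpha>) \<inter> (M \<alpha> \<union> N \<alpha>) = {}" using E by blast+
  have seg: "(c, d) \<in> ?J" if "set s \<subseteq> set ws" "\<forall>y\<in>set s. y \<notin> real_item A ` N \<alpha>" "walk c s d"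
    "c \<in> vs (N \<alpha>)" "d \<in> vs (N \<alpha>)" "c \<noteq> d" for s c d
    using segment_conn[OF \<alpha> E' nv unm[OF that(1,2)] that(3) _ that(4,5,6)] lev that(1) by blast
  have ends: "fst it \<in> vs (N \<alpha>) \<and> fst (snd it) \<in> vs (N \<alpha>) \<and> (fst it, fst (snd it)) \<in> step A (N \<alpha>)"
    if it: "it \<in> real_item A ` N \<alpha>" for it
  proof -
    obtain e where e: "e \<in> N \<alpha>" "it = real_item A e" using it by blast
    have "(src A e, dst A e) \<in> step A (N \<alpha>)" unfolding step_def using e(1) by (rule imageI)
    then show ?thesis using src_vs[OF e(1), of A] dst_vs[OF e(1), of A]
      unfolding e(2) real_item_def fst_conv snd_conv by blast
  qed
  obtain it rest' where r1: "rest = it # rest'" using rot(4) by (cases rest) auto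
  obtain rest'' it' where r2: "rest = rest'' @ [it']" using rot(4) by (cases rest rule: rev_cases) auto
  have "b = fst it" using w(2) r1 by simp
  then have bV: "b \<in> vs (N \<alpha>)" using ends[OF rot(5)] r1 by simp
  have "a = fst (snd it')" using w(2) unfolding r2 by (auto simp: chain_append)
  then have aV: "a \<in> vs (N \<alpha>)" using ends[OF rot(6)] r2 by simp
  have "a \<noteq> b" by (rule ne[OF rot(1,2,4) unm[OF sets(1) rot(3)] w])
  from seg[OF sets(1) rot(3) w(1) aV bV this] have ab: "(a, b) \<in> ?J" .
  have "(b, a) \<in> (step A (N \<alpha>) \<union> ?J)\<^sup>*"
  proof (rule chain_segments[OF _ _ w(2) bV aV, where m = "\<lambda>it. it \<in> real_item A ` N \<alpha>"])
    fix s c d assume s: "set s \<subseteq> set rest" "\<forall>y\<in>set s. y \<notin> real_item A ` N \<alpha>" "walk c s d" "c \<in> vs (N \<alpha>)" "d \<in> vs (N \<alpha>)"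
    then show "(c, d) \<in> (step A (N \<alpha>) \<union> ?J)\<^sup>*"
      using seg[OF _ s(2-5)] sets(2) by (cases "c = d") auto
  next
    fix it assume "it \<in> set rest" "it \<in> real_item A ` N \<alpha>"
    then show "(fst it, fst (snd it)) \<in> (step A (N \<alpha>) \<union> ?J)\<^sup>* \<and> fst it \<in> vs (N \<alpha>) \<and> fst (snd it) \<in> vs (N \<alpha>)"
      using ends by blast
  qed
  then show False using A(2)[OF \<alpha>] ab by blast
qed

text \<open>Dropping the edges of the first stage that \<open>E\<close> meets gives a smaller set;
  the claim for it turns the detours outside that stage into increasing virtual arcs of the stage.
  When no edges are left, every item increases in \<open>\<rho>\<close>.\<close>

lemma no_virtual_finite:
  assumes "finite E" "E \<subseteq> X"
  shows "no_virtual E"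
  using assms
proof (induction E rule: finite_psubset_induct)
  case (psubset E)
  show ?case
    unfolding no_virtual_def
  proof (intro allI impI notI)
    fix u ws x y assume ws: "set ws \<subseteq> items E" "walk u ws u" and v: "(x, y, None) \<in> set ws"
    show False
    proof (cases "E = {}")
      case True
      have "(fst it, fst (snd it)) \<in> \<rho>" if "it \<in> set ws" for it
        using that ws(1) True by (auto simp: items_def varcs_def)
      moreover have "ws \<noteq> []" using v by auto
      ultimately have "(u, u) \<in> \<rho>\<^sup>+" using chain_trancl[OF ws(2)] by blast
      then show False using rho(1,2) by (simp add: irrefl_def)
    next
      case False
      obtain \<alpha> where \<alpha>: "\<alpha> \<in> X" "E \<inter> N \<alpha> \<noteq> {}" "E \<inter> M \<alpha> = {}"
        using least_stage[OF psubset.prems False] by (elim bexE conjE)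
      have "E - N \<alpha> \<subset> E" "E - N \<alpha> \<subseteq> X" using \<alpha>(2) psubset.prems by auto
      then have nv: "no_virtual (E - N \<alpha>)" by (rule psubset.IH)
      show False
      proof (cases "\<exists>it\<in>set ws. it \<in> real_item A ` N \<alpha>")
        case True
        then obtain it where it: "it \<in> set ws" "it \<in> real_item A ` N \<alpha>" by blast
        show False
        proof (rule no_crossing[OF \<alpha>(1) psubset.prems \<alpha>(3) nv ws _ v _ it])
          show "(a, b) \<in> level X \<alpha>" if "(a, b, None) \<in> set ws" for a b
            using all_virtual_level[OF \<alpha>(1) psubset.prems \<alpha>(3,2) ws that] .
          show "(x, y, None) \<notin> real_item A ` N \<alpha>" by (auto simp: real_item_def)
          \<comment> \<open>The stretch contains a virtual arc and no edges of the stage, so the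
            induction hypothesis forbids it to be closed.\<close>
          fix n sg rest a b
          assume "(x, y, None) \<in> set sg" "set sg \<subseteq> items (E - N \<alpha>)" "walk a sg b"
          then show "a \<noteq> b" using nv unfolding no_virtual_def by blast
        qed
      next
        case False
        then have "set ws \<subseteq> items (E - N \<alpha>)"
          using ws(1) items_Diff[of _ E "N \<alpha>"] by (meson subsetD subsetI)
        then show False using nv ws(2) v unfolding no_virtual_def by blast
      qed
    qed
  qed
qed

text \<open>Arcs in \<open>conn X\<close> are available whatever edges are used, and a walk uses
  finitely many edges. This hands the condition on virtual arcs from the stages on to
  \<open>X\<close>.\<close>

lemma virtual_rtrancl: "(\<rho> \<inter> conn X)\<inverse> \<inter> (step A X \<union> (\<rho> \<inter> conn X))\<^sup>* = {}"
proof (rule ccontr)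
  assume "\<not> ?thesis"
  then obtain x y where xy: "(x, y) \<in> \<rho> \<inter> conn X" "(y, x) \<in> (step A X \<union> (\<rho> \<inter> conn X))\<^sup>*" by auto
  obtain F where F: "finite F" "F \<subseteq> X" "(y, x) \<in> (step A F \<union> (\<rho> \<inter> conn X))\<^sup>*"
    using rtrancl_Un_image_finite[OF xy(2)[unfolded step_def]] unfolding step_def by blast
  have virt: "(a, b, None) \<in> items F" if "(a, b) \<in> \<rho> \<inter> conn X" for a b
    using that by (auto simp: virtual_item_iff varcs_def)
  from F(3) have "\<exists>ws. set ws \<subseteq> items F \<and> walk y ws x"
  proof (induction rule: rtrancl_induct)
    case base
    show ?case by (intro exI[of _ "[]"]) simp
  next
    case (step a b)
    then obtain ws where ws: "set ws \<subseteq> items F" "walk y ws a" by blast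
    have "\<exists>k. (a, b, k) \<in> items F"
      using step(2) virt real_item_iff[of a b _ F] unfolding step_def by blast
    then obtain k where "(a, b, k) \<in> items F" by blast
    with ws show ?case by (intro exI[of _ "ws @ [(a, b, k)]"]) (auto simp: chain_append)
  qed
  then obtain ws where ws: "set ws \<subseteq> items F" "walk y ws x" by blast
  have "set ((x, y, None) # ws) \<subseteq> items F" using ws(1) virt[OF xy(1)] by auto
  moreover have "walk x ((x, y, None) # ws) x" using ws(2) by simp
  ultimately have "(x, y, None) \<notin> set ((x, y, None) # ws)"
    using no_virtual_finite[OF F(1,2)] unfolding no_virtual_def by blast
  then show False by simp
qed

text \<open>A cycle not contained in the first stage it meets would cross it. Its vertices are
  distinct, so the stretch outside cannot be closed in itself.\<close>

lemma cycle_in_stage: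
  assumes es: "es \<noteq> []" "set es \<subseteq> X" "chain (src A) (dst A) u es u" "distinct (map (src A) es)"
  shows "\<exists>\<alpha>\<in>X. set es \<subseteq> N \<alpha>"
proof -
  obtain \<alpha> where \<alpha>: "\<alpha> \<in> X" "set es \<inter> N \<alpha> \<noteq> {}" "set es \<inter> M \<alpha> = {}"
    using least_stage[of "set es"] es(1,2) by auto
  have "set es \<subseteq> N \<alpha>"
  proof (rule ccontr)
    assume "\<not> ?thesis"
    then obtain i where i: "i \<in> set es" "i \<notin> N \<alpha>" by blast
    obtain x where x: "x \<in> set es" "x \<in> N \<alpha>" using \<alpha>(2) by blast
    let ?ws = "map (real_item A) es"
    have w: "chain (src A) (dst A) c ds d \<Longrightarrow> walk c (map (real_item A) ds) d" for c ds d
      by (induction ds arbitrary: c) (auto simp: real_item_def)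
    show False
    proof (rule no_crossing[of \<alpha> "set es" ?ws u "real_item A i" "real_item A x"])
      show "no_virtual (set es - N \<alpha>)" using no_virtual_finite[of "set es - N \<alpha>"] es(2) by blast
      show "set ?ws \<subseteq> items (set es)" by (auto simp: items_def)
      show "walk u ?ws u" by (rule w[OF es(3)])
      show "(x, y) \<in> level X \<alpha>" if "(x, y, None) \<in> set ?ws" for x y
        using that by (auto simp: real_item_def)
      fix n sg rest a b assume r: "rotate n ?ws = sg @ rest" "real_item A i \<in> set sg" "rest \<noteq> []"
        and ab: "walk a sg b" "walk b rest a"
      have "map fst ?ws = map (src A) es" by (simp add: real_item_def o_def)
      then have "distinct (map fst ?ws)" using es(4) by (rule ssubst)
      then have "distinct (rotate n (map fst ?ws))" by (simp only: distinct_rotate)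
      then have "distinct (map fst (rotate n ?ws))" by (simp only: rotate_map)
      then have "distinct (map fst sg @ map fst rest)" using r(1) by simp
      moreover obtain it s where "sg = it # s" using r(2) by (cases sg) auto
      moreover obtain it' s' where "rest = it' # s'" using r(3) by (cases rest) auto
      ultimately show "a \<noteq> b" using ab by auto
    qed (use \<alpha> es(2) i x real_item_mem in auto)
  qed
  then show ?thesis using \<alpha>(1) by blast
qed

end

section \<open>Reduction to countable pieces\<close>

context ends
begin

text \<open>
  The induction on the cardinality of \<open>X\<close> needs the virtual arcs \<open>\<rho> \<inter> conn X\<close>: at an uncountable
  \<open>X\<close> it is applied to the stages of a filtration, and there the virtual arcs take the place of
  paths through later stages.
\<close>

lemma thin_orientation:
  assumes \<rho>\<^sub>0: "trans (\<rho>\<^sub>0 :: 'v rel)" "irrefl \<rho>\<^sub>0" "total \<rho>\<^sub>0"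
  shows "\<exists>A P. disjoint P \<and> \<Union>P = X \<and> (\<forall>N\<in>P. countable N \<and> approximable {} N A) \<and>
    (\<rho>\<^sub>0 \<inter> conn X)\<inverse> \<inter> (step A X \<union> (\<rho>\<^sub>0 \<inter> conn X))\<^sup>* = {} \<and>
    (\<forall>es u. es \<noteq> [] \<and> set es \<subseteq> X \<and> chain (src A) (dst A) u es u \<and> distinct (map (src A) es) \<longrightarrow>
      (\<exists>N\<in>P. set es \<subseteq> N))"
proof -
  define Thin where "Thin \<rho> X A P \<longleftrightarrow> disjoint P \<and> \<Union>P = X \<and> (\<forall>N\<in>P. countable N \<and> approximable {} N A) \<and>
    (\<rho> \<inter> conn X)\<inverse> \<inter> (step A X \<union> (\<rho> \<inter> conn X))\<^sup>* = {} \<and>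
    (\<forall>es u. es \<noteq> [] \<and> set es \<subseteq> X \<and> chain (src A) (dst A) u es u \<and> distinct (map (src A) es) \<longrightarrow>
      (\<exists>N\<in>P. set es \<subseteq> N))" for \<rho> X A P
  have "trans \<rho>\<^sub>0 \<longrightarrow> irrefl \<rho>\<^sub>0 \<longrightarrow> total \<rho>\<^sub>0 \<longrightarrow> (\<exists>A P. Thin \<rho>\<^sub>0 X A P)" for \<rho>\<^sub>0 :: "'v rel" and X
  \<comment> \<open>The order has to vary in the induction: the stages are treated with the coherent
    order built for \<open>X\<close>, not with the given one.\<close>
  proof (induction X arbitrary: \<rho>\<^sub>0 rule: wf_induct_rule[OF wf_inv_image[OF wf_ordLess, of card_of]])
    case (1 X)
    show ?case
    proof (intro impI)
      assume r0: "trans \<rho>\<^sub>0" "irrefl \<rho>\<^sub>0" "total \<rho>\<^sub>0"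
      show "\<exists>A P. Thin \<rho>\<^sub>0 X A P"
      proof (cases "countable X")
        case True
        let ?J = "\<rho>\<^sub>0 \<inter> conn X"
        have "trans (conn X)" unfolding conn_def by (intro transI) (auto intro: rtrancl_trans)
        then have J: "trans ?J" "irrefl ?J" using r0 by (auto simp: irrefl_def trans_Int)
        have "(a, b) \<in> (step {} (X - S))\<^sup>*" if "(a, b) \<in> ?J" "finite S" for a b S
          using that unfolding conn_def by blast
        from thinning[OF this J] obtain A where A: "approximable {} X A" "?J\<inverse> \<inter> (step A X \<union> ?J)\<^sup>* = {}"
          by blast
        have "Thin \<rho>\<^sub>0 X A {X}" unfolding Thin_def using True A by simp
        then show ?thesis by blast
      next
        case False
        have wo: "Well_order |X|" "Field |X| = X" by (rule card_of_Well_order, rule Field_card_of)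
        have "\<exists>\<rho> le. trans \<rho> \<and> irrefl \<rho> \<and> total \<rho> \<and>
            (\<forall>x y. (x, y) \<in> \<rho>\<^sub>0 \<and> (\<forall>\<alpha>\<in>X. (x, y) \<in> level X \<alpha>) \<longrightarrow> (x, y) \<in> \<rho>) \<and>
            (\<forall>\<alpha>\<in>X. trans (le \<alpha>) \<and> level X \<alpha> \<subseteq> le \<alpha> \<and>
              (\<forall>x y. (x, y) \<in> \<rho> \<and> (x, y) \<notin> level X \<alpha> \<longrightarrow> (x, y) \<in> le \<alpha> \<and> (y, x) \<notin> le \<alpha>))"
          by (rule level_order[OF wo(1), unfolded wo(2)])
            (rule level_refl level_trans r0 | erule level_mono)+
        then obtain \<rho> le where order: "trans \<rho> \<and> irrefl \<rho> \<and> total \<rho> \<and>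
            (\<forall>x y. (x, y) \<in> \<rho>\<^sub>0 \<and> (\<forall>\<alpha>\<in>X. (x, y) \<in> level X \<alpha>) \<longrightarrow> (x, y) \<in> \<rho>) \<and>
            (\<forall>\<alpha>\<in>X. trans (le \<alpha>) \<and> level X \<alpha> \<subseteq> le \<alpha> \<and>
              (\<forall>x y. (x, y) \<in> \<rho> \<and> (x, y) \<notin> level X \<alpha> \<longrightarrow> (x, y) \<in> le \<alpha> \<and> (y, x) \<notin> le \<alpha>))"
          by (elim exE)
        then have rho: "trans \<rho>" "irrefl \<rho>" "total \<rho>" by blast+
        have rho0: "(x, y) \<in> \<rho>" if "(x, y) \<in> \<rho>\<^sub>0" "\<forall>\<alpha>\<in>X. (x, y) \<in> level X \<alpha>" for x y
          using order that by blast
        have le: "trans (le \<alpha>) \<and> level X \<alpha> \<subseteq> le \<alpha> \<and>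
            (\<forall>x y. (x, y) \<in> \<rho> \<and> (x, y) \<notin> level X \<alpha> \<longrightarrow> (x, y) \<in> le \<alpha> \<and> (y, x) \<notin> le \<alpha>)"
          if "\<alpha> \<in> X" for \<alpha>
          using order that by blast
        define Sep where "Sep x y Z \<longleftrightarrow> (\<forall>\<alpha>. |Z \<alpha>| \<le>o |Kset X \<alpha>| ) \<and>
          (\<forall>\<alpha> \<beta>. (\<alpha>, \<beta>) \<in> |X| \<longrightarrow> Z \<alpha> \<subseteq> Z \<beta>) \<and>
          (\<forall>\<alpha>\<in>X. infinite (preds X \<alpha>) \<and> (x, y) \<notin> level X \<alpha> \<longrightarrow>
            (x, y) \<notin> (step {} (X - (\<Union>\<delta>\<in>preds X \<alpha>. Z \<delta>)))\<^sup>*)" for x y Z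
        have "\<exists>Z. Sep x y Z" for x y unfolding Sep_def by (rule separators)
        then obtain Z where "\<And>x y. Sep x y (Z x y)" by metis
        then have Z: "\<forall>x y. (\<forall>\<alpha>. |Z x y \<alpha>| \<le>o |Kset X \<alpha>| ) \<and>
          (\<forall>\<alpha> \<beta>. (\<alpha>, \<beta>) \<in> |X| \<longrightarrow> Z x y \<alpha> \<subseteq> Z x y \<beta>) \<and>
          (\<forall>\<alpha>\<in>X. infinite (preds X \<alpha>) \<and> (x, y) \<notin> level X \<alpha> \<longrightarrow>
            (x, y) \<notin> (step {} (X - (\<Union>\<delta>\<in>preds X \<alpha>. Z x y \<delta>)))\<^sup>*)"
          unfolding Sep_def by blast
        have Zc: "|Z x y \<alpha>| \<le>o |Kset X \<alpha>|" for x y \<alpha> using Z by blast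
        obtain N where N: "\<forall>\<alpha>. stage X Z \<alpha> (\<Union>\<beta>\<in>preds X \<alpha>. N \<beta>) (N \<alpha>)"
          using filtration_exists[where Z = Z, OF Zc] by (elim exE)
        have "\<exists>A P. Thin \<rho> (N \<alpha>) A P" if \<alpha>: "\<alpha> \<in> X" for \<alpha>
        proof -
          have "|N \<alpha>| \<le>o |Kset X \<alpha>|" using spec[OF N, of \<alpha>] by (simp add: stage_def)
          then have "|N \<alpha>| <o |X|" using Kset_less[OF False \<alpha>] by (rule ordLeq_ordLess_trans)
          then have "(N \<alpha>, X) \<in> inv_image ordLess card_of" by simp
          from 1[OF this] show ?thesis using rho by blast
        qed
        then obtain a p where ap: "\<And>\<alpha>. \<alpha> \<in> X \<Longrightarrow> Thin \<rho> (N \<alpha>) (a \<alpha>) (p \<alpha>)" by metis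
        \<comment> \<open>The stages are disjoint, so their orientations are glued by taking from
          each only the part inside its stage.\<close>
        define A where "A = (\<Union>\<alpha>\<in>X. a \<alpha> \<inter> N \<alpha>)"
        have dj: "N \<alpha> \<inter> N \<beta> = {}" if "\<alpha> \<in> X" "\<beta> \<in> X" "\<alpha> \<noteq> \<beta>" for \<alpha> \<beta>
        proof -
          have "\<alpha> \<in> preds X \<beta> \<or> \<beta> \<in> preds X \<alpha>"
            using that wo_rel.TOTALS[OF wo_rel.intro[OF wo(1)]] wo(2) by (auto simp: underS_def)
          moreover have "N \<alpha> \<subseteq> X - (\<Union>\<beta>\<in>preds X \<alpha>. N \<beta>)" "N \<beta> \<subseteq> X - (\<Union>\<gamma>\<in>preds X \<beta>. N \<gamma>)"
            using spec[OF N, of \<alpha>] spec[OF N, of \<beta>] by (simp_all add: stage_def)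
          ultimately show ?thesis by blast
        qed
        have AN: "A \<inter> N \<alpha> = a \<alpha> \<inter> N \<alpha>" if "\<alpha> \<in> X" for \<alpha>
        proof -
          have "a \<beta> \<inter> N \<beta> \<inter> N \<alpha> \<subseteq> a \<alpha> \<inter> N \<alpha>" if "\<beta> \<in> X" for \<beta>
            using dj[OF that \<open>\<alpha> \<in> X\<close>] by (cases "\<beta> = \<alpha>") auto
          then show ?thesis using that unfolding A_def by blast
        qed
        have approximable_p: "approximable {} n A" if "\<alpha> \<in> X" "n \<in> p \<alpha>" for \<alpha> n
        proof -
          have "n \<subseteq> N \<alpha>" "approximable {} n (a \<alpha>)" using ap[OF that(1)] that(2) unfolding Thin_def by blast+
          moreover from this(1) have "A \<inter> n = a \<alpha> \<inter> n" using AN[OF that(1)] by blast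
          ultimately show ?thesis using approximable_cong by blast
        qed
        interpret F: filtration t h X Z N \<rho> le A
        proof
          show "uncountable X" by (fact False)
          show "Z x y \<alpha> \<subseteq> Z x y \<beta>" if "(\<alpha>, \<beta>) \<in> |X|" for x y \<alpha> \<beta> using Z that by blast
          show "(x, y) \<notin> (step {} (X - (\<Union>\<delta>\<in>preds X \<alpha>. Z x y \<delta>)))\<^sup>*"
            if "\<alpha> \<in> X" "infinite (preds X \<alpha>)" "(x, y) \<notin> level X \<alpha>" for x y \<alpha>
            using Z that by blast
          show "stage X Z \<alpha> (\<Union>\<beta>\<in>preds X \<alpha>. N \<beta>) (N \<alpha>)" for \<alpha> using N by blast
          show "trans \<rho>" "irrefl \<rho>" "total \<rho>" by (fact rho)+
          show "trans (le \<alpha>)" "level X \<alpha> \<subseteq> le \<alpha>" if "\<alpha> \<in> X" for \<alpha> using le[OF that] by blast+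
          show "(x, y) \<in> le \<alpha> \<and> (y, x) \<notin> le \<alpha>"
            if "\<alpha> \<in> X" "(x, y) \<in> \<rho>" "(x, y) \<notin> level X \<alpha>" for \<alpha> x y
            using le[OF that(1)] that(2,3) by blast
          fix \<alpha> assume \<alpha>: "\<alpha> \<in> X"
          have "approximable {} (\<Union>(p \<alpha>)) A"
            using approximable_p[OF \<alpha>] ap[OF \<alpha>] by (intro approximable_Union) (auto simp: Thin_def)
          then show "approximable {} (N \<alpha>) A" using ap[OF \<alpha>] by (simp add: Thin_def)
          show "(\<rho> \<inter> conn (N \<alpha>))\<inverse> \<inter> (step A (N \<alpha>) \<union> \<rho> \<inter> conn (N \<alpha>))\<^sup>* = {}"
            using ap[OF \<alpha>] step_cong[OF AN[OF \<alpha>]] by (simp add: Thin_def)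
        qed
        define P where "P = (\<Union>\<alpha>\<in>X. p \<alpha>)"
        have pN: "\<Union>(p \<alpha>) = N \<alpha>" if "\<alpha> \<in> X" for \<alpha> using ap[OF that] by (simp add: Thin_def)
        have "disjoint P"
        proof (rule disjointI)
          fix m n assume mn: "m \<in> P" "n \<in> P" "m \<noteq> n"
          then obtain \<alpha> \<beta> where ab: "\<alpha> \<in> X" "m \<in> p \<alpha>" "\<beta> \<in> X" "n \<in> p \<beta>" unfolding P_def by blast
          show "m \<inter> n = {}"
          proof (cases "\<alpha> = \<beta>")
            case True
            then show ?thesis using ap[OF ab(1)] ab mn(3) unfolding Thin_def by (meson disjointD)
          next
            case False
            have "m \<subseteq> N \<alpha>" "n \<subseteq> N \<beta>" using pN ab by blast+
            then show ?thesis using dj[OF ab(1,3) False] by blast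
          qed
        qed
        moreover have "\<Union>P = X"
        proof -
          have "\<Union>P = (\<Union>\<alpha>\<in>X. \<Union>(p \<alpha>))" unfolding P_def by blast
          also have "\<dots> = (\<Union>\<alpha>\<in>X. N \<alpha>)" using pN by simp
          finally have "\<Union>P = (\<Union>\<alpha>\<in>X. N \<alpha>)" .
          then show ?thesis using F.X_eq by simp
        qed
        moreover have "\<forall>n\<in>P. countable n \<and> approximable {} n A"
        proof
          fix n assume "n \<in> P"
          then obtain \<alpha> where "\<alpha> \<in> X" "n \<in> p \<alpha>" unfolding P_def by blast
          then show "countable n \<and> approximable {} n A" using approximable_p ap unfolding Thin_def by blast
        qed
        moreover have "(\<rho>\<^sub>0 \<inter> conn X)\<inverse> \<inter> (step A X \<union> (\<rho>\<^sub>0 \<inter> conn X))\<^sup>* = {}"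
        proof -
          \<comment> \<open>Pairs in \<open>conn X\<close> belong to every level, and there the
            coherent order keeps the decisions of the given one. So the condition for
            \<open>\<rho>\<close> implies the one for \<open>\<rho>\<^sub>0\<close>.\<close>
          have sub: "\<rho>\<^sub>0 \<inter> conn X \<subseteq> \<rho> \<inter> conn X"
            using rho0 conn_subset_level[OF False] by auto
          then have "(step A X \<union> (\<rho>\<^sub>0 \<inter> conn X))\<^sup>* \<subseteq> (step A X \<union> (\<rho> \<inter> conn X))\<^sup>*"
            by (intro rtrancl_mono) blast
          then show ?thesis using F.virtual_rtrancl sub by blast
        qed
        moreover have "\<exists>n\<in>P. set es \<subseteq> n"
          if es: "es \<noteq> []" "set es \<subseteq> X" "chain (src A) (dst A) u es u" "distinct (map (src A) es)" for es u
        proof -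
          obtain \<alpha> where \<alpha>: "\<alpha> \<in> X" "set es \<subseteq> N \<alpha>" using F.cycle_in_stage[OF es] by blast
          have eq: "src A e = src (a \<alpha>) e" "dst A e = dst (a \<alpha>) e" if "e \<in> set es" for e
          proof -
            have "e \<in> A \<longleftrightarrow> e \<in> a \<alpha>" using AN[OF \<alpha>(1)] \<alpha>(2) that by blast
            then show "src A e = src (a \<alpha>) e" "dst A e = dst (a \<alpha>) e" by (rule src_cong, rule dst_cong)
          qed
          have "chain (src (a \<alpha>)) (dst (a \<alpha>)) u es u"
            by (rule iffD1[OF chain_cong[OF eq] es(3)])
          moreover have "map (src A) es = map (src (a \<alpha>)) es" by (rule map_cong[OF refl eq(1)])
          then have "distinct (map (src (a \<alpha>)) es)" using es(4) by (rule subst)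
          ultimately obtain n where "n \<in> p \<alpha>" "set es \<subseteq> n"
            using ap[OF \<alpha>(1)] es(1) \<alpha>(2) unfolding Thin_def by blast
          then show ?thesis using \<alpha>(1) unfolding P_def by blast
        qed
        ultimately have "Thin \<rho>\<^sub>0 X A P" unfolding Thin_def by blast
        then show ?thesis by blast
      qed
    qed
  qed
  then have "\<exists>A P. Thin \<rho>\<^sub>0 X A P" using \<rho>\<^sub>0 by simp
  then show ?thesis by (simp only: Thin_def)
qed

end

theorem theorem1p8:
  fixes D :: "('v, 'e) pre_digraph"
  assumes "loopfree_digraph D" and "no_isolated_verts D"
  shows "\<exists>(r :: ('e \<times> nat) rel) C D'. reverts D C r D' \<and>
           (\<forall>e\<in>arcs D. finite {\<xi> \<in> Field r. e \<in> set (C \<xi>)}) \<and>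
           dichromatic_number D' \<le>o ctwo"
proof -
  interpret loopfree_digraph D by fact
  interpret ends "tail D" "head D" .
  obtain v :: "'v rel" where v: "Well_order v" "Field v = UNIV"
    using well_ordering[where 'a = 'v] by (elim exE conjE) (rule that)
  define \<rho> where "\<rho> = v - Id"
  have v': "trans v" "antisym v" "\<And>a b. (a, b) \<in> v \<or> (b, a) \<in> v"
    using v wo_rel.TOTALS[OF wo_rel.intro[OF v(1)]] by (auto simp: order_on_defs)
  have rho: "trans \<rho>" "irrefl \<rho>" "total \<rho>"
    unfolding \<rho>_def using v' by (auto intro!: transI simp: irrefl_def total_on_def dest: transD antisymD)
  obtain A1 P where "disjoint P \<and> \<Union>P = arcs D \<and> (\<forall>N\<in>P. countable N \<and> approximable {} N A1) \<and>
    (\<rho> \<inter> conn (arcs D))\<inverse> \<inter> (step A1 (arcs D) \<union> (\<rho> \<inter> conn (arcs D)))\<^sup>* = {} \<and>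
    (\<forall>es u. es \<noteq> [] \<and> set es \<subseteq> arcs D \<and> chain (src A1) (dst A1) u es u \<and> distinct (map (src A1) es) \<longrightarrow>
      (\<exists>N\<in>P. set es \<subseteq> N))"
    using thin_orientation[OF rho, of "arcs D"] by (elim exE)
  then have P: "disjoint P" "\<Union>P = arcs D" "N \<in> P \<Longrightarrow> countable N" "N \<in> P \<Longrightarrow> approximable {} N A1"
    and cyc: "es \<noteq> [] \<Longrightarrow> set es \<subseteq> arcs D \<Longrightarrow> chain (src A1) (dst A1) u es u \<Longrightarrow>
      distinct (map (src A1) es) \<Longrightarrow> \<exists>N\<in>P. set es \<subseteq> N" for N es u
    by blast+
  \<comment> \<open>The colouring starts from the orientation \<open>A1\<close>, whose cycles are
    confined to pieces; \<open>A2\<close> is relative to it, so in total the symmetric difference is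
    reversed.\<close>
  have "\<exists>A2 c. A2 \<subseteq> arcs D \<and> (\<forall>N\<in>P. approximable A1 N A2) \<and> dicolours (A1 \<oplus>\<oplus> A2) (arcs D) c"
    by (rule two_colouring[OF _ P(1,2) _ rho]) (erule (3) cyc, erule no_loops)
  then obtain A2 c where "A2 \<subseteq> arcs D \<and> (\<forall>N\<in>P. approximable A1 N A2) \<and> dicolours (A1 \<oplus>\<oplus> A2) (arcs D) c"
    by (elim exE)
  then have A2: "A2 \<subseteq> arcs D" "N \<in> P \<Longrightarrow> approximable A1 N A2" "dicolours (A1 \<oplus>\<oplus> A2) (arcs D) c" for N
    by simp_all
  \<comment> \<open>A reversion sequence changes nothing outside the arc set, where
    \<open>A1\<close> is arbitrary.\<close>
  define A where "A = (A1 \<oplus>\<oplus> A2) \<inter> arcs D"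
  have ap: "approximable {} N A" if N: "N \<in> P" for N
  proof -
    have "approximable {} N (A1 \<oplus>\<oplus> A2)" by (rule approximable_sdiff[OF P(4)[OF N]]) (simp add: A2(2)[OF N])
    moreover have "A \<inter> N = (A1 \<oplus>\<oplus> A2) \<inter> N" using N P(2) unfolding A_def by blast
    ultimately show ?thesis using approximable_cong by blast
  qed
  have "A \<subseteq> arcs D" by (simp add: A_def)
  from reverts_of_countable_pieces[OF P(1,2,3) this ap]
  obtain r\<^sub>0 :: "('e set \<times> nat) rel" and C\<^sub>0 where "reverts D C\<^sub>0 r\<^sub>0 (reverse_arcs D A)" by blast
  \<comment> \<open>The concatenation is indexed by pieces, that is, by sets of edges; bounding its
    length moves it to the required index type.\<close>
  from reverts_bounded_length[OF assms(1) this]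
  obtain r :: "('e \<times> nat) rel" and C where r: "reverts D C r (reverse_arcs D A)" by blast
  let ?D = "reverse_arcs D A"
  interpret R: loopfree_digraph ?D
    by unfold_locales (auto simp: no_loops no_loops[THEN not_sym])
  have sd: "tail ?D = src A" "head ?D = dst A" by (auto simp: src_def dst_def)
  have "dicolouring ?D c"
    unfolding dicolouring_def
  proof (intro allI impI notI)
    fix p assume "R.cycle p" and mono: "\<exists>k. \<forall>v\<in>tail ?D ` set p. c v = k"
    then obtain u where p: "p \<noteq> []" "set p \<subseteq> arcs D" "chain (src A) (dst A) u p u"
      unfolding R.cycle_iff_chain sd by auto
    have eq: "src A e = src (A1 \<oplus>\<oplus> A2) e" "dst A e = dst (A1 \<oplus>\<oplus> A2) e" if "e \<in> set p" for e
      using p(2) that by (auto simp: A_def src_def dst_def)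
    have "chain (src (A1 \<oplus>\<oplus> A2)) (dst (A1 \<oplus>\<oplus> A2)) u p u"
      by (rule iffD1[OF chain_cong[OF eq] p(3)])
    moreover have "\<exists>k. \<forall>e\<in>set p. c (src (A1 \<oplus>\<oplus> A2) e) = k"
      using mono eq(1) unfolding sd by auto
    ultimately show False using A2(3) p(1,2) unfolding dicolours_def by blast
  qed
  then have "dicolourable ?D (UNIV :: bool set)" unfolding dicolourable_def by blast
  then have "dichromatic_number ?D \<le>o ctwo"
    using dichromatic_number_le_iff[OF R.loopfree_digraph_axioms, of "UNIV :: bool set"] by (simp add: ctwo_def)
  then show ?thesis using r reverts_finite[OF assms(1) r] by blast
qed

end
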